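(* Let $\Omega\subset\mathbb{R}^n$, $n\ge4$, be a smooth bounded domain containing $0$ and let $R=\sup_{x\in\Omega}|x|$. Then the following hold for all $u\in H^2(\Omega)\cap H_0^1(\Omega)$: (1) If $k\ge1$ and $\rho=R\,E_k$, then $$\int_\Omega|\Delta u|^2dx\ge\frac{n^2(n-4)^2}{16}\int_\Omega\frac{u^2}{|x|^4}dx+\Big(1+\frac{n(n-4)}{8}\Big)\sum_{j=1}^k\int_\Omega\frac{u^2}{|x|^4}\Big(\prod_{i=1}^j\log^{(i)}\frac{\rho}{|x|}\Big)^{-2}dx .$$ (2) If $D\ge R$, then $$\int_\Omega|\Delta u|^2dx\ge\frac{n^2(n-4)^2}{16}\int_\Omega\frac{u^2}{|x|^4}dx+\Big(1+\frac{n(n-4)}{8}\Big)\sum_{i=1}^\infty\int_\Omega\frac{u^2}{|x|^4}X_1^2\Big(\frac{|x|}{D}\Big)X_2^2\Big(\frac{|x|}{D}\Big)\cdots X_i^2\Big(\frac{|x|}{D}\Big)dx .$$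
   Context: $E_k$ is the exponential tower with $k$ copies of $e$: $E_1=e$, $E_{k+1}=e^{E_k}$. $\log^{(1)}=\log$ and $\log^{(k)}(\cdot)=\log(\log^{(k-1)}(\cdot))$ for $k\ge2$. $X_1(t)=(1-\log t)^{-1}$ and $X_k(t)=X_1(X_{k-1}(t))$ for $k\ge2$. *)

theory Defs
  imports "HOL-Analysis.Analysis"
begin

definition partial :: "'n \<Rightarrow> (real^'n \<Rightarrow> real) \<Rightarrow> real^'n \<Rightarrow> real" where
  "partial i f x = frechet_derivative f (at x) (axis i 1)"

(* A multi-index is a list of directions; the order of the derivative is its length. *)
primrec iter_partial :: "'n list \<Rightarrow> (real^'n \<Rightarrow> real) \<Rightarrow> real^'n \<Rightarrow> real" where
  "iter_partial [] f = f"
| "iter_partial (i # is) f = partial i (iter_partial is f)"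

definition smooth :: "(real^'n \<Rightarrow> real) \<Rightarrow> bool" where
  "smooth f \<longleftrightarrow> (\<forall>is x. iter_partial is f differentiable (at x))"

(* Near each boundary point the domain is, after relabelling and reorienting the axes,
   the region above the graph of a smooth function of the remaining n - 1 coordinates;
   such a function is encoded as one on the whole space that is constant along axis i. *)
definition smooth_boundary :: "(real^'n) set \<Rightarrow> bool" where
  "smooth_boundary \<Omega> \<longleftrightarrow>
     (\<forall>p\<in>frontier \<Omega>. \<exists>r>0. \<exists>i. \<exists>s\<in>{1, -1}. \<exists>\<gamma>.
        smooth \<gamma> \<and> (\<forall>x t. \<gamma> (x + t *\<^sub>R axis i 1) = \<gamma> x) \<and>
        \<Omega> \<inter> ball p r = {x \<in> ball p r. s * x $ i > \<gamma> x})"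

definition smooth_bounded_domain :: "(real^'n) set \<Rightarrow> bool" where
  "smooth_bounded_domain \<Omega> \<longleftrightarrow>
     open \<Omega> \<and> connected \<Omega> \<and> \<Omega> \<noteq> {} \<and> bounded \<Omega> \<and> smooth_boundary \<Omega>"

definition test_functions :: "(real^'n) set \<Rightarrow> (real^'n \<Rightarrow> real) set" where
  "test_functions \<Omega> =
     {\<phi>. smooth \<phi> \<and> compact (closure {x. \<phi> x \<noteq> 0}) \<and> closure {x. \<phi> x \<noteq> 0} \<subseteq> \<Omega>}"

definition locally_integrable :: "(real^'n) set \<Rightarrow> (real^'n \<Rightarrow> real) \<Rightarrow> bool" where
  "locally_integrable \<Omega> f \<longleftrightarrow>
     (\<forall>K. compact K \<longrightarrow> K \<subseteq> \<Omega> \<longrightarrow> f absolutely_integrable_on K)"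

(* Elements of the function spaces below are representatives, not classes modulo null sets. *)
definition L2 :: "(real^'n) set \<Rightarrow> (real^'n \<Rightarrow> real) set" where
  "L2 \<Omega> = {f. f \<in> borel_measurable (lebesgue_on \<Omega>) \<and>
              integrable (lebesgue_on \<Omega>) (\<lambda>x. (f x)\<^sup>2)}"

definition has_weak_deriv ::
  "(real^'n) set \<Rightarrow> 'n list \<Rightarrow> (real^'n \<Rightarrow> real) \<Rightarrow> (real^'n \<Rightarrow> real) \<Rightarrow> bool" where
  "has_weak_deriv \<Omega> is u v \<longleftrightarrow>
     locally_integrable \<Omega> u \<and> locally_integrable \<Omega> v \<and>
     (\<forall>\<phi>\<in>test_functions \<Omega>.
        (LINT x|lebesgue_on \<Omega>. u x * iter_partial is \<phi> x)
          = (-1) ^ length is * (LINT x|lebesgue_on \<Omega>. v x * \<phi> x))"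

(* Weak derivatives are unique up to null sets, so the choice of representative is harmless. *)
definition weak_deriv ::
  "(real^'n) set \<Rightarrow> 'n list \<Rightarrow> (real^'n \<Rightarrow> real) \<Rightarrow> real^'n \<Rightarrow> real" where
  "weak_deriv \<Omega> is u = (SOME v. has_weak_deriv \<Omega> is u v)"

definition sobolev_H :: "nat \<Rightarrow> (real^'n) set \<Rightarrow> (real^'n \<Rightarrow> real) set" where
  "sobolev_H m \<Omega> = {u \<in> L2 \<Omega>. \<forall>is. length is \<le> m \<longrightarrow>
     (\<exists>v. has_weak_deriv \<Omega> is u v) \<and> weak_deriv \<Omega> is u \<in> L2 \<Omega>}"

(* The closure of the test functions in the norm of H^1; the limits of the zeroth and
   first order parts of the squared norm of u - \<phi> m are stated separately. *)
definition sobolev_H10 :: "(real^'n) set \<Rightarrow> (real^'n \<Rightarrow> real) set" where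
  "sobolev_H10 \<Omega> = {u \<in> sobolev_H 1 \<Omega>. \<exists>\<phi> :: nat \<Rightarrow> real^'n \<Rightarrow> real.
     (\<forall>m. \<phi> m \<in> test_functions \<Omega>) \<and>
     (\<lambda>m. LINT x|lebesgue_on \<Omega>. (u x - \<phi> m x)\<^sup>2) \<longlonglongrightarrow> 0 \<and>
     (\<forall>i. (\<lambda>m. LINT x|lebesgue_on \<Omega>. (weak_deriv \<Omega> [i] u x - partial i (\<phi> m) x)\<^sup>2)
            \<longlonglongrightarrow> 0)}"

definition weak_laplacian :: "(real^'n) set \<Rightarrow> (real^'n \<Rightarrow> real) \<Rightarrow> real^'n \<Rightarrow> real" where
  "weak_laplacian \<Omega> u x = (\<Sum>i\<in>UNIV. weak_deriv \<Omega> [i, i] u x)"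

(* Meaningful for k \<ge> 1: exp_tower 1 = e and exp_tower (Suc k) = exp (exp_tower k). *)
definition exp_tower :: "nat \<Rightarrow> real" where
  "exp_tower k = (exp ^^ k) 1"

definition iter_log :: "nat \<Rightarrow> real \<Rightarrow> real" where
  "iter_log k = ln ^^ k"

definition X :: "nat \<Rightarrow> real \<Rightarrow> real" where
  "X k = (\<lambda>t. inverse (1 - ln t)) ^^ k"

end

theory Submission
  imports Defs
begin

text \<open>
  If \<open>\<phi> > 0\<close> is radial, \<open>w = - \<Delta>\<phi> / \<phi> \<ge> 0\<close> and \<open>u\<close> vanishes on the boundary, then
  \<open>(\<Delta>u + w u)\<^sup>2 \<ge> 0\<close> together with \<open>w |\<nabla>u - u \<nabla>\<phi> / \<phi>|\<^sup>2 \<ge> 0\<close> and two integrations by parts gives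
  \<open>\<integral> (\<Delta>u)\<^sup>2 \<ge> \<integral> (\<Delta>\<^sup>2\<phi> / \<phi>) u\<^sup>2\<close>; every boundary term contains
  a factor \<open>u\<close>. For \<open>\<phi> = |x|\<^bsup>2 - n/2\<^esup> f(ln (\<rho> / |x|))\<close> one has
  \<open>|x|\<^sup>4 \<Delta>\<^sup>2\<phi> / \<phi> = (f'''' - m f'' + A\<^sup>2 f) / f\<close> with \<open>A = n (n - 4) / 4\<close> and \<open>m = 2 A + 4\<close>. The function
  \<open>F = (L\<^sub>1 \<cdots> L\<^sub>k)\<^bsup>1/2\<^esup>\<close> built from the logarithms \<open>L\<^sub>i\<close> satisfies \<open>F'' = - S F / 4\<close> with
  \<open>S = \<Sum>\<^sub>j (L\<^sub>1 \<cdots> L\<^sub>j)\<^sup>-\<^sup>2\<close>, and solving \<open>f - f'' / m = F\<close> with \<open>0 < f \<le> F\<close> yields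
  \<open>f'''' - m f'' = m S F / 4 \<ge> (1 + A / 2) S f\<close>, which is the claim. Near the origin \<open>w\<close> is truncated.
\<close>

section \<open>A radial comparison function\<close>

text \<open>Test functions are not dense in \<open>H^2 \<inter> H_0^1\<close> for the
  \<open>H^2\<close> norm, so the inequality cannot be proved for them and then extended. The
  Laplacian is therefore eliminated for \<open>u\<close> itself by a weak Green formula; the
  remaining quadratic form contains only \<open>u\<close> and its first derivatives, survives an
  \<open>H^1\<close> limit, and may be estimated on test functions. The exponent
  \<open>2 - n/2\<close> is a centre of symmetry: on \<open>f = exp (\<lambda> t)\<close> the
  bilaplacian acts as \<open>(\<lambda>^2 - 2 \<lambda> - A) (\<lambda>^2 + 2 \<lambda> - A) =
  \<lambda>^4 - m \<lambda>^2 + A^2\<close>, which is even in \<lambda>. The constant term is the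
  Rellich constant, and \<open>m / 4 = 1 + n (n - 4) / 8\<close> is that of the logarithmic terms.
  For \<open>n = 4\<close> one has \<open>A = 0\<close>, and \<open>|x|^2 w\<close> may tend to 0 at
  the origin. The truncation needs \<open>w\<close> itself to blow up there; this is why a lower
  bound of order \<open>exp (- t)\<close>, that is of order \<open>|x|\<close>, is carried along for
  the logarithmic derivatives.\<close>

lemma antiderivative_from:
  fixes h :: "real \<Rightarrow> real"
  assumes "\<And>t. t > a \<Longrightarrow> isCont h t" and "a < b"
  obtains H where "continuous_on {b..} H" "H b = 0"
    "\<And>t. t > b \<Longrightarrow> (H has_real_derivative h t) (at t)"
proof -
  define H where "H t = integral {b..t} h" for t
  have cont: "continuous_on {b..c} h" for c
    using assms by (auto intro!: continuous_at_imp_continuous_on)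
  have d: "(H has_real_derivative h t) (at t within {b..c})" if "t \<in> {b..c}" for t c
    unfolding H_def by (rule integral_has_real_derivative[OF cont that])
  show thesis
  proof
    show "continuous_on {b..} H"
      unfolding continuous_on_eq_continuous_within
    proof
      fix t assume t: "t \<in> {b..}"
      have "continuous (at t within {b..t+1}) H"
        using d[of t "t+1"] t by (auto intro: DERIV_continuous)
      moreover have "at t within {b..t+1} = at t within {b..}"
        using t by (intro at_within_nhd[of t "{t-1<..<t+1}"]) auto
      ultimately show "continuous (at t within {b..}) H" by simp
    qed
    show "H b = 0" by (simp add: H_def)
    fix t assume t: "t > b"
    have "at t within {b..t+1} = at t"
      using t by (intro at_within_interior) auto
    then show "(H has_real_derivative h t) (at t)"
      using d[of t "t+1"] t by auto
  qed
qed

text \<open>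
  Given \<open>F'' = - S F / 4\<close> (with \<open>p = F' / F\<close>), the function \<open>f\<close> constructed here solves
  \<open>f'' = \<mu>\<^sup>2 (f - F)\<close>, in two first-order steps \<open>g' = \<mu> (g - F)\<close> and \<open>f' = \<mu> (g - f)\<close>; the first
  one singles out the solution that does not grow exponentially. The result is stated for
  \<open>y = f' / f\<close> and \<open>q = F / f\<close>. The point is \<open>q \<ge> 1\<close>: it gives
  \<open>f'''' - \<mu>\<^sup>2 f'' = \<mu>\<^sup>2 S F / 4 \<ge> \<mu>\<^sup>2 S f / 4\<close>, which \<open>f = F\<close> itself violates because
  \<open>F'''' < 0\<close> is possible.
\<close>

lemma bounded_solution_quotients:
  fixes F p S :: "real \<Rightarrow> real" and \<mu> :: real
  assumes \<mu>: "\<mu> > 0" and ab: "a < b"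
    and Fpos: "\<And>t. t > a \<Longrightarrow> F t > 0"
    and F': "\<And>t. t > a \<Longrightarrow> (F has_real_derivative F t * p t) (at t)"
    and p': "\<And>t. t > a \<Longrightarrow> (p has_real_derivative - S t / 4 - (p t)\<^sup>2) (at t)"
    and S: "\<And>t. t > a \<Longrightarrow> S t \<ge> 0"
    and p: "\<And>t. t > a \<Longrightarrow> p t \<ge> exp (-t) / 2"
  obtains y q :: "real \<Rightarrow> real" and c where "c > 0"
    "\<And>t. t > b \<Longrightarrow> (y has_real_derivative \<mu>\<^sup>2 * (1 - q t) - (y t)\<^sup>2) (at t)"
    "\<And>t. t > b \<Longrightarrow> (q has_real_derivative q t * (p t - y t)) (at t)"
    "\<And>t. t > b \<Longrightarrow> y t \<ge> c * exp (-t)" "\<And>t. t > b \<Longrightarrow> q t \<ge> 1"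
proof -
  \<comment> \<open>The first integration starts at \<open>b0\<close> and is controlled only to the
    right of it; the second one starts at \<open>b\<close> and needs \<open>g\<close> to be
    continuous at \<open>b\<close>. Hence a point strictly between \<open>a\<close> and
    \<open>b\<close>.\<close>
  define b0 where "b0 = (a + b) / 2"
  have b0: "a < b0" "b0 < b" using ab by (auto simp: b0_def)
  \<comment> \<open>With this value the term \<open>\<kappa> * (\<mu> + 1) * exp (-t)\<close> in the
    derivative of \<open>L\<close> is exactly the assumed lower bound for \<open>p\<close>.\<close>
  define \<kappa> where "\<kappa> = 1 / (2 * (\<mu> + 1))"
  have \<kappa>: "\<kappa> > 0" "\<kappa> * (\<mu> + 1) = 1/2" using \<mu> by (auto simp: \<kappa>_def)
  have ppos: "p t > 0" if "t > a" for t using p[OF that] by (smt (verit) exp_gt_zero half_gt_zero)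
  have contF: "isCont F t" if "t > a" for t using F'[OF that] DERIV_isCont by blast
  \<comment> \<open>The equation \<open>g' = \<mu> (g - F)\<close> says that
    \<open>exp (-\<mu>*t) * g t + I t\<close> is constant, so its solutions are
    \<open>exp (\<mu>*t) * (C - I t)\<close>.\<close>
  obtain I where I: "\<And>t. t > b0 \<Longrightarrow> (I has_real_derivative \<mu> * exp (-\<mu>*t) * F t) (at t)"
    by (rule antiderivative_from[of a "\<lambda>t. \<mu> * exp (-\<mu>*t) * F t" b0])
       (use b0 contF in \<open>auto intro!: continuous_intros\<close>)
  \<comment> \<open>Barriers for \<open>C\<close>: \<open>C \<le> U t\<close> means
    \<open>g t \<le> F t * (1 + p t / \<mu>)\<close>, and \<open>L t \<le> C\<close> means
    \<open>g t \<ge> F t * (1 + \<kappa> * exp (-t))\<close>. \<open>U\<close> decreases because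
    \<open>p' + p^2 \<le> 0\<close>, and \<open>L\<close> increases because of the lower bound for
    \<open>p\<close>.\<close>
  define U where "U t = I t + exp (-\<mu>*t) * F t * (1 + p t / \<mu>)" for t
  define L where "L t = I t + exp (-\<mu>*t) * F t * (1 + \<kappa> * exp (-t))" for t
  have U': "(U has_real_derivative - exp (-\<mu>*t) * F t * S t / (4*\<mu>)) (at t)" if "t > b0" for t
    unfolding U_def using that b0 \<mu>
    by (auto intro!: derivative_eq_intros I F' p' simp: field_simps power2_eq_square)
  have L': "(L has_real_derivative exp (-\<mu>*t) * F t * (p t * (1 + \<kappa> * exp (-t)) - \<kappa> * (\<mu> + 1) * exp (-t))) (at t)"
    if "t > b0" for t
    unfolding L_def using that b0 \<mu>
    by (auto intro!: derivative_eq_intros I F' p' simp: field_simps power2_eq_square)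
  have Umono: "U t \<le> U s" if "b0 < s" "s \<le> t" for s t
  proof (rule DERIV_nonpos_imp_nonincreasing[OF \<open>s \<le> t\<close>])
    fix x assume "s \<le> x" "x \<le> t"
    with that b0 have x: "x > b0" "x > a" by auto
    have "- exp (-\<mu>*x) * F x * S x / (4*\<mu>) \<le> 0"
      using S[OF x(2)] Fpos[OF x(2)] \<mu> by (simp add: zero_le_divide_iff)
    then show "\<exists>y. DERIV U x :> y \<and> y \<le> 0"
      using U'[OF x(1)] by blast
  qed
  have Lmono: "L s \<le> L t" if "b0 < s" "s \<le> t" for s t
  proof (rule DERIV_nonneg_imp_nondecreasing[OF \<open>s \<le> t\<close>])
    fix x assume "s \<le> x" "x \<le> t"
    with that b0 have x: "x > b0" "x > a" by auto
    have "p x * 1 \<le> p x * (1 + \<kappa> * exp (-x))"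
      using ppos[OF x(2)] \<kappa> by (intro mult_left_mono) auto
    moreover have "\<kappa> * (\<mu> + 1) * exp (-x) \<le> p x" using p[OF x(2)] unfolding \<kappa>(2) by simp
    ultimately have "p x * (1 + \<kappa> * exp (-x)) - \<kappa> * (\<mu> + 1) * exp (-x) \<ge> 0"
      by linarith
    then have "exp (-\<mu>*x) * F x * (p x * (1 + \<kappa> * exp (-x)) - \<kappa> * (\<mu> + 1) * exp (-x)) \<ge> 0"
      using Fpos[OF x(2)] by (intro mult_nonneg_nonneg) auto
    then show "\<exists>y. DERIV L x :> y \<and> 0 \<le> y"
      using L'[OF x(1)] by blast
  qed
  have LU: "L t \<le> U t" if "t > b0" for t
  proof -
    have "\<kappa> * exp (-t) \<le> p t / \<mu>"
    proof -
      have "\<kappa> * exp (-t) * \<mu> \<le> (\<kappa> * (\<mu> + 1)) * exp (-t)" using \<kappa> \<mu> by (simp add: algebra_simps)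
      also have "\<dots> \<le> p t" using p[of t] that b0 unfolding \<kappa>(2) by simp
      finally show ?thesis using \<mu> by (simp add: pos_le_divide_eq)
    qed
    then show ?thesis unfolding L_def U_def using Fpos[of t] that b0 by (auto intro!: mult_left_mono)
  qed
  \<comment> \<open>Any number above all values of \<open>L\<close> and below all values of
    \<open>U\<close> serves. It plays the part of the limit of \<open>I\<close> at infinity, whose
    existence need not be shown.\<close>
  define C where "C = (SUP t\<in>{b0<..}. L t)"
  have LUst: "L s \<le> U t" if "s > b0" "t > b0" for s t
  proof -
    have m: "max s t > b0" using that by auto
    show ?thesis using Lmono[of s "max s t"] LU[OF m] Umono[of t "max s t"] that by linarith
  qed
  have CL: "L t \<le> C" if "t > b0" for t
    unfolding C_def using that LUst by (intro cSUP_upper bdd_aboveI2[of _ _ "U (b0+1)"]) auto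
  have CU: "C \<le> U t" if "t > b0" for t
    unfolding C_def using that LUst by (intro cSUP_least) auto
  define g where "g t = exp (\<mu>*t) * (C - I t)" for t
  have g': "(g has_real_derivative \<mu> * (g t - F t)) (at t)" if "t > b0" for t
    unfolding g_def using that
    by (auto intro!: derivative_eq_intros I simp: algebra_simps exp_minus)
  have gL: "g t \<ge> F t * (1 + \<kappa> * exp (-t))" if "t > b0" for t
  proof -
    have "exp (-\<mu>*t) * F t * (1 + \<kappa> * exp (-t)) \<le> C - I t" using CL[OF that] by (simp add: L_def)
    then have "exp (\<mu>*t) * (exp (-\<mu>*t) * F t * (1 + \<kappa> * exp (-t))) \<le> g t"
      unfolding g_def by (intro mult_left_mono) auto
    then show ?thesis by (simp add: mult.assoc[symmetric] exp_add[symmetric])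
  qed
  have gU: "g t \<le> F t * (1 + p t / \<mu>)" if "t > b0" for t
  proof -
    have "C - I t \<le> exp (-\<mu>*t) * F t * (1 + p t / \<mu>)" using CU[OF that] by (simp add: U_def)
    then have "g t \<le> exp (\<mu>*t) * (exp (-\<mu>*t) * F t * (1 + p t / \<mu>))"
      unfolding g_def by (intro mult_left_mono) auto
    then show ?thesis by (simp add: mult.assoc[symmetric] exp_add[symmetric])
  qed
  have gpos: "g t \<ge> 0" if "t > b0" for t
    using gL[OF that] Fpos[of t] that b0 \<kappa> by (intro order_trans[OF _ gL[OF that]]) (auto intro!: mult_nonneg_nonneg)
  have contg: "isCont g t" if "t > b0" for t using g'[OF that] DERIV_isCont by blast
  obtain J where Jc: "continuous_on {b..} J" and J0: "J b = 0"
    and J: "\<And>t. t > b \<Longrightarrow> (J has_real_derivative \<mu> * exp (\<mu>*t) * g t) (at t)"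
    by (rule antiderivative_from[of b0 "\<lambda>t. \<mu> * exp (\<mu>*t) * g t" b])
       (use b0 contg in \<open>auto intro!: continuous_intros\<close>)
  have Jpos: "J t \<ge> 0" if "t > b" for t
  proof -
    have "J b \<le> J t"
    proof (rule DERIV_nonneg_imp_increasing_open[of b t J])
      show "\<exists>y. DERIV J x :> y \<and> 0 \<le> y" if "b < x" "x < t" for x
      proof -
        have "0 \<le> \<mu> * exp (\<mu>*x) * g x" using gpos[of x] that b0 \<mu> by simp
        then show ?thesis using J[OF that(1)] by blast
      qed
    qed (use that Jc in \<open>auto intro: continuous_on_subset\<close>)
    then show ?thesis using J0 by simp
  qed
  \<comment> \<open>The initial value is \<open>f b = F b\<close>, the largest one compatible with
    \<open>f \<le> F\<close>.\<close>
  define f where "f t = exp (-\<mu>*t) * (J t + exp (\<mu>*b) * F b)" for t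
  have f': "(f has_real_derivative \<mu> * (g t - f t)) (at t)" if "t > b" for t
    unfolding f_def using that
    by (auto intro!: derivative_eq_intros J simp: algebra_simps exp_minus)
  have fpos: "f t > 0" if "t > b" for t
    unfolding f_def using Jpos[OF that] Fpos[OF ab] by (auto intro!: mult_pos_pos add_nonneg_pos)
  have fF: "f t \<le> F t" if "t > b" for t
  proof -
    \<comment> \<open>\<open>D t - D b\<close> is \<open>exp (\<mu>*t) * (F t - f t)\<close>, and
      \<open>D\<close> increases by the upper barrier for \<open>g\<close>.\<close>
    define D where "D t = exp (\<mu>*t) * F t - J t" for t
    have "D b \<le> D t"
    proof (rule DERIV_nonneg_imp_increasing_open[of b t D])
      fix x assume x: "b < x" "x < t"
      have "(D has_real_derivative exp (\<mu>*x) * (\<mu> * F x + F x * p x - \<mu> * g x)) (at x)"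
        unfolding D_def using x ab
        by (auto intro!: derivative_eq_intros J F' simp: algebra_simps)
      moreover have "\<mu> * g x \<le> \<mu> * F x + F x * p x"
        using mult_left_mono[OF gU[of x], of \<mu>] x b0 \<mu> by (simp add: algebra_simps)
      moreover from this have "0 \<le> exp (\<mu>*x) * (\<mu> * F x + F x * p x - \<mu> * g x)" by simp
      ultimately show "\<exists>y. DERIV D x :> y \<and> 0 \<le> y" by blast
    next
      have "continuous_on {b..t} J" using Jc by (rule continuous_on_subset) auto
      moreover have "continuous_on {b..t} F"
        using contF ab by (intro continuous_at_imp_continuous_on) auto
      ultimately show "continuous_on {b..t} D"
        unfolding D_def by (intro continuous_intros)
    qed (use that in auto)
    then have "exp (-\<mu>*t) * (J t + exp (\<mu>*b) * F b) \<le> exp (-\<mu>*t) * (exp (\<mu>*t) * F t)"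
      using J0 by (intro mult_left_mono) (auto simp: D_def)
    then show ?thesis unfolding f_def by (simp add: mult.assoc[symmetric] exp_add[symmetric])
  qed
  \<comment> \<open>Here \<open>f' / f = \<mu> * (g / f - 1)\<close>; the lower barrier for
    \<open>g\<close> together with \<open>f \<le> F\<close> gives the constant
    \<open>\<mu> * \<kappa>\<close>.\<close>
  show thesis
  proof (rule that[of "\<mu> * \<kappa>" "\<lambda>t. \<mu> * (g t / f t - 1)" "\<lambda>t. F t / f t"])
    show "0 < \<mu> * \<kappa>" using \<mu> \<kappa> by simp
    fix t assume t: "t > b"
    then have tt: "t > b0" "t > a" using b0 by auto
    note f = fpos[OF t]
    show "((\<lambda>t. \<mu> * (g t / f t - 1)) has_real_derivative \<mu>\<^sup>2 * (1 - F t / f t) - (\<mu> * (g t / f t - 1))\<^sup>2) (at t)"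
      using f t tt by (auto intro!: derivative_eq_intros g' f' simp: field_simps power2_eq_square)
    show "((\<lambda>t. F t / f t) has_real_derivative F t / f t * (p t - \<mu> * (g t / f t - 1))) (at t)"
      using f t tt by (auto intro!: derivative_eq_intros F' f' simp: field_simps power2_eq_square)
    show "1 \<le> F t / f t" using f fF[OF t] by simp
    have "f t * (1 + \<kappa> * exp (-t)) \<le> g t"
      using mult_right_mono[OF fF[OF t], of "1 + \<kappa> * exp (-t)"] \<kappa> gL[OF tt(1)]
      by (auto intro: order_trans add_nonneg_nonneg)
    then have "\<kappa> * exp (-t) \<le> g t / f t - 1" using f by (simp add: field_simps)
    then show "\<mu> * \<kappa> * exp (-t) \<le> \<mu> * (g t / f t - 1)"
      using \<mu> by (simp add: mult.assoc mult_left_mono)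
  qed
qed

text \<open>
  At \<open>t = ln (\<rho> / |x|)\<close> the chain consists of the iterated logarithms of \<open>\<rho> / |x|\<close> for \<open>c = 0\<close>, and
  of the reciprocals of \<open>X\<^sub>1, X\<^sub>2, \<dots>\<close> at \<open>|x| / D\<close> for \<open>c = 1\<close> and \<open>\<rho> = e D\<close>.
\<close>

primrec log_chain :: "real \<Rightarrow> nat \<Rightarrow> real \<Rightarrow> real" where
  "log_chain c 0 = (\<lambda>t. t)"
| "log_chain c (Suc i) = (\<lambda>t. c + ln (log_chain c i t))"

text \<open>Where the members up to \<open>j\<close> are positive, this is the derivative of
  \<open>log_chain c (Suc j)\<close>.\<close>

definition log_pot :: "real \<Rightarrow> nat \<Rightarrow> real \<Rightarrow> real" where
  "log_pot c j t = (\<Prod>i\<le>j. inverse (log_chain c i t))"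

text \<open>Twice the logarithmic derivative of \<open>F\<close>, the square root of the product of
  the chain.\<close>

definition log_pot_sum :: "real \<Rightarrow> nat \<Rightarrow> real \<Rightarrow> real" where
  "log_pot_sum c j t = (\<Sum>i\<le>j. log_pot c i t)"

lemma log_chain_deriv:
  assumes "\<And>i. i < j \<Longrightarrow> log_chain c i t > 0"
  shows "(log_chain c j has_real_derivative (\<Prod>i<j. inverse (log_chain c i t))) (at t)"
  using assms
proof (induction j)
  case (Suc j)
  have "(log_chain c j has_real_derivative (\<Prod>i<j. inverse (log_chain c i t))) (at t)"
    using Suc by auto
  moreover have "log_chain c j t > 0" using Suc.prems by auto
  ultimately show ?case
    by (auto intro!: derivative_eq_intros simp: field_simps)
qed simp

text \<open>Logarithmic differentiation: each factor contributes \<open>L_i' / L_i\<close>, which is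
  \<open>log_pot c i\<close>.\<close>

lemma log_pot_deriv:
  assumes "\<And>i. i \<le> j \<Longrightarrow> log_chain c i t > 0"
  shows "(log_pot c j has_real_derivative - log_pot c j t * log_pot_sum c j t) (at t)"
  using assms
proof (induction j)
  case 0
  then show ?case
    by (auto intro!: derivative_eq_intros simp: log_pot_def log_pot_sum_def fun_eq_iff field_simps power2_eq_square)
next
  case (Suc j)
  have IH: "(log_pot c j has_real_derivative - log_pot c j t * log_pot_sum c j t) (at t)"
    using Suc by auto
  have pos: "log_chain c (Suc j) t > 0" using Suc.prems by blast
  have d: "(log_chain c (Suc j) has_real_derivative log_pot c j t) (at t)"
    using log_chain_deriv[of "Suc j" c t] Suc.prems by (simp add: log_pot_def lessThan_Suc_atMost del: log_chain.simps)
  have eq: "log_pot c (Suc j) = (\<lambda>t. log_pot c j t * inverse (log_chain c (Suc j) t))"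
    by (simp add: log_pot_def fun_eq_iff del: log_chain.simps)
  have "((\<lambda>t. log_pot c j t * inverse (log_chain c (Suc j) t)) has_real_derivative
     - log_pot c (Suc j) t * log_pot_sum c (Suc j) t) (at t)"
    using pos by (auto intro!: derivative_eq_intros IH d simp: log_pot_sum_def field_simps power2_eq_square eq simp del: log_chain.simps)
  then show ?case by (simp only: eq)
qed

text \<open>Termwise differentiation gives \<open>- (\<Sum>i. P i * (\<Sum>l\<le>i. P l))\<close>
  with \<open>P i = log_pot c i t\<close>; symmetrising this triangular double sum yields half the
  square of the sum plus half the sum of the squares.\<close>

lemma log_pot_sum_deriv:
  assumes "\<And>i. i \<le> j \<Longrightarrow> log_chain c i t > 0"
  shows "(log_pot_sum c j has_real_derivative
    - ((log_pot_sum c j t)\<^sup>2 + (\<Sum>i\<le>j. (log_pot c i t)\<^sup>2)) / 2) (at t)"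
  using assms
proof (induction j)
  case 0
  have "log_pot_sum c 0 = log_pot c 0" by (simp add: log_pot_sum_def fun_eq_iff)
  then show ?case using log_pot_deriv[of 0 c t] 0 by (simp add: power2_eq_square)
next
  case (Suc j)
  have eq: "log_pot_sum c (Suc j) = (\<lambda>t. log_pot_sum c j t + log_pot c (Suc j) t)"
    by (simp add: log_pot_sum_def fun_eq_iff)
  have "((\<lambda>t. log_pot_sum c j t + log_pot c (Suc j) t) has_real_derivative
     - ((log_pot_sum c (Suc j) t)\<^sup>2 + (\<Sum>i\<le>Suc j. (log_pot c i t)\<^sup>2)) / 2) (at t)"
    using Suc by (auto intro!: derivative_eq_intros log_pot_deriv simp: eq field_simps power2_eq_square)
  then show ?case by (simp only: eq)
qed

text \<open>Verifies the hypotheses of \<open>bounded_solution_quotients\<close>. The square root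
  normalises the derivative of \<open>log_pot_sum\<close> to a Riccati equation with coefficient 1
  before \<open>p^2\<close>, equivalent to \<open>F'' = - S F / 4\<close>. The lower bound comes
  from the first summand \<open>1 / t\<close> alone.\<close>

lemma sqrt_log_chain_prod:
  fixes c :: real and k :: nat
  defines "F \<equiv> \<lambda>t. sqrt (\<Prod>i\<le>k. log_chain c i t)"
  assumes pos: "\<And>i. i \<le> k \<Longrightarrow> log_chain c i t > 0"
  shows "F t > 0" "(F has_real_derivative F t * (log_pot_sum c k t / 2)) (at t)"
    "((\<lambda>t. log_pot_sum c k t / 2) has_real_derivative
       - (\<Sum>i\<le>k. (log_pot c i t)\<^sup>2) / 4 - (log_pot_sum c k t / 2)\<^sup>2) (at t)"
    "log_pot_sum c k t / 2 \<ge> exp (-t) / 2"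
proof -
  have prod: "(\<Prod>i\<le>k. log_chain c i t) > 0" using pos by (intro prod_pos) auto
  then show "F t > 0" by (simp add: F_def)
  have Pp: "log_pot c i t > 0" if "i \<le> k" for i
    unfolding log_pot_def using pos that by (intro prod_pos) auto
  have FQ: "F = (\<lambda>t. inverse (sqrt (log_pot c k t)))"
    by (simp add: F_def log_pot_def fun_eq_iff real_sqrt_inverse prod_inversef[unfolded o_def])
  show "(F has_real_derivative F t * (log_pot_sum c k t / 2)) (at t)"
    unfolding FQ using Pp[of k]
    by (auto intro!: derivative_eq_intros log_pot_deriv pos simp: field_simps power2_eq_square)
  show "((\<lambda>t. log_pot_sum c k t / 2) has_real_derivative
       - (\<Sum>i\<le>k. (log_pot c i t)\<^sup>2) / 4 - (log_pot_sum c k t / 2)\<^sup>2) (at t)"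
    by (auto intro!: derivative_eq_intros log_pot_sum_deriv pos simp: field_simps power2_eq_square)
  have t: "t > 0" using pos[of 0] by simp
  have "exp (-t) \<le> inverse t"
  proof -
    have "t \<le> exp t" using exp_ge_add_one_self[of t] by linarith
    then show ?thesis using t by (simp add: exp_minus le_imp_inverse_le)
  qed
  also have "inverse t = log_pot c 0 t" by (simp add: log_pot_def)
  also have "\<dots> \<le> log_pot_sum c k t"
    unfolding log_pot_sum_def using Pp by (intro member_le_sum) (auto intro: less_imp_le)
  finally show "log_pot_sum c k t / 2 \<ge> exp (-t) / 2" by simp
qed

text \<open>The closure of the domain may touch \<open>|x| = R\<close>, that is
  \<open>t = ln (\<rho> / R)\<close>, so the profile has to exist slightly beyond this end
  point.\<close>

lemma log_chain_pos_left:
  assumes "\<And>t i. t \<ge> t0 \<Longrightarrow> i \<le> k \<Longrightarrow> log_chain c i t > 0"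
  obtains a where "a < t0" "\<And>t i. t > a \<Longrightarrow> i \<le> k \<Longrightarrow> log_chain c i t > 0"
proof -
  have "\<forall>\<^sub>F t in at_left t0. \<forall>i\<in>{..k}. log_chain c i t > 0"
  proof (rule eventually_ball_finite)
    show "\<forall>i\<in>{..k}. \<forall>\<^sub>F t in at_left t0. log_chain c i t > 0"
    proof
      fix i assume i: "i \<in> {..k}"
      have "isCont (log_chain c i) t0"
        using log_chain_deriv[of i c t0] assms i by (intro DERIV_isCont) auto
      then have "(log_chain c i \<longlongrightarrow> log_chain c i t0) (at_left t0)"
        by (auto simp: isCont_def filterlim_at_split)
      then show "\<forall>\<^sub>F t in at_left t0. log_chain c i t > 0"
        using assms[of t0 i] i by (auto intro: order_tendstoD)
    qed
  qed auto
  then obtain a where a: "a < t0" "\<And>t. a < t \<Longrightarrow> t < t0 \<Longrightarrow> \<forall>i\<in>{..k}. log_chain c i t > 0"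
    by (auto simp: eventually_at_left_field)
  show thesis
  proof (rule that[OF a(1)])
    fix t i assume "t > a" "i \<le> k"
    then show "log_chain c i t > 0" using a(2)[of t] assms[of t i] by (cases "t < t0") auto
  qed
qed

section \<open>Iterated logarithms and the functions \<open>X\<close> as chains\<close>

lemma log_chain_one_ge: "t \<ge> 1 \<Longrightarrow> log_chain 1 i t \<ge> 1"
  by (induction i) (auto simp: )

lemma exp_tower_ge_1: "exp_tower k \<ge> 1"
  by (induction k) (auto simp: exp_tower_def)

text \<open>Each logarithm removes one exponential, and the convention
  \<open>exp_tower 0 = 1\<close> keeps even the last member positive.\<close>

lemma log_chain_zero_ge:
  assumes "t \<ge> exp_tower k" "i \<le> k"
  shows "log_chain 0 i t \<ge> exp_tower (k - i)"
  using assms(2)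
proof (induction i)
  case (Suc i)
  then have IH: "log_chain 0 i t \<ge> exp_tower (k - i)" by auto
  have eq: "exp_tower (k - i) = exp (exp_tower (k - Suc i))"
    using Suc.prems by (simp add: exp_tower_def Suc_diff_Suc[symmetric])
  have "exp_tower (k - Suc i) = ln (exp_tower (k - i))" unfolding eq by simp
  also have "\<dots> \<le> ln (log_chain 0 i t)"
    using IH exp_tower_ge_1[of "k - i"] by simp
  finally show ?case by simp
qed (use assms in auto)

lemma iter_log_Suc_eq: "iter_log (Suc i) x = log_chain 0 i (ln x)"
  by (induction i) (auto simp: iter_log_def)

text \<open>Because \<open>1 - ln (1 / L) = 1 + ln L\<close>, reciprocals turn the recursion for
  \<open>X\<close> into the chain with \<open>c = 1\<close>.\<close>

lemma X_Suc_eq: "X (Suc i) x = inverse (log_chain 1 i (1 - ln x))"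
proof (induction i)
  case (Suc i)
  have "X (Suc (Suc i)) x = inverse (1 - ln (X (Suc i) x))" by (simp add: X_def)
  also have "\<dots> = inverse (log_chain 1 (Suc i) (1 - ln x))"
    unfolding Suc by (simp add: ln_inverse)
  finally show ?case .
qed (simp add: X_def)

section \<open>Smooth functions and test functions\<close>

lemma partial_eqI: "(f has_derivative f') (at x) \<Longrightarrow> partial i f x = f' (axis i 1)"
  unfolding partial_def by (simp add: frechet_derivative_at[symmetric])

lemma iter_partial_append: "iter_partial (is @ js) f = iter_partial is (iter_partial js f)"
  by (induction "is") auto

lemma smooth_differentiable: "smooth f \<Longrightarrow> f differentiable (at x)"
  unfolding smooth_def by (metis iter_partial.simps(1))

lemma smooth_partial: "smooth f \<Longrightarrow> smooth (partial i f)"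
  unfolding smooth_def using iter_partial_append[of _ "[i]" f] by (metis iter_partial.simps)

lemma smooth_continuous: "smooth f \<Longrightarrow> continuous_on S f"
  by (meson continuous_at_imp_continuous_on differentiable_imp_continuous_within smooth_differentiable)

text \<open>A coinduction principle: induction on the multi-index keeps every iterated derivative
  inside \<open>C\<close>.\<close>

lemma smooth_closed_classI:
  assumes "f \<in> C" "\<And>f x. f \<in> C \<Longrightarrow> f differentiable (at x)" "\<And>f i. f \<in> C \<Longrightarrow> partial i f \<in> C"
  shows "smooth f"
proof -
  have "iter_partial is f \<in> C" for "is" by (induction "is") (use assms in auto)
  then show ?thesis unfolding smooth_def using assms(2) by blast
qed

lemma partial_add:
  assumes "f differentiable (at x)" "g differentiable (at x)"
  shows "partial i (\<lambda>x. f x + g x) x = partial i f x + partial i g x"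
proof -
  have "((\<lambda>x. f x + g x) has_derivative (\<lambda>h. frechet_derivative f (at x) h + frechet_derivative g (at x) h)) (at x)"
    using assms by (intro has_derivative_add) (auto simp: frechet_derivative_works)
  then show ?thesis by (simp add: partial_eqI) (simp add: partial_def)
qed

lemma partial_mult:
  assumes "f differentiable (at x)" "g differentiable (at x)"
  shows "partial i (\<lambda>x. f x * g x) x = f x * partial i g x + partial i f x * g x"
proof -
  have "((\<lambda>x. f x * g x) has_derivative (\<lambda>h. f x * frechet_derivative g (at x) h + frechet_derivative f (at x) h * g x)) (at x)"
    using assms by (intro has_derivative_mult) (auto simp: frechet_derivative_works)
  then show ?thesis by (simp add: partial_eqI) (simp add: partial_def)
qed

text \<open>Closed under both operations because the product rule turns a derivative of a product
  into a sum of products; \<open>smooth_closed_classI\<close> then applies to the whole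
  ring.\<close>

inductive_set smooth_ring :: "(real^'n \<Rightarrow> real) set" where
  base: "smooth f \<Longrightarrow> f \<in> smooth_ring"
| add: "f \<in> smooth_ring \<Longrightarrow> g \<in> smooth_ring \<Longrightarrow> (\<lambda>x. f x + g x) \<in> smooth_ring"
| mult: "f \<in> smooth_ring \<Longrightarrow> g \<in> smooth_ring \<Longrightarrow> (\<lambda>x. f x * g x) \<in> smooth_ring"

lemma smooth_ring_differentiable: "f \<in> smooth_ring \<Longrightarrow> f differentiable (at x)"
  by (induction rule: smooth_ring.induct) (auto intro: smooth_differentiable)

lemma smooth_ring_smooth: "f \<in> smooth_ring \<Longrightarrow> smooth f"
proof (rule smooth_closed_classI[of f smooth_ring])
  fix f :: "real^'n \<Rightarrow> real" and i assume "f \<in> smooth_ring"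
  then show "partial i f \<in> smooth_ring"
  proof induction
    case (add f g)
    have "partial i (\<lambda>x. f x + g x) = (\<lambda>x. partial i f x + partial i g x)"
      using add by (auto simp: fun_eq_iff intro!: partial_add smooth_ring_differentiable)
    then show ?case using add by (auto intro: smooth_ring.intros)
  next
    case (mult f g)
    have "partial i (\<lambda>x. f x * g x) = (\<lambda>x. f x * partial i g x + partial i f x * g x)"
      using mult by (auto simp: fun_eq_iff intro!: partial_mult smooth_ring_differentiable)
    then show ?case using mult by (auto intro: smooth_ring.intros)
  qed (auto intro: smooth_ring.intros smooth_partial)
qed (auto intro: smooth_ring_differentiable)

lemma smooth_add: "smooth f \<Longrightarrow> smooth g \<Longrightarrow> smooth (\<lambda>x. f x + g x)"
  by (rule smooth_ring_smooth[OF smooth_ring.add]) (auto intro: smooth_ring.base)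

lemma smooth_mult: "smooth f \<Longrightarrow> smooth g \<Longrightarrow> smooth (\<lambda>x. f x * g x)"
  by (rule smooth_ring_smooth[OF smooth_ring.mult]) (auto intro: smooth_ring.base)

lemma smooth_const: "smooth (\<lambda>_::real^'n. c)"
proof (rule smooth_closed_classI[of _ "range (\<lambda>c _. c)"])
  fix f :: "real^'n \<Rightarrow> real" and i assume "f \<in> range (\<lambda>c _. c)"
  then obtain c where f: "f = (\<lambda>_. c)" by auto
  have "partial i f = (\<lambda>_. 0)"
    unfolding f by (rule ext) (simp add: partial_eqI[OF has_derivative_const])
  then show "partial i f \<in> range (\<lambda>c _. c)" by auto
qed auto

lemma smooth_component: "smooth (\<lambda>x::real^'n. x $ j)"
proof (rule smooth_closed_classI[of _ "insert (\<lambda>x. x $ j) {f. smooth f}"])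
  have d: "((\<lambda>x::real^'n. x $ j) has_derivative (\<lambda>x. x $ j)) (at x)" for x
    by (intro bounded_linear_imp_has_derivative bounded_linear_vec_nth)
  fix f :: "real^'n \<Rightarrow> real"
  assume f: "f \<in> insert (\<lambda>x. x $ j) {f. smooth f}"
  show "f differentiable (at x)" for x
    using f differentiableI[OF d] by (auto intro: smooth_differentiable)
  have "partial i (\<lambda>x::real^'n. x $ j) = (\<lambda>_. axis i 1 $ j)" for i
    by (rule ext) (simp add: partial_eqI[OF d])
  then show "partial i f \<in> insert (\<lambda>x. x $ j) {f. smooth f}" for i
    using f by (auto intro: smooth_partial simp: smooth_const)
qed auto

lemma smooth_sum: "finite I \<Longrightarrow> (\<And>i. i \<in> I \<Longrightarrow> smooth (f i)) \<Longrightarrow> smooth (\<lambda>x. \<Sum>i\<in>I. f i x)"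
  by (induction I rule: finite_induct) (auto intro: smooth_const smooth_add)

lemma smooth_power: "smooth f \<Longrightarrow> smooth (\<lambda>x. f x ^ k)"
  by (induction k) (auto intro: smooth_const smooth_mult)

lemma smooth_polynomial_norm:
  assumes "real_polynomial_function p"
  shows "smooth (\<lambda>x::real^'n. p (norm x ^ 2))"
proof -
  have eq: "norm x ^ 2 = (\<Sum>j\<in>UNIV. x $ j * x $ j)" for x :: "real^'n"
    by (simp add: norm_vec_def L2_set_def sum_nonneg power2_eq_square)
  obtain c k where p: "p = (\<lambda>s. \<Sum>i\<le>k. c i * s ^ i)"
    using assms by (auto simp: real_polynomial_function_iff_sum)
  show ?thesis
    unfolding p eq by (intro smooth_sum smooth_mult smooth_const smooth_power smooth_component) auto
qed

text \<open>Radial functions are taken in the variable \<open>s = |x|^2\<close>, which is smooth at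
  the origin, so the chain rule needs no exception at \<open>x = 0\<close>.\<close>

lemma partial_radial:
  assumes "(W has_real_derivative d) (at (norm x ^ 2))"
  shows "partial i (\<lambda>x::real^'n. W (norm x ^ 2)) x = 2 * x $ i * d"
    "(\<lambda>x. W (norm x ^ 2)) differentiable (at x)"
proof -
  have "((\<lambda>x::real^'n. x \<bullet> x) has_derivative (\<lambda>h. x \<bullet> h + h \<bullet> x)) (at x)"
    by (intro derivative_intros)
  then have "((\<lambda>x::real^'n. norm x ^ 2) has_derivative (\<lambda>h. 2 * (x \<bullet> h))) (at x)"
    by (simp add: power2_norm_eq_inner inner_commute)
  then have der: "((\<lambda>x::real^'n. W (norm x ^ 2)) has_derivative (\<lambda>h. d * (2 * (x \<bullet> h)))) (at x)"
    using assms by (intro has_derivative_compose[of "\<lambda>x. norm x ^ 2" _ x UNIV W]) (auto simp: has_field_derivative_def)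
  show "partial i (\<lambda>x::real^'n. W (norm x ^ 2)) x = 2 * x $ i * d"
    by (simp add: partial_eqI[OF der] inner_axis)
  show "(\<lambda>x. W (norm x ^ 2)) differentiable (at x)" using der by (auto simp: differentiable_def)
qed

lemma partial_eq_0_outside_support:
  assumes "x \<notin> closure {x. f x \<noteq> 0}"
  shows "(f has_derivative (\<lambda>_. 0)) (at x)" "partial i f x = 0"
proof -
  have "((\<lambda>_. 0) has_derivative (\<lambda>_. 0)) (at x)" by simp
  then show d: "(f has_derivative (\<lambda>_. 0)) (at x)"
    by (rule has_derivative_transform_within_open[of _ _ _ _ "- closure {x. f x \<noteq> 0}"])
       (use assms closure_subset[of "{x. f x \<noteq> 0}"] in auto)
  show "partial i f x = 0" by (simp add: partial_eqI[OF d])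
qed

section \<open>Operations on test functions\<close>

lemma test_functionsI:
  assumes "smooth f" "{x. f x \<noteq> 0} \<subseteq> K" "compact K" "K \<subseteq> \<Omega>"
  shows "f \<in> test_functions \<Omega>"
proof -
  have "closure {x. f x \<noteq> 0} \<subseteq> K" using assms by (simp add: closure_minimal compact_imp_closed)
  moreover from this have "compact (closure {x. f x \<noteq> 0})"
    using compact_Int_closed[OF assms(3) closed_closure, of "{x. f x \<noteq> 0}"] by (simp add: Int_absorb1)
  ultimately show ?thesis using assms unfolding test_functions_def by auto
qed

lemma test_functionsE:
  assumes "f \<in> test_functions \<Omega>"
  obtains K where "compact K" "K \<subseteq> \<Omega>" "smooth f" "\<And>x. x \<notin> K \<Longrightarrow> f x = 0"
    "\<And>x i. x \<notin> K \<Longrightarrow> partial i f x = 0" "\<And>x. x \<notin> K \<Longrightarrow> (f has_derivative (\<lambda>_. 0)) (at x)"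
proof (rule that[of "closure {x. f x \<noteq> 0}"])
  show "f x = 0" if "x \<notin> closure {x. f x \<noteq> 0}" for x
    using that closure_subset[of "{x. f x \<noteq> 0}"] by auto
qed (use assms in \<open>auto simp: test_functions_def intro: partial_eq_0_outside_support\<close>)

lemma test_functions_partial:
  assumes "f \<in> test_functions \<Omega>" shows "partial i f \<in> test_functions \<Omega>"
  using assms by (elim test_functionsE) (rule test_functionsI, auto intro: smooth_partial)

lemma test_functions_mult:
  assumes "f \<in> test_functions \<Omega>" "smooth g" shows "(\<lambda>x. g x * f x) \<in> test_functions \<Omega>"
  using assms by (elim test_functionsE) (rule test_functionsI, auto intro: smooth_mult)

text \<open>Weierstrass approximation is applied to the derivative and then integrated from
  \<open>W 0\<close>; over \<open>[0, b]\<close> this multiplies the error by at most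
  \<open>b\<close>, which the choice of \<open>d\<close> absorbs.\<close>

lemma polynomial_approx_C1:
  fixes W W1 :: "real \<Rightarrow> real"
  assumes W: "\<And>s. 0 \<le> s \<Longrightarrow> s \<le> b \<Longrightarrow> (W has_real_derivative W1 s) (at s)"
    and c: "\<And>s. 0 \<le> s \<Longrightarrow> s \<le> b \<Longrightarrow> isCont W1 s" and e: "e > 0" and b: "b \<ge> 0"
  obtains p p1 where "real_polynomial_function p" "\<And>s. (p has_real_derivative p1 s) (at s)"
    "\<And>s. 0 \<le> s \<Longrightarrow> s \<le> b \<Longrightarrow> \<bar>W s - p s\<bar> \<le> e" "\<And>s. 0 \<le> s \<Longrightarrow> s \<le> b \<Longrightarrow> \<bar>W1 s - p1 s\<bar> \<le> e"
proof -
  define d where "d = e / (1 + b)"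
  have d: "d > 0" "d \<le> e" "d * b \<le> e" using e b by (auto simp: d_def field_simps)
  have cont: "continuous_on {0..b} W1" using c by (auto intro: continuous_at_imp_continuous_on)
  obtain g where g: "real_polynomial_function g" "\<And>s. s \<in> {0..b} \<Longrightarrow> \<bar>W1 s - g s\<bar> < d"
    using Stone_Weierstrass_real_polynomial_function[OF compact_Icc cont d(1)] by blast
  obtain c k where gk: "g = (\<lambda>s. \<Sum>i\<le>k. c i * s ^ i)"
    using g(1) by (auto simp: real_polynomial_function_iff_sum)
  define p where "p s = W 0 + (\<Sum>i\<le>k. c i / real (Suc i) * s ^ Suc i)" for s
  have p1: "(p has_real_derivative g s) (at s)" for s
  proof -
    have "((\<lambda>s. c i / real (Suc i) * s ^ Suc i) has_real_derivative c i * s ^ i) (at s)" for i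
      by (rule DERIV_cong[OF DERIV_cmult[OF DERIV_pow]]) simp
    then have "((\<lambda>s. W 0 + (\<Sum>i\<le>k. c i / real (Suc i) * s ^ Suc i)) has_real_derivative 0 + (\<Sum>i\<le>k. c i * s ^ i)) (at s)"
      by (intro DERIV_add DERIV_const DERIV_sum)
    then show ?thesis unfolding p_def[abs_def] gk by simp
  qed
  have "real_polynomial_function p"
    unfolding p_def[abs_def]
    by (intro real_polynomial_function.intros real_polynomial_function_sum real_polynomial_function_power)
       (auto intro: real_polynomial_function.intros)
  moreover have "\<bar>W s - p s\<bar> \<le> e" if s: "0 \<le> s" "s \<le> b" for s
  proof -
    have "norm ((W s - p s) - (W 0 - p 0)) \<le> d * norm (s - 0)"
    proof (rule field_differentiable_bound[of "{0..b}" "\<lambda>s. W s - p s" "\<lambda>s. W1 s - g s"])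
      show "((\<lambda>s. W s - p s) has_field_derivative W1 z - g z) (at z within {0..b})" if "z \<in> {0..b}" for z
        using that by (intro DERIV_diff has_field_derivative_at_within[OF W] has_field_derivative_at_within[OF p1]) auto
    qed (use s b g(2) in \<open>auto intro: less_imp_le\<close>)
    also have "\<dots> \<le> e"
    proof -
      have "d * s \<le> d * b" using s d by (intro mult_left_mono) auto
      then show ?thesis using s d(3) by simp
    qed
    finally show ?thesis by (simp add: p_def)
  qed
  moreover have "\<bar>W1 s - g s\<bar> \<le> e" if "0 \<le> s" "s \<le> b" for s
    using g(2)[of s] that d(2) by simp
  ultimately show thesis using p1 by (intro that[of p g])
qed

section \<open>Energy estimates in Sobolev spaces\<close>

lemma abs_mult_le_sum_squares: "\<bar>a * b\<bar> \<le> a\<^sup>2 + b\<^sup>2" for a b :: real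
proof -
  have "2 * \<bar>a * b\<bar> \<le> a\<^sup>2 + b\<^sup>2"
    using sum_squares_bound[of "\<bar>a\<bar>" "\<bar>b\<bar>"] by (simp add: abs_mult)
  then show ?thesis using abs_ge_zero[of "a * b"] by linarith
qed

lemma L2_mult_integrable:
  fixes f g :: "'a \<Rightarrow> real"
  assumes "f \<in> borel_measurable M" "integrable M (\<lambda>x. (f x)\<^sup>2)"
    "g \<in> borel_measurable M" "integrable M (\<lambda>x. (g x)\<^sup>2)"
  shows "integrable M (\<lambda>x. f x * g x)"
proof (rule Bochner_Integration.integrable_bound[of _ "\<lambda>x. (f x)\<^sup>2 + (g x)\<^sup>2"])
  show "AE x in M. norm (f x * g x) \<le> norm ((f x)\<^sup>2 + (g x)\<^sup>2)"
    using abs_mult_le_sum_squares by (intro always_eventually allI) (simp add: abs_of_nonneg)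
qed (use assms in auto)

lemma integrable_bounded_mult:
  fixes f c :: "'a \<Rightarrow> real"
  assumes "integrable M f" "c \<in> borel_measurable M" "\<And>x. x \<in> space M \<Longrightarrow> \<bar>c x\<bar> \<le> C"
  shows "integrable M (\<lambda>x. c x * f x)"
proof (rule Bochner_Integration.integrable_bound[of _ "\<lambda>x. C * f x"])
  have "\<bar>c x\<bar> * \<bar>f x\<bar> \<le> \<bar>C\<bar> * \<bar>f x\<bar>" if "x \<in> space M" for x
    using assms(3)[OF that] by (intro mult_right_mono) auto
  then show "AE x in M. norm (c x * f x) \<le> norm (C * f x)"
    by (intro AE_I2) (simp add: abs_mult)
qed (use assms in auto)

text \<open>Expanding \<open>F G - f g\<close> in the differences leaves one quadratic and two mixed
  terms. Young's inequality with a free \<epsilon> bounds the mixed ones by a small multiple of the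
  fixed \<open>L^2\<close> norms plus a multiple of quantities tending to zero.\<close>

lemma integral_square_perturbation_tendsto:
  fixes f g :: "'a \<Rightarrow> real" and F G :: "nat \<Rightarrow> 'a \<Rightarrow> real"
  assumes f: "f \<in> borel_measurable M" "integrable M (\<lambda>x. (f x)\<^sup>2)"
    and g: "g \<in> borel_measurable M" "integrable M (\<lambda>x. (g x)\<^sup>2)"
    and F: "\<And>m. F m \<in> borel_measurable M" "\<And>m. integrable M (\<lambda>x. (F m x)\<^sup>2)"
    and G: "\<And>m. G m \<in> borel_measurable M" "\<And>m. integrable M (\<lambda>x. (G m x)\<^sup>2)"
    and c: "c \<in> borel_measurable M" "\<And>x. x \<in> space M \<Longrightarrow> \<bar>c x\<bar> \<le> C"
    and lim: "(\<lambda>m. LINT x|M. (f x - F m x)\<^sup>2) \<longlonglongrightarrow> 0" "(\<lambda>m. LINT x|M. (g x - G m x)\<^sup>2) \<longlonglongrightarrow> 0"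
  shows "(\<lambda>m. LINT x|M. c x * (F m x * G m x)) \<longlonglongrightarrow> (LINT x|M. c x * (f x * g x))"
proof -
  have sq_diff: "integrable M (\<lambda>x. (h x - H x)\<^sup>2)"
    if "h \<in> borel_measurable M" "integrable M (\<lambda>x. (h x)\<^sup>2)" "H \<in> borel_measurable M" "integrable M (\<lambda>x. (H x)\<^sup>2)"
    for h H :: "'a \<Rightarrow> real"
    using that L2_mult_integrable[of h M H] by (simp add: power2_diff mult.assoc)
  define \<alpha> where "\<alpha> m = (LINT x|M. (f x - F m x)\<^sup>2)" for m
  define \<beta> where "\<beta> m = (LINT x|M. (g x - G m x)\<^sup>2)" for m
  define K where "K = (LINT x|M. (f x)\<^sup>2) + (LINT x|M. (g x)\<^sup>2)"
  have lab: "\<alpha> \<longlonglongrightarrow> 0" "\<beta> \<longlonglongrightarrow> 0" using lim by (simp_all add: \<alpha>_def[abs_def] \<beta>_def[abs_def])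
  have K: "K \<ge> 0" by (simp add: K_def)
  have Cabs: "\<bar>c x\<bar> \<le> \<bar>C\<bar>" if "x \<in> space M" for x using c(2)[OF that] by simp
  have intfg: "integrable M (\<lambda>x. c x * (f x * g x))" "integrable M (\<lambda>x. c x * (F m x * G m x))" for m
    by (rule integrable_bounded_mult[OF L2_mult_integrable[OF f g] c]
        integrable_bounded_mult[OF L2_mult_integrable[OF F G] c]; assumption)+
  have bound: "\<bar>(LINT x|M. c x * (F m x * G m x)) - (LINT x|M. c x * (f x * g x))\<bar>
      \<le> \<bar>C\<bar> * (\<epsilon> * K + (1 + 1 / \<epsilon>) * (\<alpha> m + \<beta> m))" if e: "\<epsilon> > 0" for m \<epsilon>
  proof -
    have pt: "\<bar>c x * (F m x * G m x) - c x * (f x * g x)\<bar>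
        \<le> \<bar>C\<bar> * (\<epsilon> * ((f x)\<^sup>2 + (g x)\<^sup>2) + (1 + 1 / \<epsilon>) * ((f x - F m x)\<^sup>2 + (g x - G m x)\<^sup>2))"
      if x: "x \<in> space M" for x
    proof -
      define a where "a = F m x - f x"
      define b where "b = G m x - g x"
      have young: "\<bar>p * q\<bar> \<le> \<epsilon> * p\<^sup>2 + 1 / \<epsilon> * q\<^sup>2" for p q :: real
      proof -
        have "0 \<le> (\<epsilon> * \<bar>p\<bar> - \<bar>q\<bar>)\<^sup>2 / \<epsilon>" using e by simp
        also have "\<dots> = \<epsilon> * p\<^sup>2 + 1 / \<epsilon> * q\<^sup>2 - 2 * \<bar>p * q\<bar>"
          using e by (simp add: power2_diff power_mult_distrib abs_mult field_simps power2_eq_square)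
        finally show ?thesis by linarith
      qed
      have ab: "\<bar>a * b\<bar> \<le> a\<^sup>2 + b\<^sup>2"
        by (rule abs_mult_le_sum_squares)
      have "F m x * G m x - f x * g x = a * b + f x * b + g x * a"
        by (simp add: a_def b_def algebra_simps)
      then have "\<bar>F m x * G m x - f x * g x\<bar> \<le> \<bar>a * b\<bar> + \<bar>f x * b\<bar> + \<bar>g x * a\<bar>" by linarith
      also have "\<dots> \<le> \<epsilon> * ((f x)\<^sup>2 + (g x)\<^sup>2) + (1 + 1 / \<epsilon>) * (a\<^sup>2 + b\<^sup>2)"
        using ab young[of "f x" b] young[of "g x" a] by (simp add: algebra_simps)
      finally have main: "\<bar>F m x * G m x - f x * g x\<bar> \<le> \<epsilon> * ((f x)\<^sup>2 + (g x)\<^sup>2) + (1 + 1 / \<epsilon>) * ((f x - F m x)\<^sup>2 + (g x - G m x)\<^sup>2)"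
        by (simp add: a_def b_def power2_commute)
      have "\<bar>c x * (F m x * G m x) - c x * (f x * g x)\<bar> = \<bar>c x\<bar> * \<bar>F m x * G m x - f x * g x\<bar>"
        by (simp add: abs_mult[symmetric] right_diff_distrib)
      also have "\<dots> \<le> \<bar>C\<bar> * (\<epsilon> * ((f x)\<^sup>2 + (g x)\<^sup>2) + (1 + 1 / \<epsilon>) * ((f x - F m x)\<^sup>2 + (g x - G m x)\<^sup>2))"
        using Cabs[OF x] main by (intro mult_mono) auto
      finally show ?thesis .
    qed
    have int: "integrable M (\<lambda>x. (f x - F m x)\<^sup>2)" "integrable M (\<lambda>x. (g x - G m x)\<^sup>2)"
      using f g F G by (auto intro!: sq_diff)
    have "\<bar>LINT x|M. c x * (F m x * G m x) - c x * (f x * g x)\<bar>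
        \<le> (LINT x|M. \<bar>c x * (F m x * G m x) - c x * (f x * g x)\<bar>)" by (rule integral_abs_bound)
    also have "\<dots> \<le> (LINT x|M. \<bar>C\<bar> * (\<epsilon> * ((f x)\<^sup>2 + (g x)\<^sup>2) + (1 + 1 / \<epsilon>) * ((f x - F m x)\<^sup>2 + (g x - G m x)\<^sup>2)))"
      using pt intfg int f g by (intro integral_mono) auto
    also have "\<dots> = \<bar>C\<bar> * (\<epsilon> * K + (1 + 1 / \<epsilon>) * (\<alpha> m + \<beta> m))"
      using int f g by (simp add: K_def \<alpha>_def \<beta>_def)
    finally show ?thesis using intfg by simp
  qed
  show ?thesis
  proof (rule LIMSEQ_I)
    fix r :: real assume r: "r > 0"
    \<comment> \<open>Makes the part of the bound that does not vanish with \<open>m\<close> at most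
      \<open>r / 2\<close>; \<epsilon> is fixed before \<open>m\<close> grows.\<close>
    define \<epsilon> where "\<epsilon> = r / (2 * (\<bar>C\<bar> + 1) * (K + 1))"
    have e: "\<epsilon> > 0" using r K by (simp add: \<epsilon>_def)
    have "(\<lambda>m. \<bar>C\<bar> * (\<epsilon> * K + (1 + 1 / \<epsilon>) * (\<alpha> m + \<beta> m))) \<longlonglongrightarrow> \<bar>C\<bar> * (\<epsilon> * K + (1 + 1 / \<epsilon>) * (0 + 0))"
      by (intro tendsto_intros lab)
    moreover have "\<bar>C\<bar> * (\<epsilon> * K + (1 + 1 / \<epsilon>) * (0 + 0)) < r"
    proof -
      have "\<bar>C\<bar> * K \<le> (\<bar>C\<bar> + 1) * (K + 1)" using K by (intro mult_mono) auto
      then have "\<epsilon> * (\<bar>C\<bar> * K) \<le> \<epsilon> * ((\<bar>C\<bar> + 1) * (K + 1))" using e by (intro mult_left_mono) auto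
      also have "\<dots> = r / 2" using K by (simp add: \<epsilon>_def field_simps add_nonneg_eq_0_iff)
      finally show ?thesis using r by (simp add: mult_ac)
    qed
    ultimately have "\<forall>\<^sub>F m in sequentially. \<bar>C\<bar> * (\<epsilon> * K + (1 + 1 / \<epsilon>) * (\<alpha> m + \<beta> m)) < r"
      by (rule order_tendstoD(2))
    then have "\<forall>\<^sub>F m in sequentially. norm ((LINT x|M. c x * (F m x * G m x)) - (LINT x|M. c x * (f x * g x))) < r"
      by eventually_elim (use bound[OF e] in \<open>auto intro: le_less_trans\<close>)
    then show "\<exists>no. \<forall>m\<ge>no. norm ((LINT x|M. c x * (F m x * G m x)) - (LINT x|M. c x * (f x * g x))) < r"
      by (simp add: eventually_sequentially)
  qed
qed

section \<open>Square-integrable functions and weak derivatives\<close>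

lemma continuous_bounded_on_bounded:
  fixes f :: "'a::euclidean_space \<Rightarrow> real"
  assumes "bounded \<Omega>" "continuous_on (closure \<Omega>) f"
  shows "\<exists>C. \<forall>x\<in>\<Omega>. \<bar>f x\<bar> \<le> C"
proof -
  have "compact (f ` closure \<Omega>)"
    using assms by (intro compact_continuous_image) (auto simp: compact_closure)
  then obtain C where "\<forall>x\<in>closure \<Omega>. \<bar>f x\<bar> \<le> C"
    by (fastforce dest!: compact_imp_bounded simp: bounded_iff)
  then show ?thesis using closure_subset by blast
qed

lemma continuous_measurable_lebesgue_on:
  fixes f :: "'a::euclidean_space \<Rightarrow> real"
  assumes "open \<Omega>" "continuous_on (closure \<Omega>) f"
  shows "f \<in> borel_measurable (lebesgue_on \<Omega>)"
  using assms by (intro continuous_imp_measurable_on_sets_lebesgue)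
    (auto intro: continuous_on_subset[OF _ closure_subset])

lemma continuous_in_L2:
  fixes f :: "real^'n \<Rightarrow> real"
  assumes "open \<Omega>" "bounded \<Omega>" "continuous_on (closure \<Omega>) f"
  shows "f \<in> L2 \<Omega>"
proof -
  obtain C where C: "\<And>x. x \<in> \<Omega> \<Longrightarrow> \<bar>f x\<bar> \<le> C"
    using continuous_bounded_on_bounded[OF assms(2,3)] by blast
  note m = continuous_measurable_lebesgue_on[OF assms(1,3)]
  have "finite_measure (lebesgue_on \<Omega>)"
    using assms(1,2) by (intro finite_measure_lebesgue_on lmeasurable_open) auto
  then have "integrable (lebesgue_on \<Omega>) (\<lambda>x. (f x)\<^sup>2)"
  proof (rule finite_measure.integrable_const_bound)
    show "AE x in lebesgue_on \<Omega>. norm ((f x)\<^sup>2) \<le> C\<^sup>2"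
      using C by (intro AE_I2) (auto simp: abs_le_square_iff[symmetric] intro: order_trans[OF _ abs_ge_self])
  qed (use m in auto)
  then show ?thesis using m by (simp add: L2_def)
qed

lemma L2_D: "f \<in> L2 \<Omega> \<Longrightarrow> f \<in> borel_measurable (lebesgue_on \<Omega>)"
  "f \<in> L2 \<Omega> \<Longrightarrow> integrable (lebesgue_on \<Omega>) (\<lambda>x. (f x)\<^sup>2)"
  by (auto simp: L2_def)

lemma L2_add:
  assumes "f \<in> L2 \<Omega>" "g \<in> L2 \<Omega>" shows "(\<lambda>x. f x + g x) \<in> L2 \<Omega>"
  using assms L2_mult_integrable[OF L2_D[OF assms(1)] L2_D[OF assms(2)]]
  by (auto simp: L2_def power2_sum mult.assoc)

lemma L2_sum: "finite I \<Longrightarrow> (\<And>i. i \<in> I \<Longrightarrow> f i \<in> L2 \<Omega>) \<Longrightarrow> (\<lambda>x. \<Sum>i\<in>I. f i x) \<in> L2 \<Omega>"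
proof (induction I rule: finite_induct)
  case empty
  show ?case by (simp add: L2_def)
qed (auto intro: L2_add)

lemma sobolev_H_weak_deriv:
  assumes "u \<in> sobolev_H k \<Omega>" "length is \<le> k"
  shows "has_weak_deriv \<Omega> is u (weak_deriv \<Omega> is u)" "weak_deriv \<Omega> is u \<in> L2 \<Omega>"
proof -
  obtain v where v: "has_weak_deriv \<Omega> is u v" and L: "weak_deriv \<Omega> is u \<in> L2 \<Omega>"
    using assms unfolding sobolev_H_def by blast
  show "has_weak_deriv \<Omega> is u (weak_deriv \<Omega> is u)"
    unfolding weak_deriv_def using v by (rule someI[where P="has_weak_deriv \<Omega> is u"])
  show "weak_deriv \<Omega> is u \<in> L2 \<Omega>" by (rule L)
qed

lemma weak_laplacian_in_L2: "u \<in> sobolev_H 2 \<Omega> \<Longrightarrow> weak_laplacian \<Omega> u \<in> L2 \<Omega>"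
  unfolding weak_laplacian_def[abs_def] by (intro L2_sum sobolev_H_weak_deriv(2)[of u 2]) auto

lemma test_function_in_L2:
  assumes "open \<Omega>" "bounded \<Omega>" "f \<in> test_functions \<Omega>" shows "f \<in> L2 \<Omega>" "partial i f \<in> L2 \<Omega>"
proof -
  have "smooth f" using assms(3) by (rule test_functionsE)
  then show "f \<in> L2 \<Omega>" "partial i f \<in> L2 \<Omega>"
    by (auto intro!: continuous_in_L2 assms(1,2) smooth_continuous smooth_partial)
qed

lemma L2_product_integrable:
  assumes "f \<in> L2 \<Omega>" "g \<in> L2 \<Omega>" shows "integrable (lebesgue_on \<Omega>) (\<lambda>x. f x * g x)"
  using L2_mult_integrable[OF L2_D[OF assms(1)] L2_D[OF assms(2)]] .

text \<open>Both sides are traced back to the integral of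
  \<open>u * partial i (partial i \<eta>)\<close>: the second weak derivative is tested with
  \<open>\<eta>\<close>, the first one with \<open>partial i \<eta>\<close>, which is again a test
  function.\<close>

lemma weak_laplacian_test:
  assumes "open \<Omega>" "bounded \<Omega>" "u \<in> sobolev_H 2 \<Omega>" "\<eta> \<in> test_functions \<Omega>"
  shows "(LINT x|lebesgue_on \<Omega>. weak_laplacian \<Omega> u x * \<eta> x)
    = - (\<Sum>i\<in>UNIV. LINT x|lebesgue_on \<Omega>. weak_deriv \<Omega> [i] u x * partial i \<eta> x)"
proof -
  have e: "(LINT x|lebesgue_on \<Omega>. weak_deriv \<Omega> [i,i] u x * \<eta> x)
      = - (LINT x|lebesgue_on \<Omega>. weak_deriv \<Omega> [i] u x * partial i \<eta> x)" for i
  proof -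
    have "(LINT x|lebesgue_on \<Omega>. weak_deriv \<Omega> [i,i] u x * \<eta> x)
       = (LINT x|lebesgue_on \<Omega>. u x * partial i (partial i \<eta>) x)"
      using sobolev_H_weak_deriv(1)[OF assms(3), of "[i,i]"] assms(4) by (simp add: has_weak_deriv_def)
    also have "\<dots> = - (LINT x|lebesgue_on \<Omega>. weak_deriv \<Omega> [i] u x * partial i \<eta> x)"
      using sobolev_H_weak_deriv(1)[OF assms(3), of "[i]"] test_functions_partial[OF assms(4)]
      by (simp add: has_weak_deriv_def)
    finally show ?thesis .
  qed
  have int: "integrable (lebesgue_on \<Omega>) (\<lambda>x. weak_deriv \<Omega> [i,i] u x * \<eta> x)" for i
    using assms by (intro L2_product_integrable sobolev_H_weak_deriv(2)[of u 2] test_function_in_L2) auto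
  show ?thesis
    unfolding weak_laplacian_def sum_distrib_right using int by (simp add: e sum_negf)
qed

lemma uniform_multiplier_tendsto:
  fixes c :: "'a \<Rightarrow> real" and h :: "'a \<Rightarrow> real"
  assumes h: "integrable M h" and c: "c \<in> borel_measurable M"
    and pm: "\<And>k. p k \<in> borel_measurable M" and C: "\<And>x. x \<in> space M \<Longrightarrow> \<bar>c x\<bar> \<le> C"
    and p: "\<And>x k. x \<in> space M \<Longrightarrow> \<bar>c x - p k x\<bar> \<le> 1 / real (Suc k)"
  shows "(\<lambda>k. LINT x|M. p k x * h x) \<longlonglongrightarrow> (LINT x|M. c x * h x)"
proof (rule integral_dominated_convergence[where w="\<lambda>x. (C + 1) * \<bar>h x\<bar>"])
  show "AE x in M. (\<lambda>k. p k x * h x) \<longlonglongrightarrow> c x * h x"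
  proof (intro AE_I2 tendsto_mult tendsto_const)
    fix x assume x: "x \<in> space M"
    have "(\<lambda>k. c x - p k x) \<longlonglongrightarrow> 0"
    proof (rule Lim_null_comparison[OF _ LIMSEQ_inverse_real_of_nat])
      show "\<forall>\<^sub>F k in sequentially. norm (c x - p k x) \<le> inverse (real (Suc k))"
        using p[OF x] by (intro always_eventually allI) (simp only: real_norm_def inverse_eq_divide)
    qed
    from tendsto_diff[OF tendsto_const[of "c x"] this] show "(\<lambda>k. p k x) \<longlonglongrightarrow> c x" by simp
  qed
  show "AE x in M. norm (p k x * h x) \<le> (C + 1) * \<bar>h x\<bar>" for k
  proof (intro AE_I2)
    fix x assume x: "x \<in> space M"
    have "1 / real (Suc k) \<le> 1" by simp
    then have "\<bar>p k x\<bar> \<le> C + 1" using p[OF x, of k] C[OF x] by linarith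
    then show "norm (p k x * h x) \<le> (C + 1) * \<bar>h x\<bar>" by (simp add: abs_mult mult_right_mono)
  qed
qed (use h c pm in auto)

text \<open>
  The weight \<open>W\<close> enters through \<open>(\<Delta>u + W u)\<^sup>2 \<ge> 0\<close>. Weak derivatives can only be tested against smooth
  functions, so \<open>W\<close> (with gradient \<open>V\<close>) is merely required to be a \<open>C\<^sup>1\<close>-limit of smooth weights.
\<close>

lemma sobolev_energy_bound:
  fixes \<Omega> :: "(real^'n) set"
  assumes \<Omega>: "open \<Omega>" "bounded \<Omega>" and u: "u \<in> sobolev_H 2 \<Omega>" "u \<in> sobolev_H10 \<Omega>"
    and W: "W \<in> borel_measurable (lebesgue_on \<Omega>)" "\<And>x. x \<in> \<Omega> \<Longrightarrow> \<bar>W x\<bar> \<le> C"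
    and V: "\<And>i. V i \<in> borel_measurable (lebesgue_on \<Omega>)" "\<And>i x. x \<in> \<Omega> \<Longrightarrow> \<bar>V i x\<bar> \<le> C"
    and G: "G \<in> borel_measurable (lebesgue_on \<Omega>)" "\<And>x. x \<in> \<Omega> \<Longrightarrow> \<bar>G x\<bar> \<le> C"
    and approx: "\<And>e. e > 0 \<Longrightarrow> \<exists>p. smooth p \<and> (\<forall>x\<in>\<Omega>. \<bar>W x - p x\<bar> \<le> e \<and> (\<forall>i. \<bar>V i x - partial i p x\<bar> \<le> e))"
    and test: "\<And>\<psi>. \<psi> \<in> test_functions \<Omega> \<Longrightarrow> (LINT x|lebesgue_on \<Omega>. G x * (\<psi> x * \<psi> x)) \<le>
       2 * (\<Sum>i\<in>UNIV. (LINT x|lebesgue_on \<Omega>. W x * (partial i \<psi> x * partial i \<psi> x))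
          + (LINT x|lebesgue_on \<Omega>. V i x * (partial i \<psi> x * \<psi> x)))
       - (LINT x|lebesgue_on \<Omega>. (W x)\<^sup>2 * (\<psi> x * \<psi> x))"
  shows "(LINT x|lebesgue_on \<Omega>. G x * (u x * u x)) \<le> (LINT x|lebesgue_on \<Omega>. (weak_laplacian \<Omega> u x)\<^sup>2)"
proof -
  let ?M = "lebesgue_on \<Omega>"
  define D where "D i = weak_deriv \<Omega> [i] u" for i
  define L where "L = weak_laplacian \<Omega> u"
  have sp: "space ?M = \<Omega>" by simp
  have uL: "u \<in> L2 \<Omega>" using u by (simp add: sobolev_H_def)
  have DL: "D i \<in> L2 \<Omega>" for i unfolding D_def using u(1) by (intro sobolev_H_weak_deriv(2)[of u 2]) auto
  have LL: "L \<in> L2 \<Omega>" unfolding L_def using u(1) by (rule weak_laplacian_in_L2)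
  obtain \<phi> :: "nat \<Rightarrow> real^'n \<Rightarrow> real" where \<phi>: "\<And>m. \<phi> m \<in> test_functions \<Omega>"
    and lim0: "(\<lambda>m. LINT x|?M. (u x - \<phi> m x)\<^sup>2) \<longlonglongrightarrow> 0"
    and lim1: "\<And>i. (\<lambda>m. LINT x|?M. (D i x - partial i (\<phi> m) x)\<^sup>2) \<longlonglongrightarrow> 0"
    using u(2) unfolding sobolev_H10_def D_def by blast
  note \<phi>L = test_function_in_L2[OF \<Omega> \<phi>]
  note pert = integral_square_perturbation_tendsto[OF L2_D L2_D L2_D L2_D]
  have limLL: "(\<lambda>m::nat. LINT x|?M. (L x - L x)\<^sup>2) \<longlonglongrightarrow> 0"
    "(\<lambda>m::nat. LINT x|?M. (D i x - D i x)\<^sup>2) \<longlonglongrightarrow> 0" for i by simp_all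
  \<comment> \<open>The weak Laplacian of \<open>u\<close> is tested with
    \<open>p * \<phi> m\<close>, and then \<open>\<phi> m\<close> tends to \<open>u\<close>. No
    second derivative of \<open>\<phi> m\<close> occurs, so \<open>H^1\<close> convergence
    suffices.\<close>
  have smooth_green: "- (LINT x|?M. p x * (L x * u x))
      = (\<Sum>i\<in>UNIV. (LINT x|?M. p x * (D i x * D i x)) + (LINT x|?M. partial i p x * (D i x * u x)))"
    if p: "smooth p" for p
  proof -
    note pm = continuous_measurable_lebesgue_on[OF \<Omega>(1) smooth_continuous[OF p]]
    note p1m = continuous_measurable_lebesgue_on[OF \<Omega>(1) smooth_continuous[OF smooth_partial[OF p]]]
    obtain C0 where C0: "\<And>x. x \<in> \<Omega> \<Longrightarrow> \<bar>p x\<bar> \<le> C0"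
      using continuous_bounded_on_bounded[OF \<Omega>(2) smooth_continuous[OF p]] by blast
    have "\<forall>i. \<exists>C1. \<forall>x\<in>\<Omega>. \<bar>partial i p x\<bar> \<le> C1"
      by (intro allI continuous_bounded_on_bounded[OF \<Omega>(2) smooth_continuous[OF smooth_partial[OF p]]])
    from choice[OF this] obtain C1 where "\<forall>i. \<forall>x\<in>\<Omega>. \<bar>partial i p x\<bar> \<le> C1 i" ..
    then have C1: "\<bar>partial i p x\<bar> \<le> C1 i" if "x \<in> \<Omega>" for i x using that by blast
    have eq: "- (LINT x|?M. p x * (L x * \<phi> m x))
       = (\<Sum>i\<in>UNIV. (LINT x|?M. p x * (D i x * partial i (\<phi> m) x)) + (LINT x|?M. partial i p x * (D i x * \<phi> m x)))" for m
    proof -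
      have "smooth (\<phi> m)" using \<phi>[of m] by (rule test_functionsE)
      then have pp: "partial i (\<lambda>x. p x * \<phi> m x) x = p x * partial i (\<phi> m) x + partial i p x * \<phi> m x" for i x
        using p by (intro partial_mult smooth_differentiable)
      have int: "integrable ?M (\<lambda>x. p x * (D i x * partial i (\<phi> m) x))" "integrable ?M (\<lambda>x. partial i p x * (D i x * \<phi> m x))" for i
        using integrable_bounded_mult[OF L2_product_integrable[OF DL \<phi>L(2)] pm, unfolded sp, OF C0]
          integrable_bounded_mult[OF L2_product_integrable[OF DL \<phi>L(1)] p1m, unfolded sp, OF C1] by auto
      have "- (LINT x|?M. p x * (L x * \<phi> m x)) = - (LINT x|?M. weak_laplacian \<Omega> u x * (p x * \<phi> m x))"
        by (simp add: L_def mult_ac)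
      also have "\<dots> = (\<Sum>i\<in>UNIV. LINT x|?M. D i x * partial i (\<lambda>x. p x * \<phi> m x) x)"
        by (simp add: weak_laplacian_test[OF \<Omega> u(1) test_functions_mult[OF \<phi> p]] D_def)
      also have "\<dots> = (\<Sum>i\<in>UNIV. LINT x|?M. p x * (D i x * partial i (\<phi> m) x) + partial i p x * (D i x * \<phi> m x))"
        by (intro sum.cong refl arg_cong[where f="integral\<^sup>L ?M"] ext) (simp add: pp algebra_simps)
      also have "\<dots> = (\<Sum>i\<in>UNIV. (LINT x|?M. p x * (D i x * partial i (\<phi> m) x)) + (LINT x|?M. partial i p x * (D i x * \<phi> m x)))"
        using int by (intro sum.cong refl Bochner_Integration.integral_add)
      finally show ?thesis .
    qed
    have "(\<lambda>m. - (LINT x|?M. p x * (L x * \<phi> m x))) \<longlonglongrightarrow> - (LINT x|?M. p x * (L x * u x))"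
      by (intro tendsto_minus pert[OF LL LL uL uL _ _ _ _ pm _ limLL(1) lim0, unfolded sp, OF LL LL \<phi>L(1) \<phi>L(1) C0])
    moreover have "(\<lambda>m. - (LINT x|?M. p x * (L x * \<phi> m x))) \<longlonglongrightarrow>
       (\<Sum>i\<in>UNIV. (LINT x|?M. p x * (D i x * D i x)) + (LINT x|?M. partial i p x * (D i x * u x)))"
      unfolding eq
      by (intro tendsto_sum tendsto_add
            pert[OF DL DL DL DL _ _ _ _ pm _ limLL(2) lim1, unfolded sp, OF DL DL \<phi>L(2) \<phi>L(2) C0]
            pert[OF DL DL uL uL _ _ _ _ p1m _ limLL(2) lim0, unfolded sp, OF DL DL \<phi>L(1) \<phi>L(1) C1])
    ultimately show ?thesis by (rule LIMSEQ_unique)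
  qed
  \<comment> \<open>Smooth weights converging to \<open>W\<close> uniformly together with their
    gradients carry Green's formula over to \<open>W\<close>.\<close>
  have "\<forall>k. \<exists>p. smooth p \<and> (\<forall>x\<in>\<Omega>. \<bar>W x - p x\<bar> \<le> 1 / real (Suc k) \<and> (\<forall>i. \<bar>V i x - partial i p x\<bar> \<le> 1 / real (Suc k)))"
    by (intro allI approx) simp
  from choice[OF this] obtain p where
    "\<forall>k. smooth (p k) \<and> (\<forall>x\<in>\<Omega>. \<bar>W x - p k x\<bar> \<le> 1 / real (Suc k) \<and> (\<forall>i. \<bar>V i x - partial i (p k) x\<bar> \<le> 1 / real (Suc k)))" ..
  then have p: "\<And>k. smooth (p k)" "\<And>k x. x \<in> \<Omega> \<Longrightarrow> \<bar>W x - p k x\<bar> \<le> 1 / real (Suc k)"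
    "\<And>k x i. x \<in> \<Omega> \<Longrightarrow> \<bar>V i x - partial i (p k) x\<bar> \<le> 1 / real (Suc k)" by blast+
  have pm: "p k \<in> borel_measurable ?M" "partial i (p k) \<in> borel_measurable ?M" for k i
    by (intro continuous_measurable_lebesgue_on \<Omega>(1) smooth_continuous smooth_partial p(1))+
  have "(\<lambda>k. - (LINT x|?M. p k x * (L x * u x))) \<longlonglongrightarrow> - (LINT x|?M. W x * (L x * u x))"
    by (intro tendsto_minus uniform_multiplier_tendsto[OF L2_product_integrable[OF LL uL] W(1) pm(1), unfolded sp, OF W(2) p(2)])
  moreover have "(\<lambda>k. - (LINT x|?M. p k x * (L x * u x))) \<longlonglongrightarrow>
      (\<Sum>i\<in>UNIV. (LINT x|?M. W x * (D i x * D i x)) + (LINT x|?M. V i x * (D i x * u x)))"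
    unfolding smooth_green[OF p(1)]
    by (intro tendsto_sum tendsto_add
        uniform_multiplier_tendsto[OF L2_product_integrable[OF DL DL] W(1) pm(1), unfolded sp, OF W(2) p(2)]
        uniform_multiplier_tendsto[OF L2_product_integrable[OF DL uL] V(1) pm(2), unfolded sp, OF V(2) p(3)])
  ultimately have green: "- (LINT x|?M. W x * (L x * u x))
      = (\<Sum>i\<in>UNIV. (LINT x|?M. W x * (D i x * D i x)) + (LINT x|?M. V i x * (D i x * u x)))"
    by (rule LIMSEQ_unique)
  have W2: "(\<lambda>x. (W x)\<^sup>2) \<in> borel_measurable ?M" "\<And>x. x \<in> \<Omega> \<Longrightarrow> \<bar>(W x)\<^sup>2\<bar> \<le> C\<^sup>2"
    using W by (auto simp: abs_le_square_iff[symmetric] intro: order_trans[OF _ abs_ge_self])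
  \<comment> \<open>The first-order inequality assumed for test functions passes to the
    \<open>H^1\<close> limit \<open>u\<close>.\<close>
  have "(LINT x|?M. G x * (u x * u x)) \<le>
      2 * (\<Sum>i\<in>UNIV. (LINT x|?M. W x * (D i x * D i x)) + (LINT x|?M. V i x * (D i x * u x)))
      - (LINT x|?M. (W x)\<^sup>2 * (u x * u x))"
  proof (rule LIMSEQ_le)
    show "(\<lambda>m. LINT x|?M. G x * (\<phi> m x * \<phi> m x)) \<longlonglongrightarrow> (LINT x|?M. G x * (u x * u x))"
      by (intro pert[OF uL uL uL uL _ _ _ _ G(1) _ lim0 lim0, unfolded sp, OF \<phi>L(1) \<phi>L(1) \<phi>L(1) \<phi>L(1) G(2)])
    show "(\<lambda>m. 2 * (\<Sum>i\<in>UNIV. (LINT x|?M. W x * (partial i (\<phi> m) x * partial i (\<phi> m) x))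
         + (LINT x|?M. V i x * (partial i (\<phi> m) x * \<phi> m x))) - (LINT x|?M. (W x)\<^sup>2 * (\<phi> m x * \<phi> m x)))
      \<longlonglongrightarrow> 2 * (\<Sum>i\<in>UNIV. (LINT x|?M. W x * (D i x * D i x)) + (LINT x|?M. V i x * (D i x * u x)))
      - (LINT x|?M. (W x)\<^sup>2 * (u x * u x))"
      by (intro tendsto_diff tendsto_mult tendsto_const tendsto_sum tendsto_add
          pert[OF DL DL DL DL _ _ _ _ W(1) _ lim1 lim1, unfolded sp, OF \<phi>L(2) \<phi>L(2) \<phi>L(2) \<phi>L(2) W(2)]
          pert[OF DL DL uL uL _ _ _ _ V(1) _ lim1 lim0, unfolded sp, OF \<phi>L(2) \<phi>L(2) \<phi>L(1) \<phi>L(1) V(2)]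
          pert[OF uL uL uL uL _ _ _ _ W2(1) _ lim0 lim0, unfolded sp, OF \<phi>L(1) \<phi>L(1) \<phi>L(1) \<phi>L(1) W2(2)])
    show "\<exists>N. \<forall>m\<ge>N. (LINT x|?M. G x * (\<phi> m x * \<phi> m x)) \<le>
       2 * (\<Sum>i\<in>UNIV. (LINT x|?M. W x * (partial i (\<phi> m) x * partial i (\<phi> m) x))
         + (LINT x|?M. V i x * (partial i (\<phi> m) x * \<phi> m x))) - (LINT x|?M. (W x)\<^sup>2 * (\<phi> m x * \<phi> m x))"
      using test[OF \<phi>] by blast
  qed
  \<comment> \<open>Green's formula trades the first-order terms back for the Laplacian; completing
    the square \<open>(L + W u)^2 \<ge> 0\<close> concludes.\<close>
  also have "\<dots> = (LINT x|?M. - 2 * (W x * (L x * u x)) - (W x)\<^sup>2 * (u x * u x))"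
    unfolding green[symmetric]
    using integrable_bounded_mult[OF L2_product_integrable[OF LL uL] W(1), unfolded sp, OF W(2)]
      integrable_bounded_mult[OF L2_product_integrable[OF uL uL] W2(1), unfolded sp, OF W2(2)]
    by simp
  also have "\<dots> \<le> (LINT x|?M. (L x)\<^sup>2)"
  proof (rule integral_mono)
    show "- 2 * (W x * (L x * u x)) - (W x)\<^sup>2 * (u x * u x) \<le> (L x)\<^sup>2" for x
      using zero_le_power2[of "L x + W x * u x"] by (simp add: power2_eq_square algebra_simps)
  qed (use integrable_bounded_mult[OF L2_product_integrable[OF LL uL] W(1), unfolded sp, OF W(2)]
      integrable_bounded_mult[OF L2_product_integrable[OF uL uL] W2(1), unfolded sp, OF W2(2)] L2_D[OF LL] in auto)
  finally show ?thesis unfolding L_def .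
qed

section \<open>Integration by parts\<close>

text \<open>Translation invariance kills the integrals of the difference quotients.\<close>

lemma integral_directional_derivative_zero:
  fixes g :: "'a::euclidean_space \<Rightarrow> real"
  assumes der: "\<And>x. (g has_derivative g' x) (at x)"
    and supp: "\<And>x. norm x > r \<Longrightarrow> g x = 0"
    and bd: "\<And>x. \<bar>g' x e\<bar> \<le> C"
  shows "integrable lborel (\<lambda>x. g' x e)" "(LINT x|lborel. g' x e) = 0"
proof -
  have C: "C \<ge> 0" using bd[of 0] by linarith
  have cont: "continuous_on UNIV g"
    using der by (meson continuous_at_imp_continuous_on has_derivative_continuous)
  have meas: "g \<in> borel_measurable lborel" using borel_measurable_continuous_onI[OF cont] by simp
  have dir: "((\<lambda>s. g (x + s *\<^sub>R e)) has_real_derivative g' (x + s *\<^sub>R e) e) (at s)" for x s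
  proof -
    have "((\<lambda>s. g (x + s *\<^sub>R e)) has_derivative (\<lambda>t. g' (x + s *\<^sub>R e) (t *\<^sub>R e))) (at s)"
      by (rule has_derivative_compose[OF _ der]) (auto intro!: derivative_eq_intros)
    moreover have "(\<lambda>t. g' (x + s *\<^sub>R e) (t *\<^sub>R e)) = (*) (g' (x + s *\<^sub>R e) e)"
      using linear_scale[OF has_derivative_linear[OF der]] by (auto simp: fun_eq_iff)
    ultimately show ?thesis by (simp add: has_field_derivative_def)
  qed
  \<comment> \<open>Difference quotients with step \<open>1 / (j + 1) \<le> 1\<close>: all of them
    vanish outside the ball enlarged by \<open>norm e\<close>, and the mean value theorem bounds
    them by \<open>C\<close>. Dominated convergence then works without continuity of the
    derivative.\<close>
  define q where "q j x = (g (x + (1 / real (Suc j)) *\<^sub>R e) - g x) * real (Suc j)" for j x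
  define K where "K = cball (0::'a) (r + norm e)"
  have mv: "\<bar>q j x\<bar> \<le> C" for j x
  proof -
    define h where "h = 1 / real (Suc j)"
    have h: "h > 0" by (simp add: h_def)
    have "\<exists>z>0. z < h \<and> g (x + h *\<^sub>R e) - g (x + 0 *\<^sub>R e) = (h - 0) * g' (x + z *\<^sub>R e) e"
    proof (rule MVT2[OF h])
      show "((\<lambda>s. g (x + s *\<^sub>R e)) has_real_derivative g' (x + s *\<^sub>R e) e) (at s)" for s
        by (rule dir)
    qed
    then obtain z where "g (x + h *\<^sub>R e) - g x = h * g' (x + z *\<^sub>R e) e" by auto
    then have "q j x = g' (x + z *\<^sub>R e) e" unfolding q_def h_def by simp
    then show ?thesis using bd by simp
  qed
  have qsupp: "q j x = 0" if "x \<notin> K" for j x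
  proof -
    have n: "norm x > r + norm e" using that by (simp add: K_def)
    have "norm ((1 / real (Suc j)) *\<^sub>R e) \<le> norm e"
      by (simp add: divide_le_eq mult_left_le_one_le mult_right_mono algebra_simps)
    moreover have "norm x \<le> norm (x + (1 / real (Suc j)) *\<^sub>R e) + norm ((1 / real (Suc j)) *\<^sub>R e)"
      by (metis add_diff_cancel norm_triangle_ineq4)
    ultimately have "norm (x + (1 / real (Suc j)) *\<^sub>R e) > r" using n by linarith
    moreover have "norm x > r" using n norm_ge_zero[of e] by linarith
    ultimately show ?thesis by (simp add: q_def supp)
  qed
  have lim: "(\<lambda>j. q j x) \<longlonglongrightarrow> g' x e" for x
  proof -
    have "((\<lambda>s. g (x + s *\<^sub>R e)) has_real_derivative g' x e) (at 0)"
      using dir[of x 0] by simp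
    then have "((\<lambda>s. (g (x + s *\<^sub>R e) - g x) / s) \<longlongrightarrow> g' x e) (at 0)"
      by (simp add: DERIV_def)
    moreover have "filterlim (\<lambda>j. 1 / real (Suc j)) (at 0) sequentially"
      unfolding filterlim_at using LIMSEQ_inverse_real_of_nat by (auto simp: inverse_eq_divide)
    ultimately have "(\<lambda>j. (g (x + (1 / real (Suc j)) *\<^sub>R e) - g x) / (1 / real (Suc j))) \<longlonglongrightarrow> g' x e"
      by (rule filterlim_compose)
    then show ?thesis by (simp add: q_def)
  qed
  have qm: "q j \<in> borel_measurable lborel" for j
    unfolding q_def using cont
    by (auto intro!: borel_measurable_continuous_onI continuous_intros continuous_on_compose2[OF cont])
  have Kfin: "integrable lborel (\<lambda>x. C * indicator K x)"
    unfolding K_def by (intro integrable_mult_right integrable_real_indicator) (auto intro!: emeasure_bounded_finite[unfolded infinity_ennreal_def])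
  have dom: "norm (q j x) \<le> C * indicator K x" for j x
    using mv[of j x] qsupp[of x j] by (cases "x \<in> K") auto
  have g'm: "(\<lambda>x. g' x e) \<in> borel_measurable lborel"
    by (rule borel_measurable_LIMSEQ_real[OF lim qm])
  have g'lim: "AE x in lborel. (\<lambda>j. q j x) \<longlonglongrightarrow> g' x e" using lim by simp
  show "integrable lborel (\<lambda>x. g' x e)"
    by (rule integrable_dominated_convergence[OF g'm qm Kfin g'lim]) (use dom in auto)
  have "(\<lambda>j. LINT x|lborel. q j x) \<longlonglongrightarrow> (LINT x|lborel. g' x e)"
    by (rule integral_dominated_convergence[OF g'm qm Kfin g'lim]) (use dom in auto)
  moreover have "(LINT x|lborel. q j x) = 0" for j
  proof -
    define h where "h = (1 / real (Suc j)) *\<^sub>R e"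
    have gint: "integrable lborel g"
    proof -
      have "integrable (restrict_space lborel (cball 0 r)) g"
        using borel_integrable_compact[of "cball 0 r" g] cont
        by (auto intro: continuous_on_subset simp: integrable_restrict_space)
      then have "integrable lborel (\<lambda>x. indicator (cball 0 r) x *\<^sub>R g x)"
        by (simp add: integrable_restrict_space)
      moreover have "(\<lambda>x. indicator (cball 0 r) x *\<^sub>R g x) = g"
        using supp by (auto simp: indicator_def fun_eq_iff)
      ultimately show ?thesis by simp
    qed
    have "integrable lborel (\<lambda>x. g (h + x))" "(LINT x|lborel. g (h + x)) = (LINT x|lborel. g x)"
    proof -
      have d: "lborel = distr lborel borel (\<lambda>x. h + x)" using lborel_distr_plus[of h] by simp
      have "(LINT x|distr lborel borel (\<lambda>x. h + x). g x) = (LINT x|lborel. g (h + x))"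
        using meas by (intro integral_distr) auto
      then show "(LINT x|lborel. g (h + x)) = (LINT x|lborel. g x)" using d by simp
      have "integrable (distr lborel borel (\<lambda>x. h + x)) g = integrable lborel (\<lambda>x. g (h + x))"
        using meas by (intro integrable_distr_eq) auto
      then show "integrable lborel (\<lambda>x. g (h + x))" using d gint by simp
    qed
    then show ?thesis using gint unfolding q_def h_def[symmetric] by (simp add: add.commute)
  qed
  ultimately show "(LINT x|lborel. g' x e) = 0"
    by (simp add: LIMSEQ_const_iff)
qed

section \<open>Radial weights\<close>

lemma max_zero_power_deriv:
  "((\<lambda>x::real. max 0 x ^ Suc (Suc k)) has_real_derivative real (Suc (Suc k)) * max 0 x ^ Suc k) (at x)"
proof -
  consider "x > 0" | "x < 0" | "x = 0" by linarith
  then show ?thesis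
  proof cases
    case 1
    have "((\<lambda>x::real. x ^ Suc (Suc k)) has_real_derivative real (Suc (Suc k)) * max 0 x ^ Suc k) (at x)"
      using 1 DERIV_pow[of "Suc (Suc k)" x] by (simp del: power_Suc)
    then show ?thesis
      by (rule has_field_derivative_transform_within_open[of _ _ _ "{0<..}"]) (use 1 in auto)
  next
    case 2
    have "((\<lambda>x::real. 0) has_real_derivative real (Suc (Suc k)) * max 0 x ^ Suc k) (at x)"
      using 2 by (auto intro!: derivative_eq_intros)
    then show ?thesis
      by (rule has_field_derivative_transform_within_open[of _ _ _ "{..<0}"]) (use 2 in auto)
  next
    case 3
    have "((\<lambda>y. (max 0 y ^ Suc (Suc k) - max 0 (0::real) ^ Suc (Suc k)) / (y - 0)) \<longlongrightarrow> 0) (at 0)"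
    proof (rule Lim_null_comparison)
      show "\<forall>\<^sub>F y in at 0. norm ((max 0 y ^ Suc (Suc k) - max 0 (0::real) ^ Suc (Suc k)) / (y - 0)) \<le> max 0 y ^ Suc k"
        by (intro always_eventually) (auto simp: max_def field_simps)
      have "((\<lambda>y::real. max 0 y ^ Suc k) \<longlongrightarrow> max 0 0 ^ Suc k) (at 0)"
        by (intro tendsto_intros)
      then show "((\<lambda>y::real. max 0 y ^ Suc k) \<longlongrightarrow> 0) (at 0)" by simp
    qed
    then show ?thesis using 3 by (simp add: has_field_derivative_iff)
  qed
qed

text \<open>
  A concave \<open>C\<^sup>2\<close> truncation, constant for arguments above \<open>M\<close>: it replaces the singular weight
  \<open>- \<Delta>\<phi> / \<phi>\<close> by one that is constant near the origin.
\<close>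

definition trunc :: "real \<Rightarrow> real \<Rightarrow> real" where
  "trunc M w = M / 3 * (1 - max 0 (1 - w / M) ^ 3)"

lemma trunc_deriv [derivative_intros]:
  assumes "(g has_real_derivative d) (at s)" "M > 0"
  shows "((\<lambda>s. trunc M (g s)) has_real_derivative max 0 (1 - g s / M) ^ 2 * d) (at s)"
    "((\<lambda>s. max 0 (1 - g s / M) ^ 2) has_real_derivative - (2 / M * max 0 (1 - g s / M)) * d) (at s)"
proof -
  have d: "((\<lambda>s. 1 - g s / M) has_real_derivative - d / M) (at s)"
    using assms by (auto intro!: derivative_eq_intros)
  show "((\<lambda>s. max 0 (1 - g s / M) ^ 2) has_real_derivative - (2 / M * max 0 (1 - g s / M)) * d) (at s)"
    using DERIV_chain2[OF max_zero_power_deriv[of 0] d] assms(2)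
    by (simp add: numeral_2_eq_2 mult_ac)
  have d3: "((\<lambda>s. max 0 (1 - g s / M) ^ 3) has_real_derivative 3 * max 0 (1 - g s / M) ^ 2 * (- d / M)) (at s)"
    using DERIV_chain2[OF max_zero_power_deriv[of 1] d] assms(2)
    by (simp add: numeral_2_eq_2 numeral_3_eq_3 mult_ac)
  show "((\<lambda>s. trunc M (g s)) has_real_derivative max 0 (1 - g s / M) ^ 2 * d) (at s)"
    unfolding trunc_def
    by (rule DERIV_cong[OF DERIV_cmult[OF DERIV_diff[OF DERIV_const d3]]]) (use assms in simp)
qed

text \<open>For \<open>\<theta> = trunc M\<close>, concavity with \<open>\<theta> 0 = 0\<close> and
  \<open>\<theta>' 0 = 1\<close> gives \<open>\<theta>' w * w \<le> \<theta> w \<le> w\<close>,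
  hence \<open>\<theta>' w * w^2 \<le> \<theta> w * w \<le> \<theta> w * (2 * w - \<theta>
  w)\<close>. Through this inequality the truncated weight still produces \<open>\<theta>'\<close>
  times the full potential.\<close>

lemma trunc_bounds:
  assumes "M > 0" "w \<ge> 0"
  shows "0 \<le> trunc M w"
    "max 0 (1 - w / M) ^ 2 * w\<^sup>2 \<le> trunc M w * (2 * w - trunc M w)"
proof -
  define x where "x = max 0 (1 - w / M)"
  have x: "0 \<le> x" "x \<le> 1" using assms by (auto simp: x_def)
  have th: "trunc M w = M / 3 * (1 - x ^ 3)" by (simp add: trunc_def x_def)
  have x3: "0 \<le> x ^ 3" "x ^ 3 \<le> 1" using x by (auto intro: power_le_one)
  show th0: "0 \<le> trunc M w"
    unfolding th using assms x3 by auto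
  have w: "w \<ge> M * (1 - x)" using assms by (auto simp: x_def max_def field_simps)
  have "trunc M w \<le> M * (1 - x)"
  proof -
    have "1 - x ^ 3 = (1 - x) * (1 + x + x * x)" by (simp add: algebra_simps power3_eq_cube)
    also have "\<dots> \<le> (1 - x) * 3" using x mult_mono[of x 1 x 1] by (intro mult_left_mono) auto
    finally show ?thesis unfolding th using assms by (simp add: mult_left_mono)
  qed
  then have tw: "trunc M w \<le> w" using w by simp
  have tw': "x ^ 2 * w \<le> trunc M w"
  proof (cases "w \<ge> M")
    case True
    then have "x = 0" using assms by (simp add: x_def)
    then show ?thesis using th0 by simp
  next
    case False
    then have weq: "w = M * (1 - x)" using assms by (simp add: x_def field_simps)
    \<comment> \<open>On \<open>w = M (1 - x)\<close> the difference factors, by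
      \<open>1 - 3 x^2 + 2 x^3 = (1 - x)^2 (1 + 2 x)\<close>.\<close>
    have "0 \<le> M / 3 * ((1 - x)\<^sup>2 * (1 + 2 * x))" using assms x by simp
    also have "\<dots> = trunc M w - x\<^sup>2 * (M * (1 - x))"
      unfolding th by (simp add: field_simps power2_eq_square power3_eq_cube)
    finally show ?thesis using weq by simp
  qed
  have "x ^ 2 * w\<^sup>2 \<le> trunc M w * w"
    using mult_right_mono[OF tw' assms(2)] by (simp add: power2_eq_square mult_ac)
  also have "\<dots> \<le> trunc M w * (2 * w - trunc M w)"
    using th0 tw by (intro mult_left_mono) auto
  finally show "max 0 (1 - w / M) ^ 2 * w\<^sup>2 \<le> trunc M w * (2 * w - trunc M w)" by (simp add: x_def)
qed

text \<open>A nondecreasing \<open>C^1\<close> cutoff from 0 at \<open>s = e\<close> to 1 at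
  \<open>s = 2 e\<close>; the two nested squares of positive parts make it flat at both
  ends.\<close>

definition ramp :: "real \<Rightarrow> real \<Rightarrow> real" where
  "ramp e s = 1 - max 0 (1 - max 0 (s / e - 1) ^ 2) ^ 2"

lemma ramp_deriv:
  assumes "e > 0"
  shows "(ramp e has_real_derivative 4 / e * max 0 (1 - max 0 (s / e - 1) ^ 2) * max 0 (s / e - 1)) (at s)"
proof -
  have d1: "((\<lambda>s. s / e - 1) has_real_derivative 1 / e) (at s)" for s
    using assms by (auto intro!: derivative_eq_intros)
  have d2: "((\<lambda>s. 1 - max 0 (s / e - 1) ^ 2) has_real_derivative - (2 / e * max 0 (s / e - 1))) (at s)"
    unfolding numeral_2_eq_2
    by (rule DERIV_cong[OF DERIV_diff[OF DERIV_const DERIV_chain2[OF max_zero_power_deriv[of 0] d1]]]) simp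
  have d3: "((\<lambda>s. max 0 (1 - max 0 (s / e - 1) ^ 2) ^ 2) has_real_derivative
      2 * max 0 (1 - max 0 (s / e - 1) ^ 2) * (- (2 / e * max 0 (s / e - 1)))) (at s)"
    using DERIV_chain2[OF max_zero_power_deriv[of 0] d2] by (simp add: numeral_2_eq_2)
  show ?thesis
    unfolding ramp_def[abs_def] by (rule DERIV_cong[OF DERIV_diff[OF DERIV_const d3]]) simp
qed

lemma ramp_bounds: "0 \<le> ramp e s" "ramp e s \<le> 1"
proof -
  have "max 0 (1 - max 0 (s / e - 1) ^ 2) ^ 2 \<le> 1" by (rule power_le_one) auto
  then show "0 \<le> ramp e s" "ramp e s \<le> 1" by (auto simp: ramp_def)
qed

lemma ramp_zero: "e > 0 \<Longrightarrow> s \<le> e \<Longrightarrow> ramp e s = 0"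
  by (simp add: ramp_def)

lemma ramp_one: 
  assumes "e > 0" "s \<ge> 2 * e" shows "ramp e s = 1" "max 0 (1 - max 0 (s / e - 1) ^ 2) = 0"
proof -
  have "(s / e - 1) \<ge> 1" using assms by (simp add: field_simps)
  then show "max 0 (1 - max 0 (s / e - 1) ^ 2) = 0" by (simp add: one_le_power)
  then show "ramp e s = 1" unfolding ramp_def by simp
qed

text \<open>The left-hand side is \<open>|x|^4 (- \<Delta>w - 2 \<nabla>w \<nabla>\<phi> / \<phi> +
  w^2)\<close>, which is \<open>|x|^4 \<Delta>^2 \<phi> / \<phi>\<close> since
  \<open>\<Delta>\<phi> = - w \<phi>\<close>. The right-hand side is
  \<open>(f'''' - m f'' + A^2 f) / f\<close> after inserting \<open>f'' = m (f - F)\<close> and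
  \<open>F'' = - S F / 4\<close>.\<close>

lemma potential_identity:
  fixes A m y q p S :: real
  assumes "m = 2 * A + 4" and v: "v = A + 2 * y + m * (q - 1)"
    and v1: "v1 = 2 * (m * (1 - q) - y\<^sup>2) + m * (q * (p - y))"
    and v2: "v2 = 2 * (- m * (q * (p - y)) - 2 * y * (m * (1 - q) - y\<^sup>2))
      + m * (q * (p - y)\<^sup>2 + q * (- S / 4 - p\<^sup>2 - (m * (1 - q) - y\<^sup>2)))"
  shows "- v2 - 2 * v1 - 2 * y * v1 - 4 * y * v + v\<^sup>2 = A\<^sup>2 + m / 4 * S * q"
  unfolding v2 v1 v assms(1) by (simp add: field_simps power2_eq_square)

section \<open>The radial profile and its truncated weight\<close>

lemma isCont_transform_within_open:
  assumes "isCont f x" "open S" "x \<in> S" "\<And>y. y \<in> S \<Longrightarrow> f y = g y"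
  shows "isCont g x"
proof -
  have "\<forall>\<^sub>F y in nhds x. f y = g y"
    using assms by (auto simp: eventually_nhds)
  then show ?thesis using assms(1) by (simp add: isCont_cong)
qed

text \<open>
  The functions depend on \<open>s = |x|\<^sup>2\<close>. For \<open>\<phi>(x) = |x|\<^sup>a f(t)\<close> with \<open>t = ln (\<rho> / |x|)\<close>, the data are
  \<open>Y = f' / f\<close>, \<open>Q = F / f\<close> and \<open>P = F' / F\<close>, where \<open>f'' = m (f - F)\<close> and \<open>F'' = - S F / 4\<close>; since
  \<open>dt / ds = - 1 / (2 s)\<close>, their equations in \<open>t\<close> become those below.
\<close>

locale radial_profile =
  fixes n A m a \<sigma> :: real and Y Q P S :: "real \<Rightarrow> real"
  assumes n: "n \<ge> 4" and A_def: "A = n * (n - 4) / 4" and m_def: "m = 2 * A + 4"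
    and a_def: "a = 2 - n / 2" and \<sigma>: "\<sigma> > 0"
    and Y': "\<And>s. 0 < s \<Longrightarrow> s < \<sigma> \<Longrightarrow> (Y has_real_derivative - (m * (1 - Q s) - (Y s)\<^sup>2) / (2 * s)) (at s)"
    and Q': "\<And>s. 0 < s \<Longrightarrow> s < \<sigma> \<Longrightarrow> (Q has_real_derivative - (Q s * (P s - Y s)) / (2 * s)) (at s)"
    and P': "\<And>s. 0 < s \<Longrightarrow> s < \<sigma> \<Longrightarrow> (P has_real_derivative (S s / 4 + (P s)\<^sup>2) / (2 * s)) (at s)"
    and Y: "\<And>s. 0 < s \<Longrightarrow> s < \<sigma> \<Longrightarrow> Y s \<ge> 0"
    and Q: "\<And>s. 0 < s \<Longrightarrow> s < \<sigma> \<Longrightarrow> Q s \<ge> 1"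
    and S: "\<And>s. 0 < s \<Longrightarrow> s < \<sigma> \<Longrightarrow> S s \<ge> 0"
    and contS: "\<And>s. 0 < s \<Longrightarrow> s < \<sigma> \<Longrightarrow> isCont S s"
    and large: "\<And>M. \<exists>\<delta>>0. \<delta> < \<sigma> \<and> (\<forall>s. 0 < s \<longrightarrow> s \<le> \<delta> \<longrightarrow> M * s \<le> A + 2 * Y s + m * (Q s - 1))"
begin

lemma A_nonneg: "A \<ge> 0" using n by (simp add: A_def)
lemma m_ge_4: "m \<ge> 4" using A_nonneg by (simp add: m_def)

text \<open>Here \<open>w = - \<Delta>\<phi> / \<phi>\<close> and \<open>v = s w\<close>; \<open>v1\<close> and \<open>v2\<close> are derivatives of \<open>v\<close> with respect to \<open>t\<close>,
  while \<open>w1\<close> and \<open>w2\<close> are derivatives with respect to \<open>s\<close>.\<close>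

definition v where "v s = A + 2 * Y s + m * (Q s - 1)"
definition v1 where "v1 s = 2 * (m * (1 - Q s) - (Y s)\<^sup>2) + m * (Q s * (P s - Y s))"
definition v2 where "v2 s = 2 * (- m * (Q s * (P s - Y s)) - 2 * Y s * (m * (1 - Q s) - (Y s)\<^sup>2))
      + m * (Q s * (P s - Y s)\<^sup>2 + Q s * (- S s / 4 - (P s)\<^sup>2 - (m * (1 - Q s) - (Y s)\<^sup>2)))"
definition w where "w s = v s / s"
definition w1 where "w1 s = - (v1 s + 2 * v s) / (2 * s\<^sup>2)"
definition w2 where "w2 s = (v2 s + 2 * v1 s) / (4 * s ^ 3) + (v1 s + 2 * v s) / s ^ 3"

lemma v': "0 < s \<Longrightarrow> s < \<sigma> \<Longrightarrow> (v has_real_derivative - v1 s / (2 * s)) (at s)"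
  unfolding v_def[abs_def] v1_def
  by (auto intro!: derivative_eq_intros Y' Q' simp: field_simps)

lemma v1': "0 < s \<Longrightarrow> s < \<sigma> \<Longrightarrow> (v1 has_real_derivative - v2 s / (2 * s)) (at s)"
  unfolding v1_def[abs_def] v2_def
  by (auto intro!: derivative_eq_intros Y' Q' P' simp: field_simps power2_eq_square)

lemma w': "0 < s \<Longrightarrow> s < \<sigma> \<Longrightarrow> (w has_real_derivative w1 s) (at s)"
  unfolding w_def[abs_def] w1_def
  by (auto intro!: derivative_eq_intros v' simp: field_simps power2_eq_square)

lemma w1': "0 < s \<Longrightarrow> s < \<sigma> \<Longrightarrow> (w1 has_real_derivative w2 s) (at s)"
  unfolding w1_def[abs_def] w2_def
  by (auto intro!: derivative_eq_intros v' v1' simp: field_simps power2_eq_square power3_eq_cube)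

lemma v_nonneg: "0 < s \<Longrightarrow> s < \<sigma> \<Longrightarrow> v s \<ge> 0"
  unfolding v_def using A_nonneg m_ge_4 Y[of s] Q[of s] by simp

lemma w_nonneg: "0 < s \<Longrightarrow> s < \<sigma> \<Longrightarrow> w s \<ge> 0"
  unfolding w_def using v_nonneg[of s] by simp

lemma isCont_data:
  assumes "0 < s" "s < \<sigma>"
  shows "isCont Y s" "isCont Q s" "isCont P s" "isCont v s" "isCont v1 s" "isCont v2 s"
    "isCont w s" "isCont w1 s" "isCont w2 s"
proof -
  show c: "isCont Y s" "isCont Q s" "isCont P s" "isCont v s" "isCont v1 s" "isCont w s" "isCont w1 s"
    using Y'[OF assms] Q'[OF assms] P'[OF assms] v'[OF assms] v1'[OF assms] w'[OF assms] w1'[OF assms]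
    by (auto intro: DERIV_isCont)
  show v2: "isCont v2 s"
    unfolding v2_def[abs_def] using c contS[OF assms] by (auto intro!: continuous_intros)
  show "isCont w2 s"
    unfolding w2_def[abs_def] using c v2 assms by (auto intro!: continuous_intros)
qed

text \<open>For \<open>s \<le> 0\<close> the quotient \<open>v s / s\<close> carries no information;
  the value chosen is the constant that \<open>trunc M\<close> takes above \<open>M\<close>, so the
  weight is constant across the origin.\<close>

definition W where "W M s = (if s \<le> 0 then M / 3 else trunc M (w s))"
definition W1 where "W1 M s = (if s \<le> 0 then 0 else max 0 (1 - w s / M) ^ 2 * w1 s)"
definition W2 where "W2 M s = (if s \<le> 0 then 0 else
   - (2 / M * max 0 (1 - w s / M)) * w1 s * w1 s + max 0 (1 - w s / M) ^ 2 * w2 s)"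

text \<open>The weight of the final inequality times the slope of \<open>trunc M\<close> at
  \<open>w\<close>: it vanishes where \<open>w \<ge> M\<close>, in particular near the origin, and
  tends to the full weight as \<open>M\<close> grows.\<close>

definition potential where
  "potential M s = max 0 (1 - w s / M) ^ 2 * ((A\<^sup>2 + m / 4 * S s) / s\<^sup>2)"

text \<open>The field \<open>Z = zc(|x|\<^sup>2) x\<close> is \<open>\<nabla>\<phi> / \<phi>\<close>, switched off near the origin, and
  \<open>B(|x|\<^sup>2) x = \<nabla>W + 2 W Z\<close>.\<close>

definition "zc e s = ramp e s * (a - Y s) / s"
definition "zc1 e s = 4 / e * max 0 (1 - max 0 (s / e - 1) ^ 2) * max 0 (s / e - 1) * (a - Y s) / s
   + ramp e s * ((m * (1 - Q s) - (Y s)\<^sup>2) / (2 * s\<^sup>2) - (a - Y s) / s\<^sup>2)"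

definition "B M e s = 2 * W M s * zc e s + 2 * W1 M s"
definition "B1 M e s = 2 * W1 M s * zc e s + 2 * W M s * zc1 e s + 2 * W2 M s"

context
  fixes M e :: real
  assumes M: "M > 0" and e: "e > 0" and e\<sigma>: "2 * e < \<sigma>"
    and we: "\<And>s. 0 < s \<Longrightarrow> s \<le> 2 * e \<Longrightarrow> w s \<ge> M"
begin

lemma flat: 
  assumes "s \<le> 2 * e"
  shows "W M s = M / 3" "W1 M s = 0" "W2 M s = 0"
proof -
  have "max 0 (1 - w s / M) = 0" if "s > 0" using we[OF that assms] M by simp
  then show "W M s = M / 3" "W1 M s = 0" "W2 M s = 0"
    by (auto simp: W_def W1_def W2_def trunc_def)
qed

lemma W_deriv:
  assumes "s < \<sigma>"
  shows "(W M has_real_derivative W1 M s) (at s)" "(W1 M has_real_derivative W2 M s) (at s)"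
    "isCont (W1 M) s" "isCont (W2 M) s"
proof -
  have "(W M has_real_derivative W1 M s) (at s) \<and> (W1 M has_real_derivative W2 M s) (at s)
    \<and> isCont (W2 M) s"
  proof (cases "s < e")
    case True
    have fl: "W M x = M / 3" "W1 M x = 0" "W2 M x = 0" if "x < e" for x using flat[of x] that e by simp_all
    have "(W M has_real_derivative 0) (at s)"
      by (rule has_field_derivative_transform_within_open[of "\<lambda>_. M / 3" _ _ "{..<e}"]) (use True fl in auto)
    moreover have "(W1 M has_real_derivative 0) (at s)"
      by (rule has_field_derivative_transform_within_open[of "\<lambda>_. 0" _ _ "{..<e}"]) (use True fl in auto)
    moreover have "isCont (W2 M) s"
      by (rule isCont_transform_within_open[where f="\<lambda>_. 0" and S="{..<e}"]) (use True fl in auto)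
    ultimately show ?thesis using fl[OF True] by simp
  next
    case False
    then have s: "s > 0" "s < \<sigma>" using e assms by auto
    have "((\<lambda>x. trunc M (w x)) has_real_derivative W1 M s) (at s)"
      using s M by (auto intro!: derivative_eq_intros w' simp: W1_def)
    then have "(W M has_real_derivative W1 M s) (at s)"
      by (rule has_field_derivative_transform_within_open[of _ _ _ "{0<..}"]) (use s in \<open>auto simp: W_def\<close>)
    moreover have "((\<lambda>x. max 0 (1 - w x / M) ^ 2 * w1 x) has_real_derivative W2 M s) (at s)"
      by (rule DERIV_cong[OF DERIV_mult'[OF trunc_deriv(2)[OF w'[OF s] M] w1'[OF s]]]) (use s in \<open>simp add: W2_def\<close>)
    then have "(W1 M has_real_derivative W2 M s) (at s)"
      by (rule has_field_derivative_transform_within_open[of _ _ _ "{0<..}"]) (use s in \<open>auto simp: W1_def\<close>)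
    moreover have "isCont (\<lambda>x. - (2 / M * max 0 (1 - w x / M)) * w1 x * w1 x + max 0 (1 - w x / M) ^ 2 * w2 x) s"
      using s M isCont_data[of s] by (auto intro!: continuous_intros)
    then have "isCont (W2 M) s"
      by (rule isCont_transform_within_open[where S="{0<..}"]) (use s in \<open>auto simp: W2_def\<close>)
    ultimately show ?thesis by blast
  qed
  then show "(W M has_real_derivative W1 M s) (at s)" "(W1 M has_real_derivative W2 M s) (at s)"
    "isCont (W1 M) s" "isCont (W2 M) s" by (auto intro: DERIV_isCont)
qed

lemma zc_deriv:
  assumes "s < \<sigma>"
  shows "(zc e has_real_derivative zc1 e s) (at s)" "isCont (zc1 e) s"
proof -
  have "(zc e has_real_derivative zc1 e s) (at s) \<and> isCont (zc1 e) s"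
  proof (cases "s < e")
    case True
    have z: "zc e x = 0 \<and> zc1 e x = 0" if "x < e" for x
    proof -
      have "max 0 (x / e - 1) = 0" using that e by simp
      then show ?thesis using that e ramp_zero[of e x] unfolding zc_def zc1_def by simp
    qed
    have "(zc e has_real_derivative 0) (at s)"
      by (rule has_field_derivative_transform_within_open[of "\<lambda>_. 0" _ _ "{..<e}"]) (use True z in auto)
    moreover have "isCont (zc1 e) s"
      by (rule isCont_transform_within_open[where f="\<lambda>_. 0" and S="{..<e}"]) (use True z in auto)
    ultimately show ?thesis using z[OF True] by simp
  next
    case False
    then have s: "s > 0" "s < \<sigma>" using e assms by auto
    have "(zc e has_real_derivative zc1 e s) (at s)"
      unfolding zc_def[abs_def] zc1_def using s e
      by (auto intro!: derivative_eq_intros ramp_deriv Y' simp: field_simps power2_eq_square)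
    moreover have "isCont (ramp e) s" using ramp_deriv[OF e] by (rule DERIV_isCont)
    then have "isCont (zc1 e) s"
      unfolding zc1_def[abs_def] using s e isCont_data[of s] by (auto intro!: continuous_intros)
    ultimately show ?thesis by blast
  qed
  then show "(zc e has_real_derivative zc1 e s) (at s)" "isCont (zc1 e) s" by auto
qed

lemma B_deriv:
  assumes "s < \<sigma>"
  shows "(B M e has_real_derivative B1 M e s) (at s)" "isCont (B1 M e) s"
proof -
  show "(B M e has_real_derivative B1 M e s) (at s)"
    unfolding B_def[abs_def] B1_def using assms by (auto intro!: derivative_eq_intros W_deriv zc_deriv)
  have "isCont (W M) s" "isCont (zc e) s"
    using W_deriv[OF assms] zc_deriv[OF assms] by (auto intro: DERIV_isCont)
  then show "isCont (B1 M e) s"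
    unfolding B1_def[abs_def] using W_deriv[OF assms] zc_deriv[OF assms]
    by (auto intro!: continuous_intros)
qed

lemma W_nonneg: "s < \<sigma> \<Longrightarrow> W M s \<ge> 0"
  unfolding W_def using M trunc_bounds(1)[OF M] w_nonneg[of s] by auto

text \<open>With \<open>Z = (a - Y) x / s\<close> this is \<open>w = - (div Z + |Z|^2)\<close>: the
  first two terms of the bracket are \<open>s * div Z\<close>, the last one is
  \<open>s * |Z|^2\<close>.\<close>

lemma drift_bracket:
  assumes "0 < s" "s < \<sigma>"
  shows "w s = - ((n - 2) * (a - Y s) + (m * (1 - Q s) - (Y s)\<^sup>2) + (a - Y s)\<^sup>2) / s"
proof -
  have "v s = - ((n - 2) * (a - Y s) + (m * (1 - Q s) - (Y s)\<^sup>2) + (a - Y s)\<^sup>2)"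
    unfolding v_def unfolding a_def A_def by (simp add: field_simps power2_eq_square)
  then show ?thesis unfolding w_def by (rule arg_cong)
qed

text \<open>
  The left-hand side is \<open>- div (\<nabla>W + 2 W Z) - 2 W |Z|\<^sup>2 - W\<^sup>2\<close>. Without truncation it would equal
  \<open>\<Delta>\<^sup>2\<phi> / \<phi>\<close>; the concavity of the truncation makes its contribution nonnegative, and the cutoff of
  \<open>Z\<close> costs at most \<open>W\<^sup>2\<close> on a small ball.
\<close>

lemma energy_lower_bound:
  assumes "0 \<le> s" "s < \<sigma>"
  shows "- (n * B M e s + 2 * s * B1 M e s + 2 * W M s * (s * (zc e s)\<^sup>2) + (W M s)\<^sup>2)
    \<ge> potential M s - (if s < 2 * e then (M / 3)\<^sup>2 else 0)"
proof (cases "s < 2 * e")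
  case True
  show ?thesis
  proof (cases "s = 0")
    case True
    \<comment> \<open>At \<open>s = 0\<close> all quotients by \<open>s\<close> are zero by
      convention, so only \<open>- (M / 3)^2\<close> is left on both sides.\<close>
    then show ?thesis using e by (simp add: B_def B1_def zc_def zc1_def potential_def flat)
  next
    case False
    then have s: "s > 0" using assms by simp
    define k where "k = (a - Y s)\<^sup>2 / s"
    note fl = flat[OF less_imp_le[OF \<open>s < 2 * e\<close>]]
    define l where "l = ramp e s"
    define l1 where "l1 = 4 / e * max 0 (1 - max 0 (s / e - 1) ^ 2) * max 0 (s / e - 1)"
    define z where "z = a - Y s"
    have l: "0 \<le> l" "l \<le> 1" using ramp_bounds by (auto simp: l_def)
    have l1: "l1 \<ge> 0" using e by (simp add: l1_def)
    have z: "z \<le> 0" using Y[OF s assms(2)] n by (simp add: z_def a_def)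
    have pot: "potential M s = 0" using we[of s] True s M by (simp add: potential_def)
    define d where "d = m * (1 - Q s) - (Y s)\<^sup>2"
    have zc: "zc e s = l * (z / s)" "s * (zc e s)\<^sup>2 = l\<^sup>2 * (z\<^sup>2 / s)"
      using s by (simp_all add: zc_def l_def z_def power2_eq_square)
    have zc1: "s * zc1 e s = l1 * z + l * (d / s / 2 - z / s)"
    proof -
      have "zc1 e s = l1 * z / s + l * (d / (2 * s\<^sup>2) - z / s\<^sup>2)"
        by (simp add: zc1_def l_def l1_def z_def d_def)
      then show ?thesis using s by (simp add: field_simps power2_eq_square)
    qed
    have ws: "w s = - (n - 2) * (z / s) - d / s - z\<^sup>2 / s"
      unfolding drift_bracket[OF s assms(2)] z_def d_def using s by (simp add: field_simps)
    have B: "B M e s = 2 * (M / 3) * (l * (z / s))" "s * B1 M e s = 2 * (M / 3) * (s * zc1 e s)"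
      unfolding B_def B1_def zc fl by simp_all
    have "- (n * B M e s + 2 * (s * B1 M e s) + 2 * W M s * (s * (zc e s)\<^sup>2) + (W M s)\<^sup>2)
       = - (M / 3)\<^sup>2 + 2 * (M / 3) * (l * w s - 2 * l1 * z + (l - l\<^sup>2) * (z\<^sup>2 / s))"
      unfolding ws B zc1 zc(2) fl k_def[folded z_def, symmetric] by (simp add: algebra_simps)
    \<comment> \<open>Each term is nonnegative: \<open>w \<ge> 0\<close>; the cutoff increases while
      \<open>z = a - Y \<le> 0\<close>; and \<open>0 \<le> l \<le> 1\<close>.\<close>
    moreover have "l * w s - 2 * l1 * z + (l - l\<^sup>2) * (z\<^sup>2 / s) \<ge> 0"
    proof -
      have "l * w s \<ge> 0" using l w_nonneg[OF s assms(2)] by simp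
      moreover have "l1 * z \<le> 0" using l1 z by (simp add: mult_nonneg_nonpos)
      moreover have "l - l\<^sup>2 \<ge> 0" using l by (simp add: power2_eq_square mult_left_le)
      then have "(l - l\<^sup>2) * (z\<^sup>2 / s) \<ge> 0" using s by simp
      ultimately show ?thesis by linarith
    qed
    moreover from this have "0 \<le> 2 * (M / 3) * (l * w s - 2 * l1 * z + (l - l\<^sup>2) * (z\<^sup>2 / s))"
      using M by simp
    ultimately show ?thesis using True pot by (simp add: mult.assoc)
  qed
next
  case False
  then have s: "s > 0" using e by simp
  define z where "z = a - Y s"
  define th where "th = max 0 (1 - w s / M) ^ 2"
  define th2 where "th2 = 2 / M * max 0 (1 - w s / M)"
  have th: "th \<ge> 0" "th2 \<ge> 0" using M by (auto simp: th_def th2_def)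
  have "s \<ge> 2 * e" using False by simp
  note r = ramp_one[OF e this]
  have W: "W M s = trunc M (w s)" "W1 M s = th * w1 s" "W2 M s = - th2 * w1 s * w1 s + th * w2 s"
    using s by (auto simp: W_def W1_def W2_def th_def th2_def)
  define d where "d = m * (1 - Q s) - (Y s)\<^sup>2"
  have zc: "zc e s = z / s" "s * (zc e s)\<^sup>2 = z\<^sup>2 / s"
    using s by (simp_all add: zc_def r z_def power2_eq_square)
  have zc1: "s * zc1 e s = d / s / 2 - z / s"
  proof -
    have "zc1 e s = d / (2 * s\<^sup>2) - z / s\<^sup>2"
      by (simp add: zc1_def r z_def d_def)
    then show ?thesis using s by (simp add: field_simps power2_eq_square)
  qed
  have ws: "w s = - (n - 2) * (z / s) - d / s - z\<^sup>2 / s"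
    unfolding drift_bracket[OF s assms(2)] z_def d_def using s by (simp add: field_simps)
  \<comment> \<open>The left-hand side is \<open>- \<Delta>w - 2 \<nabla>w Z\<close>, the right-hand
    side \<open>\<Delta>^2 \<phi> / \<phi> - w^2\<close>.\<close>
  have main: "- 2 * n * w1 s - 4 * w1 s * z - 4 * (s * w2 s) = (A\<^sup>2 + m / 4 * S s * Q s) / s\<^sup>2 - (w s)\<^sup>2"
  proof -
    define k where "k = 1 / s\<^sup>2"
    have w12: "w1 s = - (v1 s + 2 * v s) * k / 2" "s * w2 s = (v2 s + 2 * v1 s) * k / 4 + (v1 s + 2 * v s) * k"
      "(w s)\<^sup>2 = (v s)\<^sup>2 * k"
      using s by (simp_all add: w1_def w2_def w_def k_def field_simps power2_eq_square power3_eq_cube)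
    have "- 2 * n * w1 s - 4 * w1 s * z - 4 * (s * w2 s)
      = (- v2 s - 2 * v1 s - 2 * Y s * v1 s - 4 * Y s * v s + (v s)\<^sup>2) * k - (w s)\<^sup>2"
      unfolding w12 z_def a_def by (simp add: field_simps)
    also have "- v2 s - 2 * v1 s - 2 * Y s * v1 s - 4 * Y s * v s + (v s)\<^sup>2 = A\<^sup>2 + m / 4 * S s * Q s"
      by (rule potential_identity[OF m_def v_def v1_def v2_def])
    finally show ?thesis by (simp add: k_def)
  qed
  have B: "B M e s = 2 * trunc M (w s) * (z / s) + 2 * (th * w1 s)"
    "s * B1 M e s = 2 * (th * w1 s) * z + 2 * trunc M (w s) * (s * zc1 e s) + 2 * (th * (s * w2 s) - s * th2 * (w1 s)\<^sup>2)"
    using s by (simp_all add: B_def B1_def zc W field_simps power2_eq_square)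
  \<comment> \<open>The chain rule for \<open>trunc M (w s)\<close> separates three contributions:
    the slope \<open>th\<close> times the untruncated expression, a nonnegative term from concavity
    (\<open>th2\<close> is minus the second derivative), and a zeroth-order term that pays for
    \<open>- th * (w s)^2\<close> by \<open>trunc_bounds\<close>.\<close>
  have "- (n * B M e s + 2 * (s * B1 M e s) + 2 * W M s * (s * (zc e s)\<^sup>2) + (W M s)\<^sup>2)
     = th * (- 2 * n * w1 s - 4 * w1 s * z - 4 * (s * w2 s)) + 4 * s * th2 * (w1 s)\<^sup>2
       + trunc M (w s) * (2 * (- (n - 2) * (z / s) - d / s - z\<^sup>2 / s) - trunc M (w s))"
    unfolding B zc1 zc(2) W(1) by (simp add: algebra_simps power2_eq_square)
  also have "\<dots> = th * (- 2 * n * w1 s - 4 * w1 s * z - 4 * (s * w2 s)) + 4 * s * th2 * (w1 s)\<^sup>2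
       + trunc M (w s) * (2 * w s - trunc M (w s))"
    unfolding ws ..
  also have "\<dots> \<ge> th * ((A\<^sup>2 + m / 4 * S s * Q s) / s\<^sup>2)"
  proof -
    have "4 * s * th2 * (w1 s)\<^sup>2 \<ge> 0" using th s by simp
    then show ?thesis
      unfolding main using trunc_bounds(2)[OF M w_nonneg[OF s assms(2)]]
      by (simp add: th_def[symmetric] right_diff_distrib)
  qed
  \<comment> \<open>\<open>Q \<ge> 1\<close>, the purpose of replacing \<open>F\<close> by
    \<open>f\<close>, enters here.\<close>
  also have "th * ((A\<^sup>2 + m / 4 * S s * Q s) / s\<^sup>2) \<ge> th * ((A\<^sup>2 + m / 4 * S s) / s\<^sup>2)"
  proof -
    have "m / 4 * S s * 1 \<le> m / 4 * S s * Q s"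
      using m_ge_4 S[OF s assms(2)] Q[OF s assms(2)] by (intro mult_left_mono) auto
    then show ?thesis
      using th by (intro mult_left_mono divide_right_mono add_left_mono) auto
  qed
  finally show ?thesis using False by (simp add: potential_def th_def mult.assoc)
qed

end

text \<open>By \<open>large\<close>, \<open>w = v / s\<close> is unbounded at the origin, so for
  fixed \<open>M\<close> the cutoff ball may be taken arbitrarily small, and with it the defect
  \<open>(M / 3)^2\<close> that the cutoff causes.\<close>

lemma flat_radius:
  assumes "M > 0" "\<epsilon> > 0"
  obtains e where "e > 0" "e < \<epsilon>" "2 * e < \<sigma>" "\<And>s. 0 < s \<Longrightarrow> s \<le> 2 * e \<Longrightarrow> w s \<ge> M"
proof -
  from large[of M] obtain \<delta> where \<delta>: "\<delta> > 0" "\<delta> < \<sigma>"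
    "\<And>s. 0 < s \<Longrightarrow> s \<le> \<delta> \<Longrightarrow> M * s \<le> v s"
    by (auto simp: v_def)
  show thesis
  proof (rule that[of "min (\<delta> / 2) (\<epsilon> / 2)"])
    fix s assume "0 < s" "s \<le> 2 * min (\<delta> / 2) (\<epsilon> / 2)"
    then show "w s \<ge> M" using \<delta>(3)[of s] by (auto simp: w_def pos_le_divide_eq)
  qed (use \<delta> assms in auto)
qed

end

section \<open>The weighted inequality\<close>

lemma integral_lebesgue_on_supported:
  fixes f :: "'a::euclidean_space \<Rightarrow> real"
  assumes "f \<in> borel_measurable borel" "\<And>x. x \<notin> \<Omega> \<Longrightarrow> f x = 0" "open \<Omega>"
  shows "(LINT x|lebesgue_on \<Omega>. f x) = (LINT x|lborel. f x)"
proof -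
  have "(LINT x|lebesgue_on \<Omega>. f x) = (LINT x|lebesgue. indicator \<Omega> x *\<^sub>R f x)"
    using assms(3) by (intro integral_restrict_space) auto
  also have "(\<lambda>x. indicator \<Omega> x *\<^sub>R f x) = f"
    using assms(2) by (auto simp: indicator_def fun_eq_iff)
  also have "(LINT x|lebesgue. f x) = (LINT x|lborel. f x)"
    using assms(1) by (intro integral_completion) auto
  finally show ?thesis .
qed

text \<open>\<open>h\<close> is an explicit expression for the derivative on
  \<open>\<Omega>\<close>; its continuity up to the closure provides the uniform bound required for
  dominated convergence, while everything vanishes off \<open>K\<close>.\<close>

lemma integral_partial_eq_0:
  fixes g :: "real^'n \<Rightarrow> real"
  assumes \<Omega>: "open \<Omega>" "bounded \<Omega>" and K: "K \<subseteq> \<Omega>" "\<And>x. x \<notin> K \<Longrightarrow> (g has_derivative (\<lambda>_. 0)) (at x)"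
    "\<And>x. x \<notin> K \<Longrightarrow> g x = 0"
    and d: "\<And>x. x \<in> \<Omega> \<Longrightarrow> g differentiable (at x)"
    and h: "\<And>x. x \<in> \<Omega> \<Longrightarrow> partial i g x = h x" "continuous_on (closure \<Omega>) h"
  shows "integrable (lebesgue_on \<Omega>) h" "(LINT x|lebesgue_on \<Omega>. h x) = 0"
proof -
  obtain C where C: "\<And>x. x \<in> \<Omega> \<Longrightarrow> \<bar>h x\<bar> \<le> C"
    using continuous_bounded_on_bounded[OF \<Omega>(2) h(2)] by blast
  obtain r where r: "\<And>x. x \<in> \<Omega> \<Longrightarrow> norm x \<le> r" using \<Omega>(2) by (auto simp: bounded_iff)
  have out: "partial i g x = 0" if "x \<notin> K" for x using partial_eqI[OF K(2)[OF that]] .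
  have "g differentiable (at x)" for x
  proof (cases "x \<in> K")
    case True
    then show ?thesis using d K(1) by blast
  next
    case False
    then show ?thesis using K(2) by (auto simp: differentiable_def)
  qed
  then have der: "(g has_derivative frechet_derivative g (at x)) (at x)" for x
    by (simp add: frechet_derivative_works)
  have bd: "\<bar>frechet_derivative g (at x) (axis i 1)\<bar> \<le> \<bar>C\<bar>" for x
  proof (cases "x \<in> K")
    case True
    then have "partial i g x = h x" "\<bar>h x\<bar> \<le> C" using K(1) h(1) C by auto
    then show ?thesis by (simp add: partial_def)
  next
    case False
    then show ?thesis using out by (simp add: partial_def)
  qed
  have supp: "g x = 0" if "norm x > r" for x using K(1,3) r that by (metis not_le subsetD)
  have int: "integrable lborel (partial i g)" and z: "(LINT x|lborel. partial i g x) = 0"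
    using integral_directional_derivative_zero[OF der supp bd] by (simp_all add: partial_def[abs_def])
  show "integrable (lebesgue_on \<Omega>) h"
    using L2_product_integrable[OF continuous_in_L2[OF \<Omega> h(2)] continuous_in_L2[OF \<Omega> continuous_on_const[of _ 1]]]
    by simp
  have "(LINT x|lebesgue_on \<Omega>. h x) = (LINT x|lebesgue_on \<Omega>. partial i g x)"
    using h(1) by (intro Bochner_Integration.integral_cong) auto
  also have "\<dots> = (LINT x|lborel. partial i g x)"
    using int out K(1) \<Omega>(1) by (intro integral_lebesgue_on_supported) auto
  finally show "(LINT x|lebesgue_on \<Omega>. h x) = 0" using z by simp
qed

lemma isCont_continuous_on_radial:
  assumes "\<And>s. 0 \<le> s \<Longrightarrow> s < \<sigma> \<Longrightarrow> isCont f s" "\<And>x. x \<in> S \<Longrightarrow> norm x ^ 2 < \<sigma>"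
  shows "continuous_on S (\<lambda>x::'a::real_normed_vector. f (norm x ^ 2))"
proof (rule continuous_at_imp_continuous_on, rule ballI)
  fix x assume "x \<in> S"
  then have "isCont f (norm x ^ 2)" using assms by simp
  then show "isCont (\<lambda>x. f (norm x ^ 2)) x"
    by (rule isCont_o2[where f="\<lambda>x. norm x ^ 2", rotated]) (intro continuous_intros)
qed

context radial_profile begin

context
  fixes M e :: real and \<Omega> :: "(real^'n) set"
  assumes M: "M > 0" and e: "e > 0" and e\<sigma>: "2 * e < \<sigma>"
    and we: "\<And>s. 0 < s \<Longrightarrow> s \<le> 2 * e \<Longrightarrow> w s \<ge> M"
    and \<Omega>: "open \<Omega>" "bounded \<Omega>" "\<And>x. x \<in> closure \<Omega> \<Longrightarrow> norm x ^ 2 < \<sigma>"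
    and dim: "n = real CARD('n)"
begin

lemma in_domain: "x \<in> \<Omega> \<Longrightarrow> norm x ^ 2 < \<sigma>"
  using \<Omega>(3) closure_subset by blast

lemma weights_continuous_on:
  "continuous_on (closure \<Omega>) (\<lambda>x. W M (norm x ^ 2))"
  "continuous_on (closure \<Omega>) (\<lambda>x. W1 M (norm x ^ 2))"
  "continuous_on (closure \<Omega>) (\<lambda>x. B M e (norm x ^ 2))"
  "continuous_on (closure \<Omega>) (\<lambda>x. B1 M e (norm x ^ 2))"
  "continuous_on (closure \<Omega>) (\<lambda>x. potential M (norm x ^ 2))"
proof -
  note W = W_deriv[OF M e e\<sigma> we] and B = B_deriv[OF M e e\<sigma> we]
  show "continuous_on (closure \<Omega>) (\<lambda>x. W M (norm x ^ 2))"
    "continuous_on (closure \<Omega>) (\<lambda>x. W1 M (norm x ^ 2))"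
    "continuous_on (closure \<Omega>) (\<lambda>x. B M e (norm x ^ 2))"
    "continuous_on (closure \<Omega>) (\<lambda>x. B1 M e (norm x ^ 2))"
    using W(3) B(2) DERIV_isCont[OF W(1)] DERIV_isCont[OF B(1)]
    by (auto intro!: isCont_continuous_on_radial[OF _ \<Omega>(3)])
  have pot0: "potential M (norm x ^ 2) = 0" if "norm x ^ 2 < 2 * e" for x :: "real^'n"
  proof (cases "x = 0")
    case False
    then show ?thesis using we[of "norm x ^ 2"] that M by (simp add: potential_def)
  qed (simp add: potential_def)
  show "continuous_on (closure \<Omega>) (\<lambda>x. potential M (norm x ^ 2))"
  proof (rule continuous_at_imp_continuous_on, rule ballI)
    fix x assume x: "x \<in> closure \<Omega>"
    show "isCont (\<lambda>x. potential M (norm x ^ 2)) x"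
    proof (cases "norm x ^ 2 < 2 * e")
      case True
      have "open {x::real^'n. norm x ^ 2 < 2 * e}" by (intro open_Collect_less continuous_intros)
      then have "\<forall>\<^sub>F y in nhds x. potential M (norm y ^ 2) = 0"
        using True pot0 by (auto simp: eventually_nhds)
      then show ?thesis by (simp add: isCont_cong)
    next
      case False
      then have s: "0 < norm x ^ 2" "norm x ^ 2 < \<sigma>" using e \<Omega>(3)[OF x] by linarith+
      have "isCont (potential M) (norm x ^ 2)"
        unfolding potential_def[abs_def] using s M isCont_data[OF s] contS[OF s]
        by (auto intro!: continuous_intros)
      then show ?thesis
        by (rule isCont_o2[where f="\<lambda>x. norm x ^ 2", rotated]) (intro continuous_intros)
    qed
  qed
qed

text \<open>
  Expanding \<open>W |\<nabla>\<psi> - \<psi> Z|\<^sup>2 \<ge> 0\<close> and integrating \<open>(\<nabla>W + 2 W Z) \<cdot> \<nabla>(\<psi>\<^sup>2)\<close> by parts leaves \<open>\<psi>\<^sup>2\<close> times the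
  quantity bounded in \<open>energy_lower_bound\<close>.
\<close>

lemma test_inequality:
  assumes \<psi>: "\<psi> \<in> test_functions \<Omega>"
  shows "(LINT x|lebesgue_on \<Omega>. potential M (norm x ^ 2) * (\<psi> x * \<psi> x))
     - (M / 3)\<^sup>2 * (LINT x|lebesgue_on \<Omega>. indicator {x. norm x ^ 2 < 2 * e} x * (\<psi> x * \<psi> x))
   \<le> 2 * (\<Sum>i\<in>UNIV. (LINT x|lebesgue_on \<Omega>. W M (norm x ^ 2) * (partial i \<psi> x * partial i \<psi> x))
        + (LINT x|lebesgue_on \<Omega>. (2 * x $ i * W1 M (norm x ^ 2)) * (partial i \<psi> x * \<psi> x)))
     - (LINT x|lebesgue_on \<Omega>. (W M (norm x ^ 2))\<^sup>2 * (\<psi> x * \<psi> x))"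
proof -
  let ?M = "lebesgue_on \<Omega>"
  define s where "s x = norm x ^ 2" for x :: "real^'n"
  obtain K where K: "compact K" "K \<subseteq> \<Omega>" and sm: "smooth \<psi>"
    and out: "\<And>x. x \<notin> K \<Longrightarrow> \<psi> x = 0" "\<And>x. x \<notin> K \<Longrightarrow> (\<psi> has_derivative (\<lambda>_. 0)) (at x)"
    using \<psi> by (rule test_functionsE) blast
  note c\<psi> = smooth_continuous[OF sm] smooth_continuous[OF smooth_partial[OF sm]]
  note cw = weights_continuous_on[folded s_def]
  have pL: "\<psi> \<in> L2 \<Omega>" "partial i \<psi> \<in> L2 \<Omega>" for i using test_function_in_L2[OF \<Omega>(1,2) \<psi>] .
  have int: "integrable ?M (\<lambda>x. c x * (f x * g x))"
    if c: "continuous_on (closure \<Omega>) c" and fg: "f \<in> L2 \<Omega>" "g \<in> L2 \<Omega>" for c f g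
  proof -
    obtain C where C: "\<And>x. x \<in> \<Omega> \<Longrightarrow> \<bar>c x\<bar> \<le> C"
      using continuous_bounded_on_bounded[OF \<Omega>(2) c] by blast
    show ?thesis
      using integrable_bounded_mult[OF L2_product_integrable[OF fg]
        continuous_measurable_lebesgue_on[OF \<Omega>(1) c], of C] C by simp
  qed
  have intI: "integrable ?M (\<lambda>x. indicator {x. s x < 2 * e} x * (\<psi> x * \<psi> x))"
  proof (rule integrable_bounded_mult[OF L2_product_integrable[OF pL(1) pL(1)], where C=1])
    have "open {x. s x < 2 * e}" unfolding s_def by (intro open_Collect_less continuous_intros)
    then show "(indicator {x. s x < 2 * e} :: real^'n \<Rightarrow> real) \<in> borel_measurable ?M"
      by (intro measurable_restrict_space1 borel_measurable_indicator) auto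
  qed (auto simp: indicator_def)
  \<comment> \<open>The \<open>i\<close>-th summand of the divergence of
    \<open>\<psi>^2 (\<nabla>W + 2 W Z)\<close>; its integral vanishes because \<open>\<psi>\<close>
    has compact support.\<close>
  define h where "h i x = 2 * (\<psi> x * partial i \<psi> x) * (x $ i * B M e (s x))
     + \<psi> x * \<psi> x * (B M e (s x) + 2 * (x $ i)\<^sup>2 * B1 M e (s x))" for i x
  have h: "integrable ?M (h i)" "(LINT x|?M. h i x) = 0" for i
  proof -
    define g where "g x = \<psi> x * \<psi> x * (x $ i * B M e (norm x ^ 2))" for x
    have d: "g differentiable (at x)" "partial i g x = h i x" if x: "x \<in> \<Omega>" for x
    proof -
      have B: "(B M e has_real_derivative B1 M e (s x)) (at (norm x ^ 2))"
        unfolding s_def by (rule B_deriv[OF M e e\<sigma> we in_domain[OF x]])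
      note r = partial_radial[OF B]
      note c = smooth_differentiable[OF smooth_component]
      note p = smooth_differentiable[OF sm]
      have dx: "partial i (\<lambda>x. x $ i) x = 1"
        by (subst partial_eqI[OF bounded_linear_imp_has_derivative[OF bounded_linear_vec_nth]]) simp
      note d1 = differentiable_mult[OF p p] and d2 = differentiable_mult[OF c r(2)]
      show "g differentiable (at x)"
        unfolding g_def[abs_def] by (rule differentiable_mult[OF d1 d2])
      show "partial i g x = h i x"
        unfolding g_def[abs_def] partial_mult[OF d1 d2] partial_mult[OF p p] partial_mult[OF c r(2)] r(1) dx h_def s_def
        by (simp add: algebra_simps power2_eq_square)
    qed
    have g0: "(g has_derivative (\<lambda>_. 0)) (at x)" if "x \<notin> K" for x
    proof -
      have "open (- K)" using K(1) by (simp add: compact_imp_closed open_Compl)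
      moreover have "((\<lambda>_. 0) has_derivative (\<lambda>_. 0)) (at x)" by simp
      ultimately show ?thesis
        by (rule_tac has_derivative_transform_within_open[of "\<lambda>_. 0" _ _ _ "- K"])
           (use that out in \<open>auto simp: g_def\<close>)
    qed
    have "continuous_on (closure \<Omega>) (h i)"
      unfolding h_def by (intro continuous_intros c\<psi> cw)
    then show "integrable ?M (h i)" "(LINT x|?M. h i x) = 0"
      using integral_partial_eq_0[OF \<Omega>(1,2) K(2) g0 _ d] out(1) by (auto simp: g_def)
  qed
  \<comment> \<open>The integrand of the right-hand side minus a divergence of integral zero; after
    this subtraction the comparison is pointwise.\<close>
  define F where "F x = 2 * (\<Sum>i\<in>UNIV. W M (s x) * (partial i \<psi> x * partial i \<psi> x)
        + (2 * x $ i * W1 M (s x)) * (partial i \<psi> x * \<psi> x)) - (W M (s x))\<^sup>2 * (\<psi> x * \<psi> x)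
        - (\<Sum>i\<in>UNIV. h i x)" for x
  have ints: "integrable ?M (\<lambda>x. W M (s x) * (partial i \<psi> x * partial i \<psi> x))"
    "integrable ?M (\<lambda>x. (2 * x $ i * W1 M (s x)) * (partial i \<psi> x * \<psi> x))"
    "integrable ?M (\<lambda>x. (W M (s x))\<^sup>2 * (\<psi> x * \<psi> x))"
    "integrable ?M (\<lambda>x. potential M (s x) * (\<psi> x * \<psi> x))" for i
    by (intro int continuous_intros cw pL)+
  have "(LINT x|?M. potential M (s x) * (\<psi> x * \<psi> x) - (M / 3)\<^sup>2 * (indicator {x. s x < 2 * e} x * (\<psi> x * \<psi> x)))
      \<le> (LINT x|?M. F x)"
  proof (rule integral_mono)
    show "integrable ?M F" unfolding F_def using ints h(1) by auto
    show "integrable ?M (\<lambda>x. potential M (s x) * (\<psi> x * \<psi> x) - (M / 3)\<^sup>2 * (indicator {x. s x < 2 * e} x * (\<psi> x * \<psi> x)))"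
      using ints intI by auto
    fix x assume "x \<in> space ?M"
    then have sx: "0 \<le> s x" "s x < \<sigma>" using in_domain by (auto simp: s_def)
    have ss: "(\<Sum>i\<in>UNIV. (x $ i)\<^sup>2) = s x"
      by (simp add: s_def norm_vec_def L2_set_def sum_nonneg)
    define \<zeta> where "\<zeta> = zc e (s x)"
    define T where "T = (\<Sum>i\<in>UNIV. x $ i * partial i \<psi> x)"
    define N where "N = (\<Sum>i\<in>UNIV. partial i \<psi> x * partial i \<psi> x)"
    have "0 \<le> (\<Sum>i\<in>UNIV. (partial i \<psi> x - \<psi> x * (\<zeta> * x $ i))\<^sup>2)" by (intro sum_nonneg) auto
    also have "\<dots> = N - 2 * \<psi> x * \<zeta> * T + \<psi> x * \<psi> x * \<zeta>\<^sup>2 * s x"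
      unfolding N_def T_def ss[symmetric] sum_distrib_left sum_subtractf[symmetric] sum.distrib[symmetric]
      by (intro sum.cong refl) (simp add: power2_eq_square algebra_simps)
    finally have sq: "0 \<le> W M (s x) * (N - 2 * \<psi> x * \<zeta> * T + \<psi> x * \<psi> x * \<zeta>\<^sup>2 * s x)"
      using W_nonneg[OF M e e\<sigma> we sx(2)] by (intro mult_nonneg_nonneg) auto
    have hs: "(\<Sum>i\<in>UNIV. h i x) = 2 * \<psi> x * T * B M e (s x) + \<psi> x * \<psi> x * (n * B M e (s x) + 2 * s x * B1 M e (s x))"
    proof -
      have "(\<Sum>i\<in>UNIV. h i x) = 2 * \<psi> x * T * B M e (s x)
         + \<psi> x * \<psi> x * (\<Sum>i\<in>UNIV. B M e (s x) + 2 * (x $ i)\<^sup>2 * B1 M e (s x))"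
        unfolding h_def T_def sum_distrib_left sum_distrib_right sum.distrib[symmetric]
        by (intro sum.cong refl) (simp add: mult_ac)
      also have "(\<Sum>i\<in>UNIV. B M e (s x) + 2 * (x $ i)\<^sup>2 * B1 M e (s x)) = n * B M e (s x) + 2 * s x * B1 M e (s x)"
        unfolding ss[symmetric] dim by (simp add: sum.distrib sum_distrib_left sum_distrib_right)
      finally show ?thesis .
    qed
    have F: "F x = 2 * W M (s x) * N + 4 * W1 M (s x) * \<psi> x * T - (W M (s x))\<^sup>2 * (\<psi> x * \<psi> x) - (\<Sum>i\<in>UNIV. h i x)"
      unfolding F_def N_def T_def by (simp add: sum.distrib sum_distrib_left mult_ac)
    have Beq: "B M e (s x) = 2 * W M (s x) * \<zeta> + 2 * W1 M (s x)" by (simp add: B_def \<zeta>_def)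
    have "F x = 2 * (W M (s x) * (N - 2 * \<psi> x * \<zeta> * T + \<psi> x * \<psi> x * \<zeta>\<^sup>2 * s x))
       + \<psi> x * \<psi> x * (- (n * B M e (s x) + 2 * s x * B1 M e (s x) + 2 * W M (s x) * (s x * \<zeta>\<^sup>2) + (W M (s x))\<^sup>2))"
      unfolding F hs unfolding Beq by (simp add: algebra_simps)
    also have "\<dots> \<ge> 0 + \<psi> x * \<psi> x * (potential M (s x) - (if s x < 2 * e then (M / 3)\<^sup>2 else 0))"
      using sq energy_lower_bound[OF M e e\<sigma> we sx] unfolding \<zeta>_def[symmetric]
      by (intro add_mono mult_left_mono) auto
    finally show "potential M (s x) * (\<psi> x * \<psi> x) - (M / 3)\<^sup>2 * (indicator {x. s x < 2 * e} x * (\<psi> x * \<psi> x)) \<le> F x"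
      by (simp add: indicator_def algebra_simps split: if_splits)
  qed
  also have "(LINT x|?M. F x) = 2 * (\<Sum>i\<in>UNIV. (LINT x|?M. W M (s x) * (partial i \<psi> x * partial i \<psi> x))
        + (LINT x|?M. (2 * x $ i * W1 M (s x)) * (partial i \<psi> x * \<psi> x)))
        - (LINT x|?M. (W M (s x))\<^sup>2 * (\<psi> x * \<psi> x))"
    unfolding F_def using ints h by (simp add: Bochner_Integration.integral_sum)
  finally show ?thesis
    using ints intI unfolding s_def by simp
qed

end
end

section \<open>Removal of the cutoff and of the truncation\<close>

context radial_profile begin

text \<open>The cutoff radius \<open>e\<close> enters neither \<open>W\<close> nor
  \<open>potential\<close>, only the inequality for test functions. So \<open>e\<close> tends to 0
  for each fixed test function, before the passage to \<open>u\<close>, while \<open>M\<close> stays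
  fixed.\<close>

lemma potential_energy_bound:
  fixes \<Omega> :: "(real^'n) set"
  assumes M: "M > 0" and \<Omega>: "open \<Omega>" "bounded \<Omega>"
    and b: "\<And>x. x \<in> closure \<Omega> \<Longrightarrow> norm x ^ 2 \<le> b" "0 \<le> b" "b < \<sigma>"
    and dim: "n = real CARD('n)"
    and u: "u \<in> sobolev_H 2 \<Omega>" "u \<in> sobolev_H10 \<Omega>"
  shows "(LINT x|lebesgue_on \<Omega>. potential M (norm x ^ 2) * (u x * u x))
    \<le> (LINT x|lebesgue_on \<Omega>. (weak_laplacian \<Omega> u x)\<^sup>2)"
    "(\<lambda>x. potential M (norm x ^ 2)) \<in> borel_measurable (lebesgue_on \<Omega>)"
    "integrable (lebesgue_on \<Omega>) (\<lambda>x. potential M (norm x ^ 2) * (u x * u x))"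
proof -
  have b\<Omega>: "norm x ^ 2 < \<sigma>" if "x \<in> closure \<Omega>" for x using b(1)[OF that] b(3) by simp
  have b\<Omega>': "norm x ^ 2 \<le> b" if "x \<in> \<Omega>" for x using b(1) that closure_subset by blast
  have nb: "norm x \<le> 1 + b" if "x \<in> \<Omega>" for x
  proof (cases "norm x \<le> 1")
    case False
    then have "norm x * 1 \<le> norm x * norm x" by (intro mult_left_mono) auto
    then show ?thesis using b\<Omega>'[OF that] by (simp add: power2_eq_square)
  qed (use b(2) in simp)
  obtain e0 where e0: "e0 > 0" "2 * e0 < \<sigma>" "\<And>s. 0 < s \<Longrightarrow> s \<le> 2 * e0 \<Longrightarrow> w s \<ge> M"
    using flat_radius[OF M zero_less_one] by metis
  note cw = weights_continuous_on[OF M e0 \<Omega> b\<Omega> dim]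
  note Wd = W_deriv[OF M e0]
  show pm: "(\<lambda>x. potential M (norm x ^ 2)) \<in> borel_measurable (lebesgue_on \<Omega>)"
    by (rule continuous_measurable_lebesgue_on[OF \<Omega>(1) cw(5)])
  obtain CW CV CG where
    CW: "\<And>x. x \<in> \<Omega> \<Longrightarrow> \<bar>W M (norm x ^ 2)\<bar> \<le> CW" and
    CV: "\<And>x. x \<in> \<Omega> \<Longrightarrow> \<bar>W1 M (norm x ^ 2)\<bar> \<le> CV" and
    CG: "\<And>x. x \<in> \<Omega> \<Longrightarrow> \<bar>potential M (norm x ^ 2)\<bar> \<le> CG"
    using continuous_bounded_on_bounded[OF \<Omega>(2) cw(1)] continuous_bounded_on_bounded[OF \<Omega>(2) cw(2)]
      continuous_bounded_on_bounded[OF \<Omega>(2) cw(5)] by blast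
  have uL: "u \<in> L2 \<Omega>" using u by (simp add: sobolev_H_def)
  show "integrable (lebesgue_on \<Omega>) (\<lambda>x. potential M (norm x ^ 2) * (u x * u x))"
    using integrable_bounded_mult[OF L2_product_integrable[OF uL uL] pm, of CG] CG by simp
  have CV': "\<bar>2 * x $ i * W1 M (norm x ^ 2)\<bar> \<le> 2 * (1 + b) * CV" if "x \<in> \<Omega>" for x i
  proof -
    have "\<bar>x $ i\<bar> \<le> 1 + b" using component_le_norm_cart[of x i] nb[OF that] by linarith
    then have "\<bar>x $ i\<bar> * \<bar>W1 M (norm x ^ 2)\<bar> \<le> (1 + b) * CV"
      using CV[OF that] b(2) by (intro mult_mono) auto
    then show ?thesis unfolding mult.assoc abs_mult by simp
  qed
  define C where "C = max CW (max (2 * (1 + b) * CV) CG)"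
  show "(LINT x|lebesgue_on \<Omega>. potential M (norm x ^ 2) * (u x * u x))
    \<le> (LINT x|lebesgue_on \<Omega>. (weak_laplacian \<Omega> u x)\<^sup>2)"
  proof (rule sobolev_energy_bound[where W="\<lambda>x. W M (norm x ^ 2)" and V="\<lambda>i x. 2 * x $ i * W1 M (norm x ^ 2)" and C=C])
    show "(\<lambda>x. W M (norm x ^ 2)) \<in> borel_measurable (lebesgue_on \<Omega>)"
      by (rule continuous_measurable_lebesgue_on[OF \<Omega>(1) cw(1)])
    show "(\<lambda>x. 2 * x $ i * W1 M (norm x ^ 2)) \<in> borel_measurable (lebesgue_on \<Omega>)" for i
      by (intro continuous_measurable_lebesgue_on[OF \<Omega>(1)] continuous_intros cw)
    show "\<bar>W M (norm x ^ 2)\<bar> \<le> C" "\<bar>potential M (norm x ^ 2)\<bar> \<le> C" if "x \<in> \<Omega>" for x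
      using CW[OF that] CG[OF that] by (auto simp: C_def)
    show "\<bar>2 * x $ i * W1 M (norm x ^ 2)\<bar> \<le> C" if "x \<in> \<Omega>" for i x
      using CV'[OF that, of i] by (simp add: C_def)
  next
    fix \<epsilon> :: real assume \<epsilon>: "\<epsilon> > 0"
    \<comment> \<open>The gradient of \<open>p (|x|^2)\<close> carries the factor
      \<open>2 * x $ i\<close>, at most \<open>2 * (1 + b)\<close>; the denominator makes both
      \<open>d\<close> and \<open>2 * (1 + b) * d\<close> at most \<epsilon>.\<close>
    define d where "d = \<epsilon> / (3 + 2 * b)"
    have d: "d > 0" "d \<le> \<epsilon>" "2 * (1 + b) * d \<le> \<epsilon>"
      using \<epsilon> b(2) by (auto simp: d_def field_simps)
    obtain p p1 where p: "real_polynomial_function p" "\<And>s. (p has_real_derivative p1 s) (at s)"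
      "\<And>s. 0 \<le> s \<Longrightarrow> s \<le> b \<Longrightarrow> \<bar>W M s - p s\<bar> \<le> d" "\<And>s. 0 \<le> s \<Longrightarrow> s \<le> b \<Longrightarrow> \<bar>W1 M s - p1 s\<bar> \<le> d"
    proof (rule polynomial_approx_C1[of b "W M" "W1 M" d])
      show "(W M has_real_derivative W1 M s) (at s)" "isCont (W1 M) s" if "0 \<le> s" "s \<le> b" for s
        using Wd(1,3)[of s] that b(3) by auto
    qed (use d b in auto)
    show "\<exists>p. smooth p \<and> (\<forall>x\<in>\<Omega>. \<bar>W M (norm x ^ 2) - p x\<bar> \<le> \<epsilon> \<and>
        (\<forall>i. \<bar>2 * x $ i * W1 M (norm x ^ 2) - partial i p x\<bar> \<le> \<epsilon>))"
    proof (intro exI[of _ "\<lambda>x. p (norm x ^ 2)"] conjI ballI allI)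
      show "smooth (\<lambda>x::real^'n. p (norm x ^ 2))" by (rule smooth_polynomial_norm[OF p(1)])
      fix x assume x: "x \<in> \<Omega>"
      show "\<bar>W M (norm x ^ 2) - p (norm x ^ 2)\<bar> \<le> \<epsilon>"
        using p(3)[of "norm x ^ 2"] b\<Omega>'[OF x] d(2) by simp
      fix i
      have "\<bar>x $ i\<bar> \<le> 1 + b" using component_le_norm_cart[of x i] nb[OF x] by linarith
      then have "\<bar>x $ i\<bar> * \<bar>W1 M (norm x ^ 2) - p1 (norm x ^ 2)\<bar> \<le> (1 + b) * d"
        using p(4)[of "norm x ^ 2"] b\<Omega>'[OF x] b(2) by (intro mult_mono) auto
      then have "2 * \<bar>x $ i\<bar> * \<bar>W1 M (norm x ^ 2) - p1 (norm x ^ 2)\<bar> \<le> \<epsilon>"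
        using d(3) unfolding mult.assoc by linarith
      also have "2 * \<bar>x $ i\<bar> * \<bar>W1 M (norm x ^ 2) - p1 (norm x ^ 2)\<bar>
          = \<bar>2 * x $ i * W1 M (norm x ^ 2) - partial i (\<lambda>x. p (norm x ^ 2)) x\<bar>"
        unfolding partial_radial(1)[OF p(2)] right_diff_distrib[symmetric] by (simp add: abs_mult)
      finally show "\<bar>2 * x $ i * W1 M (norm x ^ 2) - partial i (\<lambda>x. p (norm x ^ 2)) x\<bar> \<le> \<epsilon>" .
    qed
  next
    fix \<psi> assume \<psi>: "\<psi> \<in> test_functions \<Omega>"
    have \<psi>L: "\<psi> \<in> L2 \<Omega>" using test_function_in_L2(1)[OF \<Omega> \<psi>] .
    note \<psi>i = L2_product_integrable[OF \<psi>L \<psi>L]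
    define J where "J = 2 * (\<Sum>i\<in>UNIV. (LINT x|lebesgue_on \<Omega>. W M (norm x ^ 2) * (partial i \<psi> x * partial i \<psi> x))
        + (LINT x|lebesgue_on \<Omega>. (2 * x $ i * W1 M (norm x ^ 2)) * (partial i \<psi> x * \<psi> x)))
       - (LINT x|lebesgue_on \<Omega>. (W M (norm x ^ 2))\<^sup>2 * (\<psi> x * \<psi> x))"
    have "\<forall>k. \<exists>e>0. e < inverse (real (Suc k)) \<and> 2 * e < \<sigma> \<and> (\<forall>s. 0 < s \<longrightarrow> s \<le> 2 * e \<longrightarrow> w s \<ge> M)"
    proof
      fix k
      show "\<exists>e>0. e < inverse (real (Suc k)) \<and> 2 * e < \<sigma> \<and> (\<forall>s. 0 < s \<longrightarrow> s \<le> 2 * e \<longrightarrow> w s \<ge> M)"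
        by (rule flat_radius[OF M, of "inverse (real (Suc k))"]) auto
    qed
    from choice[OF this] obtain e where e: "\<And>k. e k > 0" "\<And>k. e k < inverse (real (Suc k))" "\<And>k. 2 * e k < \<sigma>"
      "\<And>k s. 0 < s \<Longrightarrow> s \<le> 2 * e k \<Longrightarrow> w s \<ge> M" by blast
    define I where "I k = (LINT x|lebesgue_on \<Omega>. indicator {x. norm x ^ 2 < 2 * e k} x * (\<psi> x * \<psi> x))" for k
    \<comment> \<open>The balls shrink to the origin, a null set, so the cutoff defect disappears in
      the limit.\<close>
    have "I \<longlonglongrightarrow> (LINT x|lebesgue_on \<Omega>. 0)"
      unfolding I_def
    proof (rule integral_dominated_convergence[where w="\<lambda>x. \<psi> x * \<psi> x"])
      have "open {x::real^'n. norm x ^ 2 < 2 * e k}" for k by (intro open_Collect_less continuous_intros)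
      then have "(indicator {x. norm x ^ 2 < 2 * e k} :: real^'n \<Rightarrow> real) \<in> borel_measurable (lebesgue_on \<Omega>)" for k
        by (intro measurable_restrict_space1 borel_measurable_indicator) auto
      then show "(\<lambda>x. indicator {x. norm x ^ 2 < 2 * e k} x * (\<psi> x * \<psi> x)) \<in> borel_measurable (lebesgue_on \<Omega>)" for k
        using \<psi>i by auto
      show "AE x in lebesgue_on \<Omega>. norm (indicator {x. norm x ^ 2 < 2 * e k} x * (\<psi> x * \<psi> x)) \<le> \<psi> x * \<psi> x" for k
        by (auto simp: indicator_def)
      have "AE x in lebesgue_on \<Omega>. x \<noteq> 0"
        using AE_lborel_singleton[of "0::real^'n"] \<Omega>(1)
        by (subst AE_restrict_space_iff) (auto intro: AE_completion)
      then show "AE x in lebesgue_on \<Omega>. (\<lambda>k. indicator {x. norm x ^ 2 < 2 * e k} x * (\<psi> x * \<psi> x)) \<longlonglongrightarrow> 0"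
      proof eventually_elim
        fix x :: "real^'n" assume "x \<noteq> 0"
        then have "\<forall>\<^sub>F k in sequentially. inverse (real (Suc k)) < norm x ^ 2 / 2"
          by (intro order_tendstoD(2)[OF LIMSEQ_inverse_real_of_nat]) auto
        then have "\<forall>\<^sub>F k in sequentially. indicator {x. norm x ^ 2 < 2 * e k} x * (\<psi> x * \<psi> x) = 0"
        proof eventually_elim
          fix k assume "inverse (real (Suc k)) < norm x ^ 2 / 2"
          then have "\<not> norm x ^ 2 < 2 * e k" using e(2)[of k] by linarith
          then show "indicator {x. norm x ^ 2 < 2 * e k} x * (\<psi> x * \<psi> x) = 0" by simp
        qed
        then show "(\<lambda>k. indicator {x. norm x ^ 2 < 2 * e k} x * (\<psi> x * \<psi> x)) \<longlonglongrightarrow> 0"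
          by (rule tendsto_eventually)
      qed
    qed (use \<psi>i in auto)
    then have "(\<lambda>k. (LINT x|lebesgue_on \<Omega>. potential M (norm x ^ 2) * (\<psi> x * \<psi> x)) - (M / 3)\<^sup>2 * I k)
        \<longlonglongrightarrow> (LINT x|lebesgue_on \<Omega>. potential M (norm x ^ 2) * (\<psi> x * \<psi> x)) - (M / 3)\<^sup>2 * 0"
      by (intro tendsto_intros) simp
    moreover have "(LINT x|lebesgue_on \<Omega>. potential M (norm x ^ 2) * (\<psi> x * \<psi> x)) - (M / 3)\<^sup>2 * I k \<le> J" for k
      unfolding I_def J_def by (rule test_inequality[OF M e(1,3,4) \<Omega> b\<Omega> dim \<psi>])
    ultimately have "(LINT x|lebesgue_on \<Omega>. potential M (norm x ^ 2) * (\<psi> x * \<psi> x)) - (M / 3)\<^sup>2 * 0 \<le> J"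
      by (intro LIMSEQ_le_const2) auto
    then show "(LINT x|lebesgue_on \<Omega>. potential M (norm x ^ 2) * (\<psi> x * \<psi> x))
       \<le> 2 * (\<Sum>i\<in>UNIV. (LINT x|lebesgue_on \<Omega>. W M (norm x ^ 2) * (partial i \<psi> x * partial i \<psi> x))
        + (LINT x|lebesgue_on \<Omega>. (2 * x $ i * W1 M (norm x ^ 2)) * (partial i \<psi> x * \<psi> x)))
       - (LINT x|lebesgue_on \<Omega>. (W M (norm x ^ 2))\<^sup>2 * (\<psi> x * \<psi> x))"
      by (simp add: J_def)
  qed (use \<Omega> u pm in auto)
qed

text \<open>\<open>M = k + 1\<close> tends to infinity. As the potentials are nonnegative, Fatou's
  lemma gives the limit with no prior knowledge that the singular integral is finite.\<close>

lemma radial_hardy_rellich: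
  fixes \<Omega> :: "(real^'n) set"
  assumes \<Omega>: "open \<Omega>" "bounded \<Omega>"
    and b: "\<And>x. x \<in> closure \<Omega> \<Longrightarrow> norm x ^ 2 \<le> b" "0 \<le> b" "b < \<sigma>"
    and dim: "n = real CARD('n)"
    and u: "u \<in> sobolev_H 2 \<Omega>" "u \<in> sobolev_H10 \<Omega>"
  shows "(\<integral>\<^sup>+x. ennreal ((u x)\<^sup>2 / norm x ^ 4 * (A\<^sup>2 + m / 4 * S (norm x ^ 2))) \<partial>lebesgue_on \<Omega>)
    \<le> (\<integral>\<^sup>+x. ennreal ((weak_laplacian \<Omega> u x)\<^sup>2) \<partial>lebesgue_on \<Omega>)"
proof -
  let ?M = "lebesgue_on \<Omega>"
  define E where "E = (\<integral>\<^sup>+x. ennreal ((weak_laplacian \<Omega> u x)\<^sup>2) \<partial>?M)"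
  define f where "f k x = potential (real (Suc k)) (norm x ^ 2) * (u x * u x)" for k x
  have uL: "u \<in> L2 \<Omega>" using u by (simp add: sobolev_H_def)
  note pe = potential_energy_bound[OF _ \<Omega> b dim u]
  have um: "u \<in> borel_measurable ?M" using L2_D(1)[OF uL] .
  have fm: "(\<lambda>x. ennreal (f k x)) \<in> borel_measurable ?M" for k
    unfolding f_def using pe(2)[of "real (Suc k)"] um by measurable
  have s\<sigma>: "norm x ^ 2 < \<sigma>" if "x \<in> \<Omega>" for x
    using b(1)[of x] b(3) that closure_subset[of \<Omega>] by fastforce
  have f0: "f k x \<ge> 0" if "x \<in> \<Omega>" for k x
  proof (cases "x = 0")
    case False
    then have "S (norm x ^ 2) \<ge> 0" using s\<sigma>[OF that] by (intro S) auto
    then show ?thesis using m_ge_4 unfolding f_def potential_def by simp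
  qed (simp add: f_def potential_def)
  have le: "(\<integral>\<^sup>+x. ennreal (f k x) \<partial>?M) \<le> E" for k
  proof -
    have "(\<integral>\<^sup>+x. ennreal (f k x) \<partial>?M) = ennreal (LINT x|?M. f k x)"
      using pe(3)[of "real (Suc k)"] f0 by (intro nn_integral_eq_integral) (auto simp: f_def)
    also have "\<dots> \<le> ennreal (LINT x|?M. (weak_laplacian \<Omega> u x)\<^sup>2)"
      using pe(1)[of "real (Suc k)"] by (intro ennreal_leI) (simp add: f_def)
    also have "\<dots> = E"
      unfolding E_def using L2_D(2)[OF weak_laplacian_in_L2[OF u(1)]]
      by (intro nn_integral_eq_integral[symmetric]) auto
    finally show ?thesis .
  qed
  have lim: "(\<lambda>k. ennreal (f k x)) \<longlonglongrightarrow> ennreal ((u x)\<^sup>2 / norm x ^ 4 * (A\<^sup>2 + m / 4 * S (norm x ^ 2)))" for x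
  proof -
    define s where "s = norm x ^ 2"
    have "(\<lambda>k. max 0 (1 - w s * inverse (real (Suc k))) ^ 2 * ((A\<^sup>2 + m / 4 * S s) / s\<^sup>2) * (u x * u x))
        \<longlonglongrightarrow> max 0 (1 - w s * 0) ^ 2 * ((A\<^sup>2 + m / 4 * S s) / s\<^sup>2) * (u x * u x)"
      by (intro tendsto_intros LIMSEQ_inverse_real_of_nat)
    moreover have "max 0 (1 - w s * 0) ^ 2 * ((A\<^sup>2 + m / 4 * S s) / s\<^sup>2) * (u x * u x)
        = (u x)\<^sup>2 / norm x ^ 4 * (A\<^sup>2 + m / 4 * S s)"
      by (simp add: s_def power2_eq_square power4_eq_xxxx mult_ac)
    moreover have "f k x = max 0 (1 - w s * inverse (real (Suc k))) ^ 2 * ((A\<^sup>2 + m / 4 * S s) / s\<^sup>2) * (u x * u x)" for k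
      unfolding f_def potential_def s_def[symmetric] divide_inverse[of "w s"] ..
    ultimately have "(\<lambda>k. f k x) \<longlonglongrightarrow> (u x)\<^sup>2 / norm x ^ 4 * (A\<^sup>2 + m / 4 * S s)" by simp
    then show ?thesis unfolding s_def by (rule tendsto_ennrealI)
  qed
  have "(\<integral>\<^sup>+x. ennreal ((u x)\<^sup>2 / norm x ^ 4 * (A\<^sup>2 + m / 4 * S (norm x ^ 2))) \<partial>?M)
      = (\<integral>\<^sup>+x. liminf (\<lambda>k. ennreal (f k x)) \<partial>?M)"
    by (intro nn_integral_cong lim_imp_Liminf[symmetric] lim) simp
  also have "\<dots> \<le> liminf (\<lambda>k. \<integral>\<^sup>+x. ennreal (f k x) \<partial>?M)"
    by (rule nn_integral_liminf[OF fm])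
  also have "\<dots> \<le> E"
    using le by (intro Liminf_le) auto
  finally show ?thesis unfolding E_def .
qed

end

section \<open>Logarithmic potentials\<close>

lemma log_pot_measurable [measurable]: "log_pot c i \<in> borel_measurable borel"
proof -
  have "log_chain c i \<in> borel_measurable borel" for i
    by (induction i) (simp_all, measurable)
  then show ?thesis unfolding log_pot_def[abs_def] by measurable
qed

text \<open>The substitution \<open>t = \<tau> s = ln (\<rho> / |x|)\<close> with
  \<open>s = |x|^2\<close> turns the solution of the equation in \<open>t\<close> into a
  \<open>radial_profile\<close>; \<open>\<mu> = sqrt m\<close> matches
  \<open>f'' = m (f - F)\<close>.\<close>

lemma hardy_rellich_log_chain:
  fixes \<Omega> :: "(real^'n) set" and R \<rho> c n :: real
  assumes n: "CARD('n) \<ge> 4" "n = real CARD('n)"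
    and \<Omega>: "open \<Omega>" "bounded \<Omega>" and R: "R > 0" "\<And>x. x \<in> closure \<Omega> \<Longrightarrow> norm x \<le> R"
    and \<rho>: "\<rho> > 0" and pos: "\<And>t i. t \<ge> ln (\<rho> / R) \<Longrightarrow> i \<le> k \<Longrightarrow> log_chain c i t > 0"
    and u: "u \<in> sobolev_H 2 \<Omega>" "u \<in> sobolev_H10 \<Omega>"
  shows "ennreal (n\<^sup>2 * (n - 4)\<^sup>2 / 16) * (\<integral>\<^sup>+x. ennreal ((u x)\<^sup>2 / norm x ^ 4) \<partial>lebesgue_on \<Omega>)
     + ennreal (1 + n * (n - 4) / 8) *
       (\<Sum>i\<le>k. \<integral>\<^sup>+x. ennreal ((u x)\<^sup>2 / norm x ^ 4 * (log_pot c i (ln (\<rho> / norm x)))\<^sup>2) \<partial>lebesgue_on \<Omega>)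
   \<le> (\<integral>\<^sup>+x. ennreal ((weak_laplacian \<Omega> u x)\<^sup>2) \<partial>lebesgue_on \<Omega>)"
proof -
  let ?M = "lebesgue_on \<Omega>"
  have n4: "n \<ge> 4" using n by simp
  define A where "A = n * (n - 4) / 4"
  define m where "m = 2 * A + 4"
  have A0: "A \<ge> 0" using n4 by (simp add: A_def)
  have m4: "m \<ge> 4" using A0 by (simp add: m_def)
  obtain a where a: "a < ln (\<rho> / R)" "\<And>t i. t > a \<Longrightarrow> i \<le> k \<Longrightarrow> log_chain c i t > 0"
  proof (rule log_chain_pos_left[of "ln (\<rho> / R)" k c])
    show "log_chain c i t > 0" if "t \<ge> ln (\<rho> / R)" "i \<le> k" for t i using pos that .
  qed blast
  define b where "b = (a + ln (\<rho> / R)) / 2"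
  have b: "a < b" "b < ln (\<rho> / R)" using a(1) by (auto simp: b_def)
  define p where "p t = log_pot_sum c k t / 2" for t
  define T where "T t = (\<Sum>i\<le>k. (log_pot c i t)\<^sup>2)" for t
  have chain: "sqrt (\<Prod>i\<le>k. log_chain c i t) > 0"
    "((\<lambda>t. sqrt (\<Prod>i\<le>k. log_chain c i t)) has_real_derivative sqrt (\<Prod>i\<le>k. log_chain c i t) * p t) (at t)"
    "(p has_real_derivative - T t / 4 - (p t)\<^sup>2) (at t)" "p t \<ge> exp (-t) / 2" if "t > a" for t
    using sqrt_log_chain_prod[OF a(2)[OF that]] unfolding p_def[abs_def] T_def by auto
  have T0: "T t \<ge> 0" for t unfolding T_def by (intro sum_nonneg) auto
  obtain y q and d :: real where d: "d > 0"
    and y': "\<And>t. t > b \<Longrightarrow> (y has_real_derivative (sqrt m)\<^sup>2 * (1 - q t) - (y t)\<^sup>2) (at t)"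
    and q': "\<And>t. t > b \<Longrightarrow> (q has_real_derivative q t * (p t - y t)) (at t)"
    and y: "\<And>t. t > b \<Longrightarrow> y t \<ge> d * exp (-t)" and q: "\<And>t. t > b \<Longrightarrow> q t \<ge> 1"
    by (rule bounded_solution_quotients[of "sqrt m" a b "\<lambda>t. sqrt (\<Prod>i\<le>k. log_chain c i t)" p T])
       (use m4 b chain T0 in auto)
  define \<tau> where "\<tau> s = ln \<rho> - ln s / 2" for s
  \<comment> \<open>The value of \<open>s\<close> with \<open>\<tau> s = b\<close>; it exceeds
    \<open>R^2\<close> since \<open>b < ln (\<rho> / R)\<close>.\<close>
  define \<sigma> where "\<sigma> = (\<rho> * exp (-b))\<^sup>2"
  have \<tau>b: "\<tau> s > b" if "0 < s" "s < \<sigma>" for s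
  proof -
    have "ln s < ln \<sigma>" using that by simp
    also have "ln \<sigma> = 2 * (ln \<rho> - b)" using \<rho> by (simp add: \<sigma>_def ln_realpow ln_mult)
    finally show ?thesis by (simp add: \<tau>_def)
  qed
  have \<tau>': "(\<tau> has_real_derivative - 1 / (2 * s)) (at s)" if "0 < s" for s
    unfolding \<tau>_def[abs_def] using that by (auto intro!: derivative_eq_intros simp: field_simps)
  have e\<tau>: "exp (- \<tau> s) = sqrt s / \<rho>" if "0 < s" for s
  proof -
    have "- \<tau> s = ln (sqrt s / \<rho>)" using that \<rho> by (simp add: \<tau>_def ln_div ln_sqrt)
    then show ?thesis using that \<rho> by simp
  qed
  have yd: "0 \<le> d * exp (- t)" for t using d by simp
  interpret rp: radial_profile n A m "2 - n / 2" \<sigma> "\<lambda>s. y (\<tau> s)" "\<lambda>s. q (\<tau> s)" "\<lambda>s. p (\<tau> s)" "\<lambda>s. T (\<tau> s)"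
  proof
    show "n \<ge> 4" "A = n * (n - 4) / 4" "m = 2 * A + 4" "2 - n / 2 = 2 - n / 2" using n4 by (simp_all add: A_def m_def)
    show "\<sigma> > 0" using \<rho> by (simp add: \<sigma>_def)
  next
    fix s assume s: "0 < s" "s < \<sigma>"
    note b' = \<tau>b[OF s]
    then have a': "\<tau> s > a" using b by simp
    show "((\<lambda>s. y (\<tau> s)) has_real_derivative - (m * (1 - q (\<tau> s)) - (y (\<tau> s))\<^sup>2) / (2 * s)) (at s)"
      by (rule DERIV_cong[OF DERIV_chain2[OF y'[OF b'] \<tau>'[OF s(1)]]]) (use m4 s in \<open>simp add: field_simps\<close>)
    show "((\<lambda>s. q (\<tau> s)) has_real_derivative - (q (\<tau> s) * (p (\<tau> s) - y (\<tau> s))) / (2 * s)) (at s)"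
      by (rule DERIV_cong[OF DERIV_chain2[OF q'[OF b'] \<tau>'[OF s(1)]]]) simp
    show "((\<lambda>s. p (\<tau> s)) has_real_derivative (T (\<tau> s) / 4 + (p (\<tau> s))\<^sup>2) / (2 * s)) (at s)"
      by (rule DERIV_cong[OF DERIV_chain2[OF chain(3)[OF a'] \<tau>'[OF s(1)]]]) (use s in \<open>simp add: field_simps\<close>)
    show "0 \<le> y (\<tau> s)" using y[OF b'] yd[of "\<tau> s"] by linarith
    show "1 \<le> q (\<tau> s)" by (rule q[OF b'])
    show "0 \<le> T (\<tau> s)" by (rule T0)
    have "isCont (log_pot c i) (\<tau> s)" if "i \<le> k" for i
      using that by (intro DERIV_isCont[OF log_pot_deriv] a(2)[OF a']) auto
    then have "isCont T (\<tau> s)"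
      unfolding T_def by (intro continuous_intros) auto
    then show "isCont (\<lambda>s. T (\<tau> s)) s"
      by (rule isCont_o2[OF DERIV_isCont[OF \<tau>'[OF s(1)]]])
  next
    fix M :: real
    \<comment> \<open>As \<open>exp (- \<tau> s) = sqrt s / \<rho>\<close>, the lower bound for
      \<open>y\<close> gives \<open>2 * y \<ge> 2 * d * sqrt s / \<rho>\<close>, and this is at
      least \<open>(|M| + 1) * s\<close> as soon as \<open>sqrt s \<le> r\<close>. The argument
      covers \<open>A = 0\<close>.\<close>
    define r where "r = 2 * d / (\<rho> * (\<bar>M\<bar> + 1))"
    have r: "r > 0" using d \<rho> by (simp add: r_def)
    define \<delta> where "\<delta> = min (r\<^sup>2) (\<sigma> / 2)"
    show "\<exists>\<delta>>0. \<delta> < \<sigma> \<and> (\<forall>s. 0 < s \<longrightarrow> s \<le> \<delta> \<longrightarrow> M * s \<le> A + 2 * y (\<tau> s) + m * (q (\<tau> s) - 1))"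
    proof (intro exI[of _ \<delta>] conjI allI impI)
      have \<sigma>: "\<sigma> > 0" using \<rho> by (simp add: \<sigma>_def)
      then show "\<delta> > 0" "\<delta> < \<sigma>" using r by (auto simp: \<delta>_def)
      fix s assume s: "0 < s" "s \<le> \<delta>"
      then have s\<sigma>: "s < \<sigma>" using \<open>\<delta> < \<sigma>\<close> by simp
      have "sqrt s \<le> r" using s r by (simp add: \<delta>_def real_le_lsqrt)
      then have "(\<bar>M\<bar> + 1) * (sqrt s * sqrt s) \<le> (\<bar>M\<bar> + 1) * (r * sqrt s)"
        using s by (intro mult_left_mono mult_right_mono) auto
      also have "\<dots> = 2 * d * (sqrt s / \<rho>)"
      proof -
        define N where "N = \<bar>M\<bar> + 1"
        have "N > 0" by (simp add: N_def)
        then show ?thesis using \<rho> by (simp add: r_def N_def[symmetric])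
      qed
      also have "\<dots> \<le> 2 * y (\<tau> s)" using y[OF \<tau>b[OF s(1) s\<sigma>]] by (simp add: e\<tau>[OF s(1)])
      finally have "(\<bar>M\<bar> + 1) * s \<le> 2 * y (\<tau> s)" using s by simp
      moreover have "M * s \<le> (\<bar>M\<bar> + 1) * s" using s by (intro mult_right_mono) auto
      moreover have "m * (q (\<tau> s) - 1) \<ge> 0" using q[OF \<tau>b[OF s(1) s\<sigma>]] m4 by simp
      ultimately show "M * s \<le> A + 2 * y (\<tau> s) + m * (q (\<tau> s) - 1)" using A0 by linarith
    qed
  qed
  have "R < \<rho> * exp (- b)"
  proof -
    have "exp b < \<rho> / R" using b(2) R \<rho> by (metis divide_pos_pos exp_less_cancel_iff exp_ln)
    then show ?thesis using R by (simp add: exp_minus field_simps)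
  qed
  then have R\<sigma>: "R\<^sup>2 < \<sigma>" using R by (simp add: \<sigma>_def power_strict_mono)
  have Rb: "norm x ^ 2 \<le> R\<^sup>2" if "x \<in> closure \<Omega>" for x
    using R(2)[OF that] by (intro power_mono) auto
  have main: "(\<integral>\<^sup>+x. ennreal ((u x)\<^sup>2 / norm x ^ 4 * (A\<^sup>2 + m / 4 * T (\<tau> (norm x ^ 2)))) \<partial>?M)
      \<le> (\<integral>\<^sup>+x. ennreal ((weak_laplacian \<Omega> u x)\<^sup>2) \<partial>?M)"
    by (rule rp.radial_hardy_rellich[OF \<Omega> Rb _ R\<sigma> n(2) u]) auto
  have um: "u \<in> borel_measurable ?M" using u L2_D(1) by (auto simp: sobolev_H_def)
  have nm: "(\<lambda>x::real^'n. norm x) \<in> borel_measurable ?M"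
    by (intro measurable_restrict_space1 measurable_completion) simp
  have fm: "(\<lambda>x. (u x)\<^sup>2 / norm x ^ 4) \<in> borel_measurable ?M" using um nm by measurable
  have gm: "(\<lambda>x. (log_pot c i (ln (\<rho> / norm x)))\<^sup>2) \<in> borel_measurable ?M" for i
    using nm by measurable
  have pt: "ennreal ((u x)\<^sup>2 / norm x ^ 4 * (A\<^sup>2 + m / 4 * T (\<tau> (norm x ^ 2)))) =
      ennreal (A\<^sup>2) * ennreal ((u x)\<^sup>2 / norm x ^ 4) + ennreal (m / 4) *
        (\<Sum>i\<le>k. ennreal ((u x)\<^sup>2 / norm x ^ 4 * (log_pot c i (ln (\<rho> / norm x)))\<^sup>2))" for x
  proof (cases "x = 0")
    case False
    have "\<tau> (norm x ^ 2) = ln (\<rho> / norm x)"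
      using False \<rho> by (simp add: \<tau>_def ln_realpow ln_div)
    then have eq: "(u x)\<^sup>2 / norm x ^ 4 * (A\<^sup>2 + m / 4 * T (\<tau> (norm x ^ 2)))
       = A\<^sup>2 * ((u x)\<^sup>2 / norm x ^ 4) + m / 4 * (\<Sum>i\<le>k. (u x)\<^sup>2 / norm x ^ 4 * (log_pot c i (ln (\<rho> / norm x)))\<^sup>2)"
      by (simp add: T_def sum_distrib_left distrib_left mult_ac)
    have lin: "ennreal (p * \<alpha> + r * (\<Sum>i\<le>k. \<beta> i))
        = ennreal p * ennreal \<alpha> + ennreal r * (\<Sum>i\<le>k. ennreal (\<beta> i))"
      if "p \<ge> 0" "r \<ge> 0" "\<alpha> \<ge> 0" "\<And>i. \<beta> i \<ge> 0" for p r \<alpha> :: real and \<beta>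
      using that by (simp add: ennreal_mult sum_nonneg sum_ennreal)
    show ?thesis unfolding eq by (rule lin) (use m4 in auto)
  qed simp
  have total: "(\<integral>\<^sup>+x. ennreal ((u x)\<^sup>2 / norm x ^ 4 * (A\<^sup>2 + m / 4 * T (\<tau> (norm x ^ 2)))) \<partial>?M)
     = ennreal (A\<^sup>2) * (\<integral>\<^sup>+x. ennreal ((u x)\<^sup>2 / norm x ^ 4) \<partial>?M) + ennreal (m / 4) *
       (\<Sum>i\<le>k. \<integral>\<^sup>+x. ennreal ((u x)\<^sup>2 / norm x ^ 4 * (log_pot c i (ln (\<rho> / norm x)))\<^sup>2) \<partial>?M)"
  proof -
    have "(\<integral>\<^sup>+x. \<alpha> * F x + \<beta> * (\<Sum>i\<le>k. G i x) \<partial>?M)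
        = \<alpha> * (\<integral>\<^sup>+x. F x \<partial>?M) + \<beta> * (\<Sum>i\<le>k. \<integral>\<^sup>+x. G i x \<partial>?M)"
      if [measurable]: "F \<in> borel_measurable ?M" "\<And>i. G i \<in> borel_measurable ?M" for F G \<alpha> \<beta>
      by (simp add: nn_integral_add nn_integral_cmult nn_integral_sum)
    note split = this
    show ?thesis unfolding pt by (rule split) (use fm gm in measurable)
  qed
  have coeffs: "A\<^sup>2 = n\<^sup>2 * (n - 4)\<^sup>2 / 16" "m / 4 = 1 + n * (n - 4) / 8"
    by (simp_all add: A_def m_def power_mult_distrib power_divide)
  show ?thesis using main unfolding total unfolding coeffs .
qed

text \<open>The integrals are taken in \<open>[0, \<infinity>]\<close>, so that the singular
  integrals and the infinite series always have a value.\<close>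

theorem corollary3p7:
  fixes \<Omega> :: "(real^'n) set" and R n :: real
  assumes "CARD('n) \<ge> 4" and "n = real CARD('n)"
    and "smooth_bounded_domain \<Omega>" and "0 \<in> \<Omega>"
    and "R = (SUP x\<in>\<Omega>. norm x)"
  shows "\<forall>u \<in> sobolev_H 2 \<Omega> \<inter> sobolev_H10 \<Omega>.
    (\<forall>k \<rho>. k \<ge> 1 \<and> \<rho> = R * exp_tower k \<longrightarrow>
      (\<integral>\<^sup>+x. ennreal ((weak_laplacian \<Omega> u x)\<^sup>2) \<partial>lebesgue_on \<Omega>)
      \<ge> ennreal (n\<^sup>2 * (n - 4)\<^sup>2 / 16) *
          (\<integral>\<^sup>+x. ennreal ((u x)\<^sup>2 / norm x ^ 4) \<partial>lebesgue_on \<Omega>)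
        + ennreal (1 + n * (n - 4) / 8) *
          (\<Sum>j=1..k. \<integral>\<^sup>+x. ennreal ((u x)\<^sup>2 / norm x ^ 4
              * inverse ((\<Prod>i=1..j. iter_log i (\<rho> / norm x))\<^sup>2)) \<partial>lebesgue_on \<Omega>)) \<and>
    (\<forall>D. D \<ge> R \<longrightarrow>
      (\<integral>\<^sup>+x. ennreal ((weak_laplacian \<Omega> u x)\<^sup>2) \<partial>lebesgue_on \<Omega>)
      \<ge> ennreal (n\<^sup>2 * (n - 4)\<^sup>2 / 16) *
          (\<integral>\<^sup>+x. ennreal ((u x)\<^sup>2 / norm x ^ 4) \<partial>lebesgue_on \<Omega>)
        + ennreal (1 + n * (n - 4) / 8) *
          (\<Sum>i. \<integral>\<^sup>+x. ennreal ((u x)\<^sup>2 / norm x ^ 4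
              * (\<Prod>j=1..Suc i. (X j (norm x / D))\<^sup>2)) \<partial>lebesgue_on \<Omega>))"
proof (intro ballI conjI allI impI)
  fix u assume "u \<in> sobolev_H 2 \<Omega> \<inter> sobolev_H10 \<Omega>"
  then have u: "u \<in> sobolev_H 2 \<Omega>" "u \<in> sobolev_H10 \<Omega>" by auto
  have \<Omega>: "open \<Omega>" "bounded \<Omega>" using assms(3) by (auto simp: smooth_bounded_domain_def)
  have bdd: "bdd_above (norm ` \<Omega>)"
    using \<Omega>(2) by (simp add: bounded_norm_comp bounded_imp_bdd_above bounded_iff bdd_above_def)
  have Rle: "norm x \<le> R" if "x \<in> \<Omega>" for x
    unfolding assms(5) using bdd that by (intro cSUP_upper)
  obtain r where r: "r > 0" "cball 0 r \<subseteq> \<Omega>" using \<Omega>(1) assms(4) open_contains_cball by blast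
  have "(r *\<^sub>R axis undefined 1 :: real^'n) \<in> cball 0 r" using r by simp
  then have "norm (r *\<^sub>R axis undefined 1 :: real^'n) \<le> R" using r(2) Rle by blast
  then have R: "R > 0" using r(1) by simp
  have Rcl: "norm x \<le> R" if "x \<in> closure \<Omega>" for x
  proof -
    have "closure \<Omega> \<subseteq> cball 0 R" by (rule closure_minimal) (use Rle in auto)
    then show ?thesis using that by auto
  qed
  note core = hardy_rellich_log_chain[OF assms(1,2) \<Omega> R Rcl _ _ u]
  {
    fix k \<rho> assume k: "1 \<le> k \<and> \<rho> = R * exp_tower k"
    then obtain k' where k': "k = Suc k'" by (cases k) auto
    have e: "exp_tower k > 0" using exp_tower_ge_1[of k] by linarith
    \<comment> \<open>The \<open>k\<close> logarithms are the chain members with index 0 to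
      \<open>k - 1\<close>, so positivity is needed only for
      \<open>t \<ge> exp_tower (k - 1)\<close>, which is \<open>ln E_k\<close>.\<close>
    have "ln (\<rho> / R) = exp_tower k'" using k R by (simp add: k' exp_tower_def)
    then have pos: "log_chain 0 i t > 0" if "t \<ge> ln (\<rho> / R)" "i \<le> k'" for t i
      using log_chain_zero_ge[of k' t i] exp_tower_ge_1[of "k' - i"] that by simp
    have pot: "inverse ((\<Prod>i=1..Suc j. iter_log i y)\<^sup>2) = (log_pot 0 j (ln y))\<^sup>2" for j y
    proof -
      have "(\<Prod>i=1..Suc j. iter_log i y) = (\<Prod>i\<le>j. log_chain 0 i (ln y))"
        unfolding One_nat_def prod.atLeast_Suc_atMost_Suc_shift
        by (simp add: iter_log_Suc_eq atMost_atLeast0)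
      then show ?thesis by (simp add: log_pot_def prod_inversef[unfolded o_def] power_inverse)
    qed
    have sum: "(\<Sum>j=1..k. f j) = (\<Sum>j\<le>k'. f (Suc j))" for f :: "nat \<Rightarrow> ennreal"
      unfolding k' One_nat_def sum.atLeast_Suc_atMost_Suc_shift by (simp add: atMost_atLeast0)
    show "(\<integral>\<^sup>+x. ennreal ((weak_laplacian \<Omega> u x)\<^sup>2) \<partial>lebesgue_on \<Omega>)
      \<ge> ennreal (n\<^sup>2 * (n - 4)\<^sup>2 / 16) *
          (\<integral>\<^sup>+x. ennreal ((u x)\<^sup>2 / norm x ^ 4) \<partial>lebesgue_on \<Omega>)
        + ennreal (1 + n * (n - 4) / 8) *
          (\<Sum>j=1..k. \<integral>\<^sup>+x. ennreal ((u x)\<^sup>2 / norm x ^ 4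
              * inverse ((\<Prod>i=1..j. iter_log i (\<rho> / norm x))\<^sup>2)) \<partial>lebesgue_on \<Omega>)"
      unfolding sum pot using k R e by (intro core pos) auto
  next
    fix D assume D: "D \<ge> R"
    \<comment> \<open>Then \<open>1 - ln (|x| / D) = ln (\<rho> / |x|)\<close>, and
      \<open>D \<ge> R\<close> gives \<open>t \<ge> 1\<close>, which keeps the chain members of
      every index at least 1.\<close>
    define \<rho> where "\<rho> = exp 1 * D"
    have \<rho>: "\<rho> > 0" using D R by (simp add: \<rho>_def)
    have "ln (\<rho> / R) \<ge> 1"
    proof -
      have "exp 1 \<le> \<rho> / R" using D R by (simp add: \<rho>_def field_simps)
      then show ?thesis using R \<rho> by (simp add: ln_ge_iff)
    qed
    then have pos: "log_chain 1 i t > 0" if "t \<ge> ln (\<rho> / R)" for t i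
      using log_chain_one_ge[of t i] that by linarith
    let ?I = "\<lambda>i. \<integral>\<^sup>+x. ennreal ((u x)\<^sup>2 / norm x ^ 4 * (\<Prod>j=1..Suc i. (X j (norm x / D))\<^sup>2)) \<partial>lebesgue_on \<Omega>"
    have pot: "(u x)\<^sup>2 / norm x ^ 4 * (\<Prod>j=1..Suc i. (X j (norm x / D))\<^sup>2)
        = (u x)\<^sup>2 / norm x ^ 4 * (log_pot 1 i (ln (\<rho> / norm x)))\<^sup>2" for i x
    proof (cases "x = 0")
      case False
      have "1 - ln (norm x / D) = ln (\<rho> / norm x)"
        using False D R by (simp add: \<rho>_def ln_div ln_mult)
      then have "(\<Prod>j=1..Suc i. (X j (norm x / D))\<^sup>2) = (log_pot 1 i (ln (\<rho> / norm x)))\<^sup>2"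
        unfolding One_nat_def prod.atLeast_Suc_atMost_Suc_shift
        by (simp add: X_Suc_eq atMost_atLeast0 log_pot_def prod_power_distrib)
      then show ?thesis by simp
    qed simp
    \<comment> \<open>Every partial sum is bounded by the same energy, so the bound survives the
      limit in \<open>[0, \<infinity>]\<close>.\<close>
    define F where "F N = ennreal (n\<^sup>2 * (n - 4)\<^sup>2 / 16) * (\<integral>\<^sup>+x. ennreal ((u x)\<^sup>2 / norm x ^ 4) \<partial>lebesgue_on \<Omega>)
        + ennreal (1 + n * (n - 4) / 8) * (\<Sum>i\<le>N. ?I i)" for N
    have "F N \<le> (\<integral>\<^sup>+x. ennreal ((weak_laplacian \<Omega> u x)\<^sup>2) \<partial>lebesgue_on \<Omega>)" for N
      unfolding F_def pot by (intro core \<rho> pos)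
    moreover have "F \<longlonglongrightarrow> ennreal (n\<^sup>2 * (n - 4)\<^sup>2 / 16) * (\<integral>\<^sup>+x. ennreal ((u x)\<^sup>2 / norm x ^ 4) \<partial>lebesgue_on \<Omega>)
        + ennreal (1 + n * (n - 4) / 8) * (\<Sum>i. ?I i)"
      unfolding F_def by (intro tendsto_add tendsto_const ennreal_tendsto_cmult summable_LIMSEQ' summableI) auto
    ultimately show "(\<integral>\<^sup>+x. ennreal ((weak_laplacian \<Omega> u x)\<^sup>2) \<partial>lebesgue_on \<Omega>)
      \<ge> ennreal (n\<^sup>2 * (n - 4)\<^sup>2 / 16) * (\<integral>\<^sup>+x. ennreal ((u x)\<^sup>2 / norm x ^ 4) \<partial>lebesgue_on \<Omega>)
        + ennreal (1 + n * (n - 4) / 8) * (\<Sum>i. ?I i)"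
      by (intro LIMSEQ_le_const2) auto
  }
qed

end
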